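(* Let $(M^7,g,\omega^3)$ be a $7$-dimensional manifold with an integrable $\mathrm{G}_2$-structure with fundamental $3$-form $\omega^3$ and Lee form $\theta$, i.e. $d*\omega^3=\theta\wedge *\omega^3$. Then the Riemannian scalar curvature $\mathrm{Scal}^g$ of $g$ is given by $$\mathrm{Scal}^g = \frac{1}{18}(d\omega^3,*\omega^3)^2 + 2\|\theta\|^2 - \frac{1}{12}\|T\|^2 + 3\,\delta\theta ,$$ where $\theta$ and $T$ are the Lee form and the torsion of the unique linear connection with totally skew-symmetric torsion preserving the $\mathrm{G}_2$-structure, given by $$T=-*d\omega^3+\frac16 (d\omega^3,*\omega^3)\cdot\omega^3+*(\theta\wedge\omega^3),\qquad \theta=-\frac13 *( *d\omega^3\wedge\omega^3)=-\frac13 *(\delta\omega^3\wedge *\omega^3).$$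
   Context: A $\mathrm{G}_2$-structure on a smooth $7$-manifold $M^7$ is a $3$-form $\omega^3$ which near every point can be written, in some local coframe $e_1,\dots,e_7$, as $$\omega^3=e_{127}+e_{135}-e_{146}-e_{236}-e_{245}+e_{347}+e_{567},\qquad e_{ijk}=e_i\wedge e_j\wedge e_k .$$ It determines a Riemannian metric $g$ and an orientation for which such coframes are orthonormal and oriented ($\mathrm{vol}=e_1\wedge\dots\wedge e_7$). $*$ is the Hodge operator and $\delta$ the codifferential (formal $L^2$-adjoint of $d$); in dimension $7$, $\delta=-*d*$ on $1$-forms and on $3$-forms. The Lee form of a $\mathrm{G}_2$-structure is the $1$-form $\theta=-\frac13 *( *d\omega^3\wedge\omega^3)$. The structure is integrable if $d*\omega^3=\theta\wedge *\omega^3$. It is known that a $\mathrm{G}_2$-structure is integrable if and only if there is a linear connection $\nabla$ with $\nabla g=0$, $\nabla\omega^3=0$ and totally skew-symmetric torsion $T$ (i.e. $T(X,Y,Z)=g(T(X,Y),Z)$ is a $3$-form), and then $\nabla$ is unique; $g(\nabla_XY,Z)=g(\nabla^g_XY,Z)+\frac12T(X,Y,Z)$ with $\nabla^g$ the Levi-Civita connection. Norm conventions: $(\cdot,\cdot)$ is the inner product on $k$-forms for which the monomials $e_{i_1}\wedge\dots\wedge e_{i_k}$, $i_1<\dots<i_k$, are orthonormal (so $( *\omega^3,*\omega^3)=7$); $\|\theta\|$ is the usual norm of a $1$-form; for a $3$-form, $\|T\|^2=\sum_{i,j,k=1}^7 T(e_i,e_j,e_k)^2$ (sum over all indices). *)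

theory Defs
  imports "HOL-Analysis.Analysis"
begin

section \<open>Smooth 7-manifolds\<close>

primrec times_diff_on :: "nat \<Rightarrow> 'a::euclidean_space set \<Rightarrow> ('a \<Rightarrow> 'b::real_normed_vector) \<Rightarrow> bool" where
  "times_diff_on 0 S f \<longleftrightarrow> continuous_on S f"
| "times_diff_on (Suc n) S f \<longleftrightarrow>
     (\<forall>x\<in>S. f differentiable (at x)) \<and>
     (\<forall>v. times_diff_on n S (\<lambda>x. frechet_derivative f (at x) v))"

text \<open>\<open>C\<^sup>\<infinity>\<close>; used only for open \<open>S\<close>.\<close>
definition smooth_on :: "'a::euclidean_space set \<Rightarrow> ('a \<Rightarrow> 'b::real_normed_vector) \<Rightarrow> bool" where
  "smooth_on S f \<longleftrightarrow> (\<forall>n. times_diff_on n S f)"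

type_synonym vec7 = "real^7"

text \<open>A chart \<open>(U, \<phi>)\<close> consists of its domain and its coordinate map.\<close>
type_synonym 'm chart = "'m set \<times> ('m \<Rightarrow> vec7)"

definition chart_image :: "'m chart \<Rightarrow> vec7 set" where
  "chart_image c = snd c ` fst c"

definition overlap :: "'m chart \<Rightarrow> 'm chart \<Rightarrow> vec7 set" where
  "overlap c c' = snd c ` (fst c \<inter> fst c')"

definition transition :: "'m chart \<Rightarrow> 'm chart \<Rightarrow> vec7 \<Rightarrow> vec7" where
  "transition c c' = snd c' \<circ> inv_into (fst c) (snd c)"

definition smooth_atlas :: "'m topology \<Rightarrow> 'm chart set \<Rightarrow> bool" where
  "smooth_atlas X A \<longleftrightarrow>
     (\<forall>c\<in>A. openin X (fst c) \<and> open (chart_image c) \<and>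
        homeomorphic_map (subtopology X (fst c)) (top_of_set (chart_image c)) (snd c)) \<and>
     \<Union> (fst ` A) = topspace X \<and>
     (\<forall>c\<in>A. \<forall>c'\<in>A. smooth_on (overlap c c') (transition c c'))"

definition smooth_manifold :: "'m topology \<Rightarrow> 'm chart set \<Rightarrow> bool" where
  "smooth_manifold X A \<longleftrightarrow> Hausdorff_space X \<and> second_countable X \<and> smooth_atlas X A"

section \<open>Tensor fields and exterior calculus in a chart\<close>

text \<open>
  A \<open>k\<close>-form at a point is an alternating multilinear function on lists of \<open>k\<close> vectors, extended
  by \<open>0\<close> to lists of any other length, so that the operations below need no degree arguments.
  A field lives on a chart image; a tensor field on the manifold is a family of such
  local representatives, indexed by the charts of the atlas and compatible with
  the transition maps.
\<close>
type_synonym field = "vec7 \<Rightarrow> vec7 list \<Rightarrow> real"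
type_synonym metric = "vec7 \<Rightarrow> vec7 \<Rightarrow> vec7 \<Rightarrow> real"
type_synonym christoffel = "vec7 \<Rightarrow> vec7 \<Rightarrow> vec7 \<Rightarrow> vec7"

definition alternating_form :: "nat \<Rightarrow> (vec7 list \<Rightarrow> real) \<Rightarrow> bool" where
  "alternating_form k \<alpha> \<longleftrightarrow>
     (\<forall>vs. length vs \<noteq> k \<longrightarrow> \<alpha> vs = 0) \<and>
     (\<forall>vs i. length vs = k \<and> i < k \<longrightarrow> linear (\<lambda>v. \<alpha> (vs[i := v]))) \<and>
     (\<forall>vs i j. length vs = k \<and> i < j \<and> j < k \<and> vs ! i = vs ! j \<longrightarrow> \<alpha> vs = 0)"

definition smooth_form_on :: "nat \<Rightarrow> vec7 set \<Rightarrow> field \<Rightarrow> bool" where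
  "smooth_form_on k S \<alpha> \<longleftrightarrow>
     (\<forall>x\<in>S. alternating_form k (\<alpha> x)) \<and> (\<forall>vs. smooth_on S (\<lambda>x. \<alpha> x vs))"

text \<open>Sum over all \<open>(k,l)\<close>-shuffles, with \<open>I\<close> the set of positions fed to the first
  factor; normalised so that \<open>(\<alpha> \<and> \<beta>)(u,v) = \<alpha>(u) \<beta>(v) - \<alpha>(v) \<beta>(u)\<close> for 1-forms.\<close>
definition wedge :: "field \<Rightarrow> field \<Rightarrow> field" (infixr "\<and>\<^sub>f" 71) where
  "(\<alpha> \<and>\<^sub>f \<beta>) x vs =
     (\<Sum>I\<in>Pow {..<length vs}.
        (-1) ^ card {(i, j). i \<in> I \<and> j \<notin> I \<and> j < i} * \<alpha> x (nths vs I) * \<beta> x (nths vs (- I)))"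

definition ext_deriv :: "field \<Rightarrow> field" where
  "ext_deriv \<alpha> x vs =
     (\<Sum>i<length vs. (-1) ^ i *
        frechet_derivative (\<lambda>y. \<alpha> y (take i vs @ drop (Suc i) vs)) (at x) (vs ! i))"

text \<open>An arbitrarily chosen orthonormal basis of the tangent space at \<open>x\<close>; everything
  defined from it below is independent of the choice.\<close>
definition onb :: "metric \<Rightarrow> vec7 \<Rightarrow> 7 \<Rightarrow> vec7" where
  "onb g x = (SOME E. \<forall>i j. g x (E i) (E j) = (if i = j then 1 else 0))"

text \<open>Summing over all multi-indices and dividing by \<open>k!\<close> is summing over increasing
  ones, i.e. the monomials in an orthonormal coframe are orthonormal.\<close>
definition form_inner :: "nat \<Rightarrow> metric \<Rightarrow> field \<Rightarrow> field \<Rightarrow> vec7 \<Rightarrow> real" where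
  "form_inner k g \<alpha> \<beta> x =
     (\<Sum>is | length is = k. \<alpha> x (map (onb g x) is) * \<beta> x (map (onb g x) is)) / fact k"

definition tensor3_norm_sq :: "metric \<Rightarrow> field \<Rightarrow> vec7 \<Rightarrow> real" where
  "tensor3_norm_sq g T x =
     (\<Sum>i\<in>UNIV. \<Sum>j\<in>UNIV. \<Sum>k\<in>UNIV. (T x [onb g x i, onb g x j, onb g x k])\<^sup>2)"

text \<open>\<open>*(e\<^sub>1 \<and> \<dots> \<and> e\<^sub>k) = e\<^sub>k\<^sub>+\<^sub>1 \<and> \<dots> \<and> e\<^sub>7\<close> for oriented orthonormal coframes,
  equivalently \<open>\<alpha> \<and> *\<beta> = (\<alpha>,\<beta>) vol\<close>; the degree \<open>k\<close> of \<open>\<alpha>\<close> is read off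
  from the number of arguments of \<open>*\<alpha>\<close>.\<close>
definition hodge :: "metric \<Rightarrow> field \<Rightarrow> field \<Rightarrow> field" where
  "hodge g vol \<alpha> x vs =
     (let k = 7 - length vs in
        (\<Sum>is | length is = k. \<alpha> x (map (onb g x) is) * vol x (map (onb g x) is @ vs)) / fact k)"

text \<open>The sign is the one for forms of odd degree in dimension 7.\<close>
definition codiff :: "metric \<Rightarrow> field \<Rightarrow> field \<Rightarrow> field" where
  "codiff g vol \<alpha> x vs = - hodge g vol (ext_deriv (hodge g vol \<alpha>)) x vs"

section \<open>Curvature\<close>

text \<open>A connection is given in a chart by \<open>\<Gamma>\<close> with
  \<open>\<nabla>\<^sub>u V = D\<^sub>u V + \<Gamma>(u, V)\<close>. For the Levi-Civita connection, \<open>\<Gamma>\<close> comes from the Koszul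
  formula for coordinate vector fields.\<close>
definition levi_civita :: "metric \<Rightarrow> christoffel" where
  "levi_civita g x u v =
     (\<Sum>i\<in>UNIV.
        ((frechet_derivative (\<lambda>y. g y v (onb g x i)) (at x) u
          + frechet_derivative (\<lambda>y. g y u (onb g x i)) (at x) v
          - frechet_derivative (\<lambda>y. g y u v) (at x) (onb g x i)) / 2) *\<^sub>R onb g x i)"

text \<open>\<open>R(u,v)w = \<nabla>\<^sub>u \<nabla>\<^sub>v w - \<nabla>\<^sub>v \<nabla>\<^sub>u w - \<nabla>\<^bsub>[u,v]\<^esub> w\<close> for constant \<open>u\<close>, \<open>v\<close>, \<open>w\<close>.\<close>
definition curvature :: "christoffel \<Rightarrow> vec7 \<Rightarrow> vec7 \<Rightarrow> vec7 \<Rightarrow> vec7 \<Rightarrow> vec7" where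
  "curvature \<Gamma> x u v w =
     frechet_derivative (\<lambda>y. \<Gamma> y v w) (at x) u - frechet_derivative (\<lambda>y. \<Gamma> y u w) (at x) v
     + \<Gamma> x u (\<Gamma> x v w) - \<Gamma> x v (\<Gamma> x u w)"

definition scalar_curvature :: "metric \<Rightarrow> vec7 \<Rightarrow> real" where
  "scalar_curvature g x =
     (\<Sum>i\<in>UNIV. \<Sum>j\<in>UNIV.
        g x (curvature (levi_civita g) x (onb g x i) (onb g x j) (onb g x j)) (onb g x i))"

section \<open>Global objects\<close>

definition differential_form :: "'m chart set \<Rightarrow> nat \<Rightarrow> ('m chart \<Rightarrow> field) \<Rightarrow> bool" where
  "differential_form A k \<alpha> \<longleftrightarrow>
     (\<forall>c\<in>A. smooth_form_on k (chart_image c) (\<alpha> c)) \<and>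
     (\<forall>c\<in>A. \<forall>c'\<in>A. \<forall>x\<in>overlap c c'. \<forall>vs.
        \<alpha> c x vs =
        \<alpha> c' (transition c c' x) (map (frechet_derivative (transition c c') (at x)) vs))"

definition riemannian_metric :: "'m chart set \<Rightarrow> ('m chart \<Rightarrow> metric) \<Rightarrow> bool" where
  "riemannian_metric A g \<longleftrightarrow>
     (\<forall>c\<in>A. (\<forall>u v. smooth_on (chart_image c) (\<lambda>x. g c x u v)) \<and>
        (\<forall>x\<in>chart_image c. bilinear (g c x) \<and> (\<forall>u v. g c x u v = g c x v u) \<and>
           (\<forall>v. v \<noteq> 0 \<longrightarrow> g c x v v > 0))) \<and>
     (\<forall>c\<in>A. \<forall>c'\<in>A. \<forall>x\<in>overlap c c'. \<forall>u v.
        g c x u v =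
        g c' (transition c c' x) (frechet_derivative (transition c c') (at x) u)
          (frechet_derivative (transition c c') (at x) v))"

text \<open>The second condition is the transformation law of Christoffel symbols.\<close>
definition linear_connection :: "'m chart set \<Rightarrow> ('m chart \<Rightarrow> christoffel) \<Rightarrow> bool" where
  "linear_connection A \<Gamma> \<longleftrightarrow>
     (\<forall>c\<in>A. (\<forall>u v. smooth_on (chart_image c) (\<lambda>x. \<Gamma> c x u v)) \<and>
        (\<forall>x\<in>chart_image c. bilinear (\<Gamma> c x))) \<and>
     (\<forall>c\<in>A. \<forall>c'\<in>A. \<forall>x\<in>overlap c c'. \<forall>u v.
        let \<tau> = transition c c'; D = (\<lambda>y. frechet_derivative \<tau> (at y)) in
        D x (\<Gamma> c x u v) =
        \<Gamma> c' (\<tau> x) (D x u) (D x v) + frechet_derivative (\<lambda>y. D y v) (at x) u)"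

definition parallel_metric_at :: "metric \<Rightarrow> christoffel \<Rightarrow> vec7 \<Rightarrow> bool" where
  "parallel_metric_at g \<Gamma> x \<longleftrightarrow>
     (\<forall>u v w. frechet_derivative (\<lambda>y. g y v w) (at x) u
        - g x (\<Gamma> x u v) w - g x v (\<Gamma> x u w) = 0)"

definition parallel_form_at :: "field \<Rightarrow> christoffel \<Rightarrow> vec7 \<Rightarrow> bool" where
  "parallel_form_at \<alpha> \<Gamma> x \<longleftrightarrow>
     (\<forall>u vs. frechet_derivative (\<lambda>y. \<alpha> y vs) (at x) u
        - (\<Sum>i<length vs. \<alpha> x (vs[i := \<Gamma> x u (vs ! i)])) = 0)"

text \<open>\<open>T(u,v,w) = g(\<nabla>\<^sub>u v - \<nabla>\<^sub>v u - [u,v], w)\<close> for constant \<open>u\<close>, \<open>v\<close>.\<close>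
definition torsion :: "metric \<Rightarrow> christoffel \<Rightarrow> field" where
  "torsion g \<Gamma> x vs =
     (if length vs = 3
      then g x (\<Gamma> x (vs ! 0) (vs ! 1) - \<Gamma> x (vs ! 1) (vs ! 0)) (vs ! 2) else 0)"

section \<open>\<open>G\<^sub>2\<close>-structures\<close>

definition coframe_on :: "vec7 set \<Rightarrow> (7 \<Rightarrow> field) \<Rightarrow> bool" where
  "coframe_on S e \<longleftrightarrow>
     (\<forall>i. smooth_form_on 1 S (e i)) \<and>
     (\<forall>x\<in>S. \<forall>v. (\<forall>i. e i x [v] = 0) \<longrightarrow> v = 0)"

definition e3 :: "(7 \<Rightarrow> field) \<Rightarrow> 7 \<Rightarrow> 7 \<Rightarrow> 7 \<Rightarrow> field" where
  "e3 e i j k = e i \<and>\<^sub>f e j \<and>\<^sub>f e k"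

text \<open>\<open>e\<close> is a coframe in which \<open>\<omega>\<close> has the normal form, and which is orthonormal for
  \<open>g\<close> and oriented with volume form \<open>vol\<close>. Note \<open>7 = 0\<close> in the index type.\<close>
definition adapted_coframe_on ::
    "vec7 set \<Rightarrow> field \<Rightarrow> metric \<Rightarrow> field \<Rightarrow> (7 \<Rightarrow> field) \<Rightarrow> bool" where
  "adapted_coframe_on S \<omega> g vol e \<longleftrightarrow> coframe_on S e \<and>
     (\<forall>x\<in>S.
        (\<forall>vs. \<omega> x vs = e3 e 1 2 7 x vs + e3 e 1 3 5 x vs - e3 e 1 4 6 x vs - e3 e 2 3 6 x vs
                      - e3 e 2 4 5 x vs + e3 e 3 4 7 x vs + e3 e 5 6 7 x vs) \<and>
        (\<forall>u v. g x u v = (\<Sum>i\<in>UNIV. e i x [u] * e i x [v])) \<and>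
        (\<forall>vs. vol x vs =
           (e 1 \<and>\<^sub>f e 2 \<and>\<^sub>f e 3 \<and>\<^sub>f e 4 \<and>\<^sub>f e 5 \<and>\<^sub>f e 6 \<and>\<^sub>f e 7) x vs))"

text \<open>\<open>g\<close> and \<open>vol\<close> (metric and orientation) are determined by \<open>\<omega>\<close>, since the
  stabiliser of the normal form lies in \<open>SO(7)\<close>.\<close>
definition G2_structure ::
    "'m chart set \<Rightarrow> ('m chart \<Rightarrow> field) \<Rightarrow> ('m chart \<Rightarrow> metric) \<Rightarrow> ('m chart \<Rightarrow> field) \<Rightarrow> bool" where
  "G2_structure A \<omega> g vol \<longleftrightarrow>
     differential_form A 3 \<omega> \<and> riemannian_metric A g \<and> differential_form A 7 vol \<and>
     (\<forall>c\<in>A. \<forall>x\<in>chart_image c. \<exists>S e. open S \<and> x \<in> S \<and> S \<subseteq> chart_image c \<and>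
        adapted_coframe_on S (\<omega> c) (g c) (vol c) e)"

definition lee_form :: "field \<Rightarrow> metric \<Rightarrow> field \<Rightarrow> field" where
  "lee_form \<omega> g vol x vs =
     - (1/3) * hodge g vol (hodge g vol (ext_deriv \<omega>) \<and>\<^sub>f \<omega>) x vs"

definition integrable_G2 ::
    "'m chart set \<Rightarrow> ('m chart \<Rightarrow> field) \<Rightarrow> ('m chart \<Rightarrow> metric) \<Rightarrow> ('m chart \<Rightarrow> field) \<Rightarrow> bool" where
  "integrable_G2 A \<omega> g vol \<longleftrightarrow>
     (\<forall>c\<in>A. \<forall>x\<in>chart_image c. \<forall>vs. length vs = 5 \<longrightarrow>
        ext_deriv (hodge (g c) (vol c) (\<omega> c)) x vs =
        (lee_form (\<omega> c) (g c) (vol c) \<and>\<^sub>f hodge (g c) (vol c) (\<omega> c)) x vs)"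

definition characteristic_connection ::
    "'m chart set \<Rightarrow> ('m chart \<Rightarrow> field) \<Rightarrow> ('m chart \<Rightarrow> metric) \<Rightarrow> ('m chart \<Rightarrow> christoffel) \<Rightarrow> bool" where
  "characteristic_connection A \<omega> g \<Gamma> \<longleftrightarrow> linear_connection A \<Gamma> \<and>
     (\<forall>c\<in>A. \<forall>x\<in>chart_image c.
        parallel_metric_at (g c) (\<Gamma> c) x \<and> parallel_form_at (\<omega> c) (\<Gamma> c) x \<and>
        alternating_form 3 (torsion (g c) (\<Gamma> c) x))"

end

theory Submission imports Defs begin

text \<open>
  All statements except the transformation law of the connection are local, so the argument takes place in
  the domain of one adapted coframe with dual frame \<open>E\<close>. In such a frame \<open>\<omega>\<close> and \<open>*\<omega>\<close> have
  constant components \<open>phi\<close> and \<open>psi\<close>, and all first-order information is contained in the array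
  \<open>a i j k\<close> by which the Levi-Civita connection differs from the flat connection that makes the frame
  parallel. The array is skew in \<open>j, k\<close> because both connections are metric. Since the
  Levi-Civita connection is torsion free, \<open>d\<omega>\<close>, \<open>d*\<omega>\<close>, the Lee form and the
  candidate torsion \<open>T\<close> are contractions of \<open>a\<close> with \<open>phi\<close> and \<open>psi\<close>
  (\<open>hodge_ext_deriv\<close>, \<open>star_ext_deriv_parallel\<close>).

  Two-forms split as \<open>7 + 14\<close>, where the \<open>14\<close> is the Lie algebra \<open>g\<^sub>2\<close>, the annihilator of
  \<open>\<omega>\<close>, and \<open>vec_part\<close> extracts the \<open>7\<close>. Write \<open>\<Gamma>\<close> for the Levi-Civita connection plus \<open>T / 2\<close>.
  Integrability implies that \<open>a + T / 2\<close> has no part in the \<open>7\<close>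
  (\<open>vec_part_char_connection\<close>), so \<open>\<Gamma>\<close> preserves \<open>\<omega>\<close>. Two connections with skew torsion that
  preserve \<open>g\<close> and \<open>\<omega>\<close> differ by a three-form all of whose slices lie in \<open>g\<^sub>2\<close>, and such
  a form vanishes (\<open>g2_torsion_eq_0\<close>). This gives existence and uniqueness of the characteristic connection.

  For the scalar curvature, the curvature of \<open>\<Gamma>\<close> is \<open>g\<^sub>2\<close>-valued, and on \<open>g\<^sub>2\<close>
  contraction with \<open>psi\<close> is a multiple of the identity. Hence the full trace of the curvature is half of
  its contraction with \<open>psi\<close> (\<open>curvature_trace\<close>). That contraction only sees the cyclic sum in the
  first Bianchi identity, which expresses it by the derivative of \<open>T\<close> and a quadratic form \<open>qform T\<close>
  (\<open>bianchi_contraction\<close>). Because \<open>\<Gamma>\<close> preserves \<open>psi\<close> and \<open>T\<close> contracts with \<open>psi\<close> to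
  \<open>- 6 \<theta>\<close>, the derivative term is \<open>6 \<delta>\<theta>\<close> plus another multiple of \<open>qform T\<close>
  (\<open>divergence_contraction\<close>). Altogether the full trace of the curvature of \<open>\<Gamma>\<close> is
  \<open>3 \<delta>\<theta> + qform T / 2\<close>.

  Finally \<open>qform T\<close> is a combination of \<open>\<parallel>T\<parallel>\<^sup>2\<close>, \<open>(d\<omega>, *\<omega>)\<^sup>2\<close> and
  \<open>\<parallel>\<theta>\<parallel>\<^sup>2\<close> (\<open>T_norm\<close>), and the Riemannian scalar curvature exceeds the one of \<open>\<Gamma>\<close> by
  \<open>\<parallel>T\<parallel>\<^sup>2 / 4\<close> (\<open>sectional_curvature_relation\<close>). Solving for \<open>qform T\<close> gives the formula.

  The local connections fit together because the characteristic connection is unique at each point: the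
  pull-back of a characteristic connection along a transition map, with the inhomogeneous second-derivative
  term, is again characteristic (\<open>characteristic_at_pullback\<close>).
\<close>

section \<open>Structure constants of the \<open>G\<^sub>2\<close> three-form\<close>

lemma UNIV_7: "(UNIV :: 7 set) = {1,2,3,4,5,6,7}"
proof -
  have "card {1,2,3,4,5,6,7::7} = CARD(7)" by simp
  then show ?thesis by (metis card_subset_eq finite_class.finite_UNIV subset_UNIV)
qed
text \<open>Lets the simplifier check an identity of structure constants index by index.\<close>
lemma forall_7: "(\<forall>i::7. P i) \<longleftrightarrow> P 1 \<and> P 2 \<and> P 3 \<and> P 4 \<and> P 5 \<and> P 6 \<and> P 7"
  using UNIV_7 by (metis (no_types, lifting) UNIV_I insert_iff singletonD)

definition dl :: "7 \<Rightarrow> 7 \<Rightarrow> real" where "dl i j = (if i = j then 1 else 0)"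

text \<open>The component \<open>(e\<^sub>a \<and> e\<^sub>b \<and> e\<^sub>c)(E\<^sub>i, E\<^sub>j, E\<^sub>k)\<close> for a dual pair of frame and coframe.\<close>
definition det3 :: "7 \<Rightarrow> 7 \<Rightarrow> 7 \<Rightarrow> 7 \<Rightarrow> 7 \<Rightarrow> 7 \<Rightarrow> real" where
  "det3 a b c i j k = dl a i * dl b j * dl c k + dl a j * dl b k * dl c i + dl a k * dl b i * dl c j
     - dl a i * dl b k * dl c j - dl a j * dl b i * dl c k - dl a k * dl b j * dl c i"

definition phi :: "7 \<Rightarrow> 7 \<Rightarrow> 7 \<Rightarrow> real" where
  "phi i j k = det3 1 2 7 i j k + det3 1 3 5 i j k - det3 1 4 6 i j k - det3 2 3 6 i j k
     - det3 2 4 5 i j k + det3 3 4 7 i j k + det3 5 6 7 i j k"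

lemma dl_sym: "dl i j = dl j i" by (simp add: dl_def)
lemma dl_self [simp]: "dl i i = 1" by (simp add: dl_def)
lemma sum_dl [simp]: "(\<Sum>k\<in>UNIV. dl i k * f k) = f i" "(\<Sum>k\<in>UNIV. dl k i * f k) = f i"
  "(\<Sum>k\<in>UNIV. f k * dl i k) = f i" "(\<Sum>k\<in>UNIV. f k * dl k i) = f i"
  by (simp_all add: dl_def if_distrib[of "\<lambda>x. x * _"] if_distrib[of "\<lambda>x. _ * x"] cong: if_cong)

lemma phi_cyc: "phi i j k = phi j k i"
  by (simp add: phi_def det3_def)
lemma phi_skew: "phi j i k = - phi i j k"
  by (simp add: phi_def det3_def)

lemma dl_rows: 
  "dl 1 2 = 0" "dl 1 3 = 0" "dl 1 4 = 0" "dl 1 5 = 0" "dl 1 6 = 0" "dl 1 7 = 0"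
  "dl 2 3 = 0" "dl 2 4 = 0" "dl 2 5 = 0" "dl 2 6 = 0" "dl 2 7 = 0"
  "dl 3 4 = 0" "dl 3 5 = 0" "dl 3 6 = 0" "dl 3 7 = 0"
  "dl 4 5 = 0" "dl 4 6 = 0" "dl 4 7 = 0" "dl 5 6 = 0" "dl 5 7 = 0" "dl 6 7 = 0"
  by (simp_all add: dl_def)
lemmas dl_eval = dl_rows dl_rows[THEN trans[OF dl_sym]]

text \<open>The rows of a multiplication table of the imaginary octonions, as functions of the last index. In this form
  the simplifier can contract products of \<open>phi\<close> without enumerating the summation index.\<close>
lemma phi_row:
  "phi 1 2 = dl 7" "phi 1 3 = dl 5" "phi 1 4 = (\<lambda>k. - dl 6 k)" "phi 1 5 = (\<lambda>k. - dl 3 k)" 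
  "phi 1 6 = dl 4" "phi 1 7 = (\<lambda>k. - dl 2 k)" "phi 2 3 = (\<lambda>k. - dl 6 k)" "phi 2 4 = (\<lambda>k. - dl 5 k)"
  "phi 2 5 = dl 4" "phi 2 6 = dl 3" "phi 2 7 = dl 1" "phi 3 4 = dl 7" "phi 3 5 = dl 1"
  "phi 3 6 = (\<lambda>k. - dl 2 k)" "phi 3 7 = (\<lambda>k. - dl 4 k)" "phi 4 5 = (\<lambda>k. - dl 2 k)" 
  "phi 4 6 = (\<lambda>k. - dl 1 k)" "phi 4 7 = dl 3" "phi 5 6 = dl 7" "phi 5 7 = (\<lambda>k. - dl 6 k)" "phi 6 7 = dl 5"
  by (rule ext; simp add: phi_def det3_def dl_eval)+

lemma phi_diag: "phi i i = (\<lambda>k. 0)"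
  by (rule ext) (use phi_skew[of i i] in simp)
lemma phi_skew_fun: "phi j i = (\<lambda>k. - phi i j k)" by (rule ext) (rule phi_skew)
lemmas phi_rows = phi_row phi_row[THEN arg_cong[of _ _ "\<lambda>f. (\<lambda>k. - f k :: real)"], THEN trans[OF phi_skew_fun]] phi_diag

text \<open>The components of \<open>*\<omega>\<close>, taken from the contraction identity for \<open>\<omega>\<close> with itself. That this
  is indeed the Hodge dual of \<open>\<omega>\<close> is the content of \<open>hodge_phi\<close> below.\<close>
definition psi :: "7 \<Rightarrow> 7 \<Rightarrow> 7 \<Rightarrow> 7 \<Rightarrow> real" where
  "psi i j a b = (\<Sum>k\<in>UNIV. phi i j k * phi a b k) - dl i a * dl j b + dl i b * dl j a"

lemma psi_skew12: "psi j i a b = - psi i j a b"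
  by (simp add: psi_def phi_skew[of j i] sum_negf)
lemma psi_pair: "psi a b i j = psi i j a b"
  by (simp add: psi_def dl_sym mult.commute)
lemma psi_skew34: "psi i j b a = - psi i j a b"
  by (metis psi_skew12 psi_pair)

text \<open>The one symmetry of \<open>psi\<close> that does not follow formally from those of \<open>phi\<close>. It expresses
  that octonions are alternative, and it is verified on all quadruples of indices.\<close>
lemma psi_skew23: "psi i a j b = - psi i j a b"
proof -
  have "\<forall>i j a b. psi i a j b = - psi i j a b"
    unfolding forall_7 psi_def by (simp add: phi_rows dl_eval sum_negf)
  then show ?thesis by blast
qed

abbreviation frame_sum :: "(7 \<Rightarrow> real) \<Rightarrow> real" (binder "\<Sigma>" 10) where
  "frame_sum f \<equiv> sum f UNIV"

lemma phi_perms: "phi y z x = phi x y z" "phi z x y = phi x y z" "phi y x z = - phi x y z"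
  "phi x z y = - phi x y z" "phi z y x = - phi x y z"
  by (metis phi_cyc, metis phi_cyc, rule phi_skew, metis phi_cyc phi_skew, metis phi_cyc phi_skew)

lemma phi_zero [simp]: "phi i i k = 0" "phi i k k = 0" "phi k i k = 0"
  using phi_skew[of i i k] phi_skew[of k k i] phi_perms[where x=k and y=k and z=i] by auto

lemma psi_zero [simp]: "psi i i a b = 0" "psi i a a b = 0" "psi a b i i = 0" "psi i a i b = 0"
    "psi i a b i = 0" "psi a i b i = 0"
  using psi_skew12[of i i a b] psi_skew23[of i a a b] psi_skew34[of a b i i]
    psi_skew23[of i i a b] psi_skew23[of i a b i] psi_skew34[of i a i b] psi_skew23[of a b i i] by auto

lemma psi_cyc3: "psi a b c k = psi b c a k" "psi k a b c = psi k b c a"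
  by (metis psi_skew12 psi_skew23 minus_minus, metis psi_skew34 psi_skew23 minus_minus)
lemma psi_cyc4: "psi b c k a = - psi a b c k"
  by (metis psi_cyc3(1) psi_skew34)

lemma phi_phi: "(\<Sigma> k. phi i j k * phi a b k) = dl i a * dl j b - dl i b * dl j a + psi i j a b"
  by (simp add: psi_def)

lemma phi_phi2: "(\<Sigma> j. \<Sigma> k. phi i j k * phi a j k) = 6 * dl i a"
  by (simp add: phi_phi sum.distrib sum_subtractf)

text \<open>Both sides come from contracting three copies of \<open>phi\<close> along a chain and evaluating the first or
  the second contraction with \<open>phi_phi\<close>.\<close>
lemma phi_psi_step: 
  "(\<Sigma> k. psi a b c k * phi k i j) = phi a b i * dl c j - phi a b j * dl c i - dl a c * phi b i j
     + dl b c * phi a i j - (\<Sigma> k. psi c i j k * phi k a b)"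
proof -
  have "(\<Sigma> k. psi a b c k * phi k i j)
      = (\<Sigma> k. \<Sigma> p. phi a b p * (phi c k p * phi k i j))
        - (\<Sigma> k. dl b k * (dl a c * phi k i j)) + (\<Sigma> k. dl a k * (dl b c * phi k i j))"
    unfolding psi_def by (simp add: algebra_simps sum.distrib sum_subtractf sum_distrib_left sum_distrib_right)
  also have "(\<Sigma> k. \<Sigma> p. phi a b p * (phi c k p * phi k i j))
      = (\<Sigma> p. phi a b p * (\<Sigma> k. phi p c k * phi i j k))"
    by (subst sum.swap) (simp add: sum_distrib_left phi_perms(1,2)[of c k p for k p] phi_perms(1,2)[of i j k for k])
  also have "\<dots> = (\<Sigma> p. (phi a b p * dl c j) * dl p i) - (\<Sigma> p. (phi a b p * dl c i) * dl p j)
      + (\<Sigma> p. phi a b p * psi p c i j)"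
    by (simp only: phi_phi) (simp add: algebra_simps sum.distrib sum_subtractf)
  also have "(\<Sigma> p. phi a b p * psi p c i j) = - (\<Sigma> k. psi c i j k * phi k a b)"
  proof -
    have "psi p c i j = - psi c i j p" "phi a b p = phi p a b" for p
      using psi_cyc4[where a = p and b = c and c = i and k = j] phi_cyc[of p a b] by simp_all
    then show ?thesis by (simp add: sum_negf mult.commute)
  qed
  finally show ?thesis by simp
qed

text \<open>Each use of the step identity reverses the sign of the unknown contraction and permutes its five indices.
  Together with the cyclic symmetry in \<open>a, b, c\<close>, five uses return to the original contraction; since five
  is odd, this determines it.\<close>
lemma phi_psi: "(\<Sigma> k. phi i j k * psi a b c k) = - dl i a * phi j b c - dl i b * phi a j c - dl i c * phi a b j
     + dl j a * phi i b c + dl j b * phi a i c + dl j c * phi a b i"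
proof -
  define X where "X a b c i j = (\<Sigma> k. psi a b c k * phi k i j)" for a b c i j
  have cyc: "X a b c i j = X b c a i j" for a b c i j
    unfolding X_def by (simp add: psi_cyc3(1)[of a b c])
  note step = phi_psi_step[folded X_def]
  have e1: "X a b c i j = phi a b i * dl c j - phi a b j * dl c i - dl a c * phi b i j
     + dl b c * phi a i j - X c i j a b" by (rule step)
  have e2: "X c i j a b = phi j c a * dl i b - phi j c b * dl i a - dl j i * phi c a b
     + dl c i * phi j a b - X i a b j c" using step[of j c i a b] cyc[of c i j] cyc[of i j c] by simp
  have e3: "X i a b j c = phi b i j * dl a c - phi b i c * dl a j - dl b a * phi i j c
     + dl i a * phi b j c - X a j c b i" using step[of b i a j c] cyc[of b i a] by simp
  have e4: "X a j c b i = phi c a b * dl j i - phi c a i * dl j b - dl c j * phi a b i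
     + dl a j * phi c b i - X j b i c a" using step[of c a j b i] cyc[of c a j] by simp
  have e5: "X j b i c a = phi i j c * dl b a - phi i j a * dl b c - dl i b * phi j c a
     + dl j b * phi i c a - X b c a i j" using step[of i j b c a] cyc[of i j b] by simp
  have "X b c a i j = X a b c i j" by (simp add: cyc[symmetric])
  with e1 e2 e3 e4 e5 have "2 * X a b c i j = (phi a b i * dl c j - phi a b j * dl c i - dl a c * phi b i j
     + dl b c * phi a i j) - (phi j c a * dl i b - phi j c b * dl i a - dl j i * phi c a b
     + dl c i * phi j a b) + (phi b i j * dl a c - phi b i c * dl a j - dl b a * phi i j c
     + dl i a * phi b j c) - (phi c a b * dl j i - phi c a i * dl j b - dl c j * phi a b i
     + dl a j * phi c b i) + (phi i j c * dl b a - phi i j a * dl b c - dl i b * phi j c a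
     + dl j b * phi i c a)" by simp
  moreover have "(\<Sigma> k. phi i j k * psi a b c k) = X a b c i j"
    unfolding X_def by (rule sum.cong) (simp_all add: phi_perms(2)[of _ i j] mult.commute)
  ultimately show ?thesis
    by (simp only: dl_sym[of c i] dl_sym[of c j] dl_sym[of b i] dl_sym[of b j] dl_sym[of a i] dl_sym[of a j]
        phi_perms[where x=a and y=b and z=i] phi_perms[where x=a and y=b and z=j] phi_perms[where x=b and y=c and z=j] phi_perms[where x=b and y=c and z=i]
        phi_perms[where x=a and y=c and z=i] phi_perms[where x=a and y=c and z=j] phi_perms[where x=a and y=i and z=j] phi_perms[where x=b and y=i and z=j] phi_perms[where x=c and y=i and z=j])
      (simp add: algebra_simps)
qed

lemma phi_psi2: "(\<Sigma> j. \<Sigma> k. phi i j k * psi a b j k) = 4 * phi i a b"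
  using phi_perms[where x = i and y = a and z = b]
  by (simp add: phi_psi sum.distrib sum_subtractf sum_negf)

lemma sum_rot3: "(\<Sigma> m. \<Sigma> p. \<Sigma> q. f m p q) = (\<Sigma> p. \<Sigma> q. \<Sigma> m. f m p q)"
  for f :: "7 \<Rightarrow> 7 \<Rightarrow> 7 \<Rightarrow> real"
  by (subst sum.swap) (rule sum.cong[OF refl], rule sum.swap)

lemma psi_psi3: "(\<Sigma> j. \<Sigma> k. \<Sigma> l. psi i j k l * psi a j k l) = 24 * dl i a"
proof -
  have "(\<Sigma> k. \<Sigma> l. psi i j k l * psi a j k l) = 4 * (\<Sigma> m. phi a j m * phi i j m)" for j
  proof -
    have "(\<Sigma> k. \<Sigma> l. psi i j k l * psi a j k l) = (\<Sigma> k. \<Sigma> l. \<Sigma> m. phi a j m * (phi m k l * psi i j k l))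
       - (\<Sigma> k. \<Sigma> l. dl j l * (dl a k * psi i j k l)) + (\<Sigma> k. \<Sigma> l. dl a l * (dl j k * psi i j k l))"
      unfolding psi_def[of a] by (simp add: algebra_simps sum.distrib sum_subtractf sum_distrib_left phi_perms(1)[of m k l for m k l])
    also have "\<dots> = (\<Sigma> k. \<Sigma> l. \<Sigma> m. phi a j m * (phi m k l * psi i j k l))"
      by simp
    also have "\<dots> = (\<Sigma> m. \<Sigma> k. \<Sigma> l. phi a j m * (phi m k l * psi i j k l))"
      by (rule sum_rot3[symmetric])
    also have "\<dots> = (\<Sigma> m. phi a j m * (4 * phi m i j))"
      by (simp only: sum_distrib_left[symmetric] phi_psi2)
    finally show ?thesis by (simp add: sum_distrib_left phi_perms(2)[of _ i j] mult_ac)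
  qed
  then have "(\<Sigma> j. \<Sigma> k. \<Sigma> l. psi i j k l * psi a j k l) = 4 * (\<Sigma> j. \<Sigma> m. phi a j m * phi i j m)"
    by (simp add: sum_distrib_left)
  then show ?thesis by (simp add: phi_phi2 dl_sym)
qed

section \<open>Skew matrices and the subalgebra \<open>g\<^sub>2\<close>\<close>

lemma sum_contract: "(\<Sigma> p. \<Sigma> q. B p q * (dl p i * G q)) = (\<Sigma> q. B i q * G q)"
    "(\<Sigma> p. \<Sigma> q. B p q * (dl q i * G' p)) = (\<Sigma> p. B p i * G' p)"
proof -
  have "B p q * (dl p i * G q) = dl p i * (B p q * G q)" for p q by simp
  then show "(\<Sigma> p. \<Sigma> q. B p q * (dl p i * G q)) = (\<Sigma> q. B i q * G q)"
    by (simp only: sum_distrib_left[symmetric] sum_dl)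
  have "B p q * (dl q i * G' p) = dl q i * (B p q * G' p)" for p q by simp
  then show "(\<Sigma> p. \<Sigma> q. B p q * (dl q i * G' p)) = (\<Sigma> p. B p i * G' p)"
    by (simp only: sum_dl)
qed

text \<open>Contraction of a two-form with \<open>\<omega>\<close>. For skew \<open>B\<close> it captures the seven-dimensional summand of
  \<open>\<Lambda>\<^sup>2 = 7 + 14\<close>, and its kernel is the Lie algebra \<open>g\<^sub>2\<close>.\<close>
definition vec_part :: "(7 \<Rightarrow> 7 \<Rightarrow> real) \<Rightarrow> 7 \<Rightarrow> real" where
  "vec_part B a = (\<Sigma> j. \<Sigma> k. B j k * phi j k a)"

text \<open>The derivation induced by a matrix on covariant tensors of rank 3, and below of rank 4.\<close>
definition act3 :: "(7 \<Rightarrow> 7 \<Rightarrow> real) \<Rightarrow> (7 \<Rightarrow> 7 \<Rightarrow> 7 \<Rightarrow> real) \<Rightarrow> 7 \<Rightarrow> 7 \<Rightarrow> 7 \<Rightarrow> real" where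
  "act3 B f i j k = (\<Sigma> m. B i m * f m j k + B j m * f i m k + B k m * f i j m)"

definition act4 :: "(7 \<Rightarrow> 7 \<Rightarrow> real) \<Rightarrow> (7 \<Rightarrow> 7 \<Rightarrow> 7 \<Rightarrow> 7 \<Rightarrow> real) \<Rightarrow> 7 \<Rightarrow> 7 \<Rightarrow> 7 \<Rightarrow> 7 \<Rightarrow> real" where
  "act4 B f i j k l =
     (\<Sigma> m. B i m * f m j k l + B j m * f i m k l + B k m * f i j m l + B l m * f i j k m)"

text \<open>The infinitesimal action of \<open>so(7)\<close> on \<open>\<omega>\<close> factors through the seven-dimensional summand, since
  \<open>g\<^sub>2\<close> annihilates \<open>\<omega>\<close>.\<close>
lemma act3_phi:
  assumes skew: "\<And>j k. B k j = - B j k"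
  shows "act3 B phi i j k = 1/2 * (\<Sigma> m. vec_part B m * psi m i j k)"
proof -
  have "(\<Sigma> m. vec_part B m * psi m i j k) = (\<Sigma> m. \<Sigma> p. \<Sigma> q. B p q * (phi p q m * psi m i j k))"
    unfolding vec_part_def by (simp add: sum_distrib_right mult.assoc)
  also have "\<dots> = (\<Sigma> p. \<Sigma> q. B p q * (\<Sigma> m. phi p q m * psi m i j k))"
    unfolding sum_distrib_left by (rule sum_rot3)
  also have "\<dots> = (\<Sigma> p. \<Sigma> q. B p q * (dl p i * phi q j k)) + (\<Sigma> p. \<Sigma> q. B p q * (dl p j * phi i q k))
      + (\<Sigma> p. \<Sigma> q. B p q * (dl p k * phi i j q)) - (\<Sigma> p. \<Sigma> q. B p q * (dl q i * phi p j k))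
      - (\<Sigma> p. \<Sigma> q. B p q * (dl q j * phi i p k)) - (\<Sigma> p. \<Sigma> q. B p q * (dl q k * phi i j p))"
  proof -
    have "psi m i j k = - psi i j k m" for m
      using psi_cyc4[where a = m and b = i and c = j and k = k] by simp
    then have "(\<Sigma> m. phi p q m * psi m i j k) = - (\<Sigma> m. phi p q m * psi i j k m)" for p q
      by (simp add: sum_negf)
    then have "B p q * (\<Sigma> m. phi p q m * psi m i j k) = B p q * (dl p i * phi q j k) + B p q * (dl p j * phi i q k)
      + B p q * (dl p k * phi i j q) - B p q * (dl q i * phi p j k) - B p q * (dl q j * phi i p k)
      - B p q * (dl q k * phi i j p)" for p q
      unfolding phi_psi by (simp add: right_diff_distrib distrib_left)
    then show ?thesis by (simp only: sum.distrib sum_subtractf)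
  qed
  also have "\<dots> = 2 * act3 B phi i j k"
  proof -
    have "B p i = - B i p" "B p j = - B j p" "B p k = - B k p" for p by (rule skew)+
    then show ?thesis unfolding sum_contract act3_def by (simp add: sum_negf sum.distrib)
  qed
  finally show ?thesis by simp
qed

lemma act4_psi:
  assumes skew: "\<And>j k. B k j = - B j k"
  shows "act4 B psi i j k l = - 1/2 * (vec_part B i * phi j k l - vec_part B j * phi i k l
            + vec_part B k * phi i j l - vec_part B l * phi i j k)"
proof -
  let ?v = "vec_part B"
  define P where "P i j p = (\<Sigma> m. B i m * phi m j p) - (\<Sigma> m. B j m * phi m i p)" for i j p
  have P: "P i j p = 1/2 * (\<Sigma> m. ?v m * psi m i j p) - (\<Sigma> m. B p m * phi i j m)" for i j p
  proof -
    have "phi i m p = - phi m i p" for m by (rule phi_skew)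
    then show ?thesis
      using act3_phi[where B = B and i = i and j = j and k = p, OF skew] unfolding P_def act3_def by (simp add: sum.distrib sum_negf sum_subtractf)
  qed
  have one: "(\<Sigma> m. B i m * psi m j k l) = (\<Sigma> p. (\<Sigma> m. B i m * phi m j p) * phi k l p) - B i k * dl j l + B i l * dl j k"
    for i j k l
  proof -
    have "(\<Sigma> m. B i m * psi m j k l) = (\<Sigma> m. \<Sigma> p. B i m * phi m j p * phi k l p)
        - (\<Sigma> m. (B i m * dl j l) * dl m k) + (\<Sigma> m. (B i m * dl j k) * dl m l)"
      unfolding psi_def by (simp add: algebra_simps sum.distrib sum_subtractf sum_distrib_left)
    also have "(\<Sigma> m. \<Sigma> p. B i m * phi m j p * phi k l p) = (\<Sigma> p. \<Sigma> m. B i m * phi m j p * phi k l p)"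
      by (rule sum.swap)
    finally show ?thesis by (simp add: sum_distrib_right)
  qed
  have "act4 B psi i j k l = (\<Sigma> m. B i m * psi m j k l) - (\<Sigma> m. B j m * psi m i k l)
      + (\<Sigma> m. B k m * psi m l i j) - (\<Sigma> m. B l m * psi m k i j)"
  proof -
    have "psi i m k l = - psi m i k l" "psi i j m l = psi m l i j" "psi i j k m = - psi m k i j" for m
      by (rule psi_skew12, rule psi_pair, metis psi_pair psi_skew34)
    then show ?thesis
      unfolding act4_def by (simp only: sum.distrib sum_subtractf mult_minus_right add_uminus_conv_diff)
  qed
  also have "\<dots> = (\<Sigma> p. P i j p * phi k l p) + (\<Sigma> p. P k l p * phi i j p)"
    unfolding one P_def using skew[of k j] skew[of k i] skew[of l j] skew[of l i]
    by (simp add: left_diff_distrib sum_subtractf dl_sym[of k j] dl_sym[of k i] dl_sym[of l j] dl_sym[of l i])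
  also have "\<dots> = 1/2 * (\<Sigma> p. (\<Sigma> m. ?v m * psi m i j p) * phi k l p) + 1/2 * (\<Sigma> p. (\<Sigma> m. ?v m * psi m k l p) * phi i j p)
      - ((\<Sigma> p. \<Sigma> m. B p m * (phi i j m * phi k l p)) + (\<Sigma> p. \<Sigma> m. B p m * (phi k l m * phi i j p)))"
    unfolding P by (simp add: algebra_simps sum.distrib sum_subtractf sum_distrib_left sum_distrib_right)
  also have "(\<Sigma> p. \<Sigma> m. B p m * (phi k l m * phi i j p)) = - (\<Sigma> p. \<Sigma> m. B p m * (phi i j m * phi k l p))"
  proof -
    have "(\<Sigma> p. \<Sigma> m. B p m * (phi k l m * phi i j p)) = (\<Sigma> m. \<Sigma> p. B p m * (phi k l m * phi i j p))"
      by (rule sum.swap)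
    also have "\<dots> = - (\<Sigma> p. \<Sigma> m. B p m * (phi i j m * phi k l p))"
      unfolding sum_negf[symmetric]
    proof (intro sum.cong refl)
      fix p m show "B m p * (phi k l p * phi i j m) = - (B p m * (phi i j m * phi k l p))"
        using skew[of m p] by simp
    qed
    finally show ?thesis .
  qed
  finally have *: "act4 B psi i j k l = 1/2 * (\<Sigma> p. (\<Sigma> m. ?v m * psi m i j p) * phi k l p)
      + 1/2 * (\<Sigma> p. (\<Sigma> m. ?v m * psi m k l p) * phi i j p)" by simp
  have v: "(\<Sigma> p. (\<Sigma> m. ?v m * psi m i j p) * phi k l p) = - ?v k * phi l i j + ?v l * phi k i j
      + (\<Sigma> m. ?v m * (- dl k i * phi m l j - dl k j * phi m i l + dl l i * phi m k j + dl l j * phi m i k))" for i j k l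
  proof -
    have "(\<Sigma> p. (\<Sigma> m. ?v m * psi m i j p) * phi k l p) = (\<Sigma> m. ?v m * (\<Sigma> p. phi k l p * psi m i j p))"
      unfolding sum_distrib_right sum_distrib_left by (subst sum.swap) (simp add: mult_ac)
    also have "\<dots> = (\<Sigma> m. ?v m * (- dl k i * phi m l j - dl k j * phi m i l + dl l i * phi m k j + dl l j * phi m i k)
       - dl k m * (?v m * phi l i j) + dl l m * (?v m * phi k i j))"
      unfolding phi_psi by (rule sum.cong) (auto simp: algebra_simps)
    finally show ?thesis by (simp only: sum.distrib sum_subtractf sum_dl)
  qed
  have "(\<Sigma> m. ?v m * (- dl k i * phi m l j - dl k j * phi m i l + dl l i * phi m k j + dl l j * phi m i k))
      = - (\<Sigma> m. ?v m * (- dl i k * phi m j l - dl i l * phi m k j + dl j k * phi m i l + dl j l * phi m k i))"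
    unfolding sum_negf[symmetric]
  proof (rule sum.cong[OF refl])
    fix m
    show "?v m * (- dl k i * phi m l j - dl k j * phi m i l + dl l i * phi m k j + dl l j * phi m i k)
      = - (?v m * (- dl i k * phi m j l - dl i l * phi m k j + dl j k * phi m i l + dl j l * phi m k i))"
      using phi_perms(4)[where x = m and y = j and z = l] phi_perms(4)[where x = m and y = i and z = k]
      by (simp add: dl_sym[of k i] dl_sym[of k j] dl_sym[of l i] dl_sym[of l j] algebra_simps)
  qed
  with * show ?thesis unfolding v
    using phi_perms[where x = i and y = j and z = k] phi_perms[where x = i and y = j and z = l]
      phi_perms[where x = i and y = k and z = l] phi_perms[where x = j and y = k and z = l]
    by (simp add: algebra_simps)
qed

text \<open>Projection to the seven-dimensional summand, up to a factor, written as a combination of the identity and the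
  operator \<open>psi\<close> on two-forms. In particular that operator is \<open>- 2\<close> on \<open>g\<^sub>2\<close>.\<close>
lemma vec_part_phi:
  assumes skew: "\<And>j k. B k j = - B j k"
  shows "(\<Sigma> a. vec_part B a * phi a m n) = 2 * B m n + (\<Sigma> j. \<Sigma> k. psi j k m n * B j k)"
proof -
  have "(\<Sigma> a. vec_part B a * phi a m n) = (\<Sigma> j. \<Sigma> k. \<Sigma> a. B j k * (phi j k a * phi m n a))"
    unfolding vec_part_def sum_distrib_right by (subst sum_rot3) (simp add: phi_perms(2)[where x = m and y = n] mult.assoc)
  also have "\<dots> = (\<Sigma> j. \<Sigma> k. B j k * (dl j m * dl k n)) - (\<Sigma> j. \<Sigma> k. B j k * (dl j n * dl k m))
      + (\<Sigma> j. \<Sigma> k. psi j k m n * B j k)"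
    unfolding sum_distrib_left[symmetric] phi_phi
    by (simp only: distrib_left right_diff_distrib sum.distrib sum_subtractf mult.commute[of "psi _ _ _ _"])
  also have "\<dots> = 2 * B m n + (\<Sigma> j. \<Sigma> k. psi j k m n * B j k)"
    unfolding sum_contract using skew[of n m] by simp
  finally show ?thesis .
qed

text \<open>Two descriptions of \<open>g\<^sub>2\<close>: the kernel of contraction with \<open>\<omega>\<close>, and the annihilator of \<open>\<omega>\<close>.\<close>
lemma vec_part_eq_0_iff:
  assumes skew: "\<And>j k. B k j = - B j k"
  shows "(\<forall>a. vec_part B a = 0) \<longleftrightarrow> (\<forall>i j k. act3 B phi i j k = 0)"
proof
  assume *: "\<forall>i j k. act3 B phi i j k = 0"
  show "\<forall>a. vec_part B a = 0"
  proof
    fix n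
    have "0 = (\<Sigma> i. \<Sigma> j. \<Sigma> k. (\<Sigma> m. vec_part B m * psi m i j k) * psi n i j k)"
      using * act3_phi[where B = B, OF skew] by simp
    also have "\<dots> = (\<Sigma> i. \<Sigma> m. \<Sigma> j. \<Sigma> k. vec_part B m * (psi m i j k * psi n i j k))"
      unfolding sum_distrib_right by (subst sum_rot3[symmetric]) (simp add: mult.assoc)
    also have "\<dots> = (\<Sigma> m. vec_part B m * (\<Sigma> i. \<Sigma> j. \<Sigma> k. psi m i j k * psi n i j k))"
      unfolding sum_distrib_left by (rule sum.swap)
    also have "\<dots> = 24 * vec_part B n"
      unfolding psi_psi3 by (simp add: mult.left_commute[of _ 24] sum_distrib_left[symmetric])
    finally show "vec_part B n = 0" by simp
  qed
qed (simp add: act3_phi[where B = B, OF skew])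

section \<open>Torsion and Lee form at a point\<close>

lemma skew3_rules:
  fixes T :: "7 \<Rightarrow> 7 \<Rightarrow> 7 \<Rightarrow> real"
  assumes "\<And>i j k. T j i k = - T i j k" "\<And>i j k. T i k j = - T i j k"
  shows "T j k i = T i j k" "T k i j = T i j k" "T k j i = - T i j k" "T i i k = 0" "T i k k = 0" "T k i k = 0"
proof -
  show "T j k i = T i j k" "T k i j = T i j k" "T k j i = - T i j k" 
    by (metis assms minus_minus)+
  show "T i i k = 0" "T i k k = 0" using assms(1)[of i i k] assms(2)[of i k k] by auto
  then show "T k i k = 0" using assms(1)[of i k k] by auto
qed

text \<open>Algebraic form of the uniqueness of the characteristic connection. The equations \<open>T\<^sub>i \<cdot> \<omega> = 0\<close> contracted with \<open>\<omega>\<close> give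
  three terms; the first vanishes, the other two both equal \<open>- 3 T\<close>.\<close>
lemma g2_torsion_eq_0:
  assumes skew: "\<And>i j k. T j i k = - T i j k" "\<And>i j k. T i k j = - T i j k"
    and g2: "\<And>i a. vec_part (T i) a = 0"
  shows "T k l n = 0"
proof -
  note T = skew3_rules[of T, OF skew]
  have act0: "act3 (T i) phi j k l = 0" for i j k l
    using vec_part_eq_0_iff[of "T i", OF skew(2)] g2 by simp
  have psiT: "(\<Sigma> m. \<Sigma> i. psi m i l n * T k m i) = - 2 * T k l n" for k l n
    using vec_part_phi[of "T k" l n, OF skew(2)] g2 by simp
  have t1: "(\<Sigma> i. \<Sigma> j. \<Sigma> m. T i j m * phi m k l * phi i j n) = 0"
  proof -
    have "(\<Sigma> i. \<Sigma> j. \<Sigma> m. T i j m * phi m k l * phi i j n)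
        = (\<Sigma> m. \<Sigma> i. \<Sigma> j. phi m k l * (T m i j * phi i j n))"
      by (subst sum_rot3[symmetric]) (simp add: T(2)[symmetric] mult_ac)
    also have "\<dots> = (\<Sigma> m. phi m k l * vec_part (T m) n)"
      unfolding vec_part_def by (simp add: sum_distrib_left)
    finally show ?thesis using g2 by simp
  qed
  have t2: "(\<Sigma> i. \<Sigma> j. \<Sigma> m. T i k m * phi j m l * phi i j n) = - 3 * T k l n" for k l
  proof -
    have "(\<Sigma> i. \<Sigma> j. \<Sigma> m. T i k m * phi j m l * phi i j n)
        = (\<Sigma> i. \<Sigma> m. T k m i * (\<Sigma> j. phi m l j * phi n i j))"
      unfolding sum_distrib_left
    proof (rule sum.cong[OF refl])
      fix i
      have "(\<Sigma> j. \<Sigma> m. T i k m * phi j m l * phi i j n) = (\<Sigma> m. \<Sigma> j. T i k m * phi j m l * phi i j n)"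
        by (rule sum.swap)
      also have "\<dots> = (\<Sigma> m. \<Sigma> j. T k m i * (phi m l j * phi n i j))"
      proof (intro sum.cong refl)
        fix m j
        have "T i k m = T k m i" "phi j m l = phi m l j" "phi i j n = phi n i j"
          by (metis T(1), rule phi_cyc, metis phi_cyc)
        then show "T i k m * phi j m l * phi i j n = T k m i * (phi m l j * phi n i j)" by simp
      qed
      finally show "(\<Sigma> j. \<Sigma> m. T i k m * phi j m l * phi i j n) = (\<Sigma> m. \<Sigma> j. T k m i * (phi m l j * phi n i j))" .
    qed
    also have "\<dots> = (\<Sigma> i. \<Sigma> m. T k m i * (dl m n * dl i l)) - (\<Sigma> i. \<Sigma> m. T k m i * (dl m i * dl l n))
         + (\<Sigma> i. \<Sigma> m. T k m i * psi m l n i)"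
      unfolding phi_phi
      by (simp add: distrib_left right_diff_distrib sum.distrib sum_subtractf dl_sym[of l _])
    also have "(\<Sigma> i. \<Sigma> m. T k m i * (dl m n * dl i l)) = T k n l"
      by (subst sum.swap) (simp only: sum_contract sum_dl)
    also have "(\<Sigma> i. \<Sigma> m. T k m i * (dl m i * dl l n)) = 0"
      by (simp add: mult.assoc[symmetric] sum_distrib_right[symmetric] T(5))
    also have "(\<Sigma> i. \<Sigma> m. T k m i * psi m l n i) = (\<Sigma> m. \<Sigma> i. psi m i l n * T k m i)"
      by (subst sum.swap) (simp add: psi_cyc3(2)[where k = m and a = i and b = l and c = n for m i] mult.commute)
    finally show ?thesis using psiT[of l n k] skew(2)[of k l n] by simp
  qed
  have t3: "(\<Sigma> i. \<Sigma> j. \<Sigma> m. T i l m * phi j k m * phi i j n) = - 3 * T k l n"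
  proof -
    have "(\<Sigma> i. \<Sigma> j. \<Sigma> m. T i l m * phi j k m * phi i j n)
       = - (\<Sigma> i. \<Sigma> j. \<Sigma> m. T i l m * phi j m k * phi i j n)"
      by (simp add: phi_perms(4)[where x = j and y = m and z = k for j m] sum_negf)
    then show ?thesis unfolding t2 using skew(1)[of k l n] by simp
  qed
  have "0 = (\<Sigma> i. \<Sigma> j. act3 (T i) phi j k l * phi i j n)" using act0 by simp
  also have "\<dots> = (\<Sigma> i. \<Sigma> j. \<Sigma> m. T i j m * phi m k l * phi i j n)
     + (\<Sigma> i. \<Sigma> j. \<Sigma> m. T i k m * phi j m l * phi i j n)
     + (\<Sigma> i. \<Sigma> j. \<Sigma> m. T i l m * phi j k m * phi i j n)"
    unfolding act3_def by (simp only: sum_distrib_right distrib_right sum.distrib)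
  finally show ?thesis unfolding t1 t2 t3 by simp
qed

lemma act4_psi_eq_0:
  assumes skew: "\<And>j k. B k j = - B j k" and "\<And>a. vec_part B a = 0"
  shows "act4 B psi i j k l = 0"
  using act4_psi[where B = B, OF skew] assms(2) by simp

text \<open>The operator \<open>psi\<close> has eigenvalue \<open>- 2\<close> on \<open>g\<^sub>2\<close> and \<open>4\<close> on the seven-dimensional summand.\<close>
lemma psi_on_2forms_injective:
  assumes skew: "\<And>j k. B k j = - B j k" and psi0: "\<And>m n. (\<Sigma> j. \<Sigma> k. psi j k m n * B j k) = 0"
  shows "B m n = 0"
proof -
  have B: "2 * B m n = (\<Sigma> a. vec_part B a * phi a m n)" for m n
    using vec_part_phi[where B = B, OF skew] psi0 by simp
  have "0 = 2 * (\<Sigma> j. \<Sigma> k. psi j k m n * B j k)"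
    by (simp add: psi0)
  also have "\<dots> = (\<Sigma> j. \<Sigma> k. (2 * B j k) * psi m n j k)"
    unfolding sum_distrib_left by (simp add: psi_pair[of m n] mult_ac)
  also have "\<dots> = (\<Sigma> j. \<Sigma> k. \<Sigma> a. vec_part B a * (phi a j k * psi m n j k))"
    unfolding B by (simp add: sum_distrib_right mult.assoc)
  also have "\<dots> = (\<Sigma> a. \<Sigma> j. \<Sigma> k. vec_part B a * (phi a j k * psi m n j k))"
    by (rule sum_rot3[symmetric])
  also have "\<dots> = (\<Sigma> a. vec_part B a * (4 * phi a m n))"
    by (simp only: sum_distrib_left[symmetric] phi_psi2)
  also have "\<dots> = 8 * B m n"
    using B[of m n] by (simp add: mult.left_commute[of _ 4] sum_distrib_left[symmetric])
  finally show ?thesis by simp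
qed

lemma act4_add: "act4 (\<lambda>j k. B j k + C j k / 2) f i j k l = act4 B f i j k l + act4 C f i j k l / 2"
  by (simp add: act4_def distrib_right sum.distrib sum_divide_distrib add_divide_distrib)

lemma phi_psi_mid: "(\<Sigma> k. phi m k i * phi j k a) = dl i a * dl m j - dl i j * dl m a + psi m j a i"
proof -
  have "phi m k i = phi i m k" "phi j k a = phi a j k" for k by (metis phi_cyc)+
  moreover have "psi i m a j = psi m j a i" by (metis psi_skew12 psi_skew23 psi_skew34 minus_minus)
  ultimately show ?thesis by (simp add: phi_phi)
qed

text \<open>The first-order jet of a \<open>G\<^sub>2\<close>-structure at a point, seen in an adapted frame. \<open>A i j k\<close> is
  the \<open>k\<close>-component of the Levi-Civita derivative of \<open>E\<^sub>j\<close> in direction \<open>E\<^sub>i\<close> relative to the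
  connection that makes the frame parallel, and \<open>th\<close> are the components of the Lee form.\<close>
locale g2_first_order =
  fixes A :: "7 \<Rightarrow> 7 \<Rightarrow> 7 \<Rightarrow> real" and th :: "7 \<Rightarrow> real" 
  assumes A_skew: "\<And>i j k. A i k j = - A i j k"
begin

text \<open>Components of \<open>*d\<omega>\<close>; then \<open>al\<close> is \<open>(d\<omega>, *\<omega>)\<close> and \<open>T\<close> is the torsion asserted in the theorem.\<close>
definition sd :: "7 \<Rightarrow> 7 \<Rightarrow> 7 \<Rightarrow> real" where
  "sd a b c = (\<Sigma> i. act4 (A i) psi i a b c)"
definition al :: real where
  "al = (\<Sigma> a. \<Sigma> b. \<Sigma> c. phi a b c * sd a b c) / 6"
definition T :: "7 \<Rightarrow> 7 \<Rightarrow> 7 \<Rightarrow> real" where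
  "T a b c = - sd a b c + al / 6 * phi a b c - (\<Sigma> i. th i * psi i a b c)"

abbreviation "\<tau> i \<equiv> vec_part (A i)"
abbreviation "tr\<tau> \<equiv> (\<Sigma> i. \<tau> i i)"

text \<open>Only the seven-dimensional parts \<open>\<tau> i\<close> of the matrices \<open>A i\<close> contribute, by \<open>act4_psi\<close>. The
  \<open>7 \<times> 7\<close> array \<open>\<tau>\<close> is the intrinsic torsion of the structure.\<close>
lemma sd_eq: "sd a b c = (\<Sigma> i. \<tau> i a * phi i b c + \<tau> i b * phi i c a + \<tau> i c * phi i a b) / 2 - tr\<tau> * phi a b c / 2"
proof -
  have "act4 (A i) psi i a b c = (\<tau> i a * phi i b c + \<tau> i b * phi i c a + \<tau> i c * phi i a b) / 2 - \<tau> i i * (phi a b c / 2)" for i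
    using act4_psi[of "A i" i a b c, OF A_skew] phi_perms(4)[of i a c] by (simp add: algebra_simps)
  then show ?thesis unfolding sd_def
    by (simp only: sum_subtractf sum_divide_distrib[symmetric] sum_distrib_right[symmetric])
qed

definition cyc_contr :: "7 \<Rightarrow> 7 \<Rightarrow> 7 \<Rightarrow> real" where
  "cyc_contr a b c = (\<Sigma> i. \<tau> i a * phi i b c + \<tau> i b * phi i c a + \<tau> i c * phi i a b)"

lemma phi_cyc_contr: "(\<Sigma> a. \<Sigma> b. \<Sigma> c. phi a b c * cyc_contr a b c) = 18 * tr\<tau>"
proof -
  define F where "F a b c = (\<Sigma> i. \<tau> i a * (phi i b c * phi a b c))" for a b c
  have F: "(\<Sigma> a. \<Sigma> b. \<Sigma> c. F a b c) = 6 * tr\<tau>"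
  proof -
    have "(\<Sigma> b. \<Sigma> c. F a b c) = 6 * \<tau> a a" for a
    proof -
      have "(\<Sigma> b. \<Sigma> c. F a b c) = (\<Sigma> i. \<tau> i a * (\<Sigma> b. \<Sigma> c. phi i b c * phi a b c))"
        unfolding F_def sum_distrib_left by (rule sum_rot3[symmetric])
      then show ?thesis unfolding phi_phi2 by (simp add: mult.left_commute[of _ 6] sum_distrib_left[symmetric])
    qed
    then show ?thesis by (simp add: sum_distrib_left)
  qed
  have rot: "(\<Sigma> a. \<Sigma> b. \<Sigma> c. F b c a) = (\<Sigma> a. \<Sigma> b. \<Sigma> c. F a b c)" 
    by (rule sum_rot3)
  have rot2: "(\<Sigma> a. \<Sigma> b. \<Sigma> c. F c a b) = (\<Sigma> a. \<Sigma> b. \<Sigma> c. F a b c)" 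
    by (rule sum_rot3[symmetric])
  have "phi a b c * cyc_contr a b c = F a b c + F b c a + F c a b" for a b c
    unfolding cyc_contr_def F_def 
    by (simp add: algebra_simps sum.distrib sum_distrib_left phi_perms(1,2)[where x = a and y = b and z = c])
  then show ?thesis by (simp only: sum.distrib F rot rot2)
qed

lemma al_eq: "al = - 2 * tr\<tau>"
proof -
  have "phi a b c * sd a b c = 1/2 * (phi a b c * cyc_contr a b c) - tr\<tau> / 2 * (phi a b c * phi a b c)" for a b c
    unfolding sd_eq cyc_contr_def by (simp add: algebra_simps)
  then have "(\<Sigma> a. \<Sigma> b. \<Sigma> c. phi a b c * sd a b c) = 1/2 * (18 * tr\<tau>) - tr\<tau> / 2 * 42"
    by (simp only: sum_subtractf sum_distrib_left[symmetric] phi_phi2 phi_cyc_contr) simp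
  then show ?thesis unfolding al_def by simp
qed

lemma T_eq: "T a b c = tr\<tau> / 6 * phi a b c
    - (\<Sigma> i. \<tau> i a * phi i b c + \<tau> i b * phi i c a + \<tau> i c * phi i a b) / 2 - (\<Sigma> i. th i * psi i a b c)"
  unfolding T_def sd_eq al_eq by simp

lemma T_skew: "T j i k = - T i j k" "T i k j = - T i j k"
proof -
  have 1: "phi m i k = - phi m k i" "phi m k j = - phi m j k" "phi m j i = - phi m i j" for m
    by (rule phi_perms)+
  have 2: "psi m j i k = - psi m i j k" "psi m i k j = - psi m i j k" for m
    by (rule psi_skew23, rule psi_skew34)
  define S where "S i j k = (\<Sigma> m. \<tau> m i * phi m j k + \<tau> m j * phi m k i + \<tau> m k * phi m i j)" for i j k
  have S: "S j i k = - S i j k" "S i k j = - S i j k"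
    unfolding S_def sum_negf[symmetric] by (intro sum.cong; simp add: 1)+
  have P: "(\<Sigma> m. th m * psi m j i k) = - (\<Sigma> m. th m * psi m i j k)"
    "(\<Sigma> m. th m * psi m i k j) = - (\<Sigma> m. th m * psi m i j k)"
    by (simp_all add: 2 sum_negf)
  have "phi j i k = - phi i j k" "phi i k j = - phi i j k" by (rule phi_perms)+
  then show "T j i k = - T i j k" "T i k j = - T i j k"
    unfolding T_eq S_def[symmetric] S P by simp_all
qed

lemma phi_T: "(\<Sigma> a. \<Sigma> b. \<Sigma> c. phi a b c * T a b c) = al"
proof -
  have z: "(\<Sigma> a. \<Sigma> b. \<Sigma> c. phi a b c * (\<Sigma> i. th i * psi i a b c)) = 0"
  proof -
    have "(\<Sigma> b. \<Sigma> c. phi a b c * (\<Sigma> i. th i * psi i a b c)) = 0" for a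
    proof -
      have "(\<Sigma> b. \<Sigma> c. phi a b c * (\<Sigma> i. th i * psi i a b c)) = (\<Sigma> i. th i * (\<Sigma> b. \<Sigma> c. phi a b c * psi i a b c))"
        unfolding sum_distrib_left by (subst sum_rot3) (simp add: mult_ac)
      then show ?thesis by (simp add: phi_psi2)
    qed
    then show ?thesis by simp
  qed
  have "phi a b c * T a b c = tr\<tau> / 6 * (phi a b c * phi a b c) - 1/2 * (phi a b c * cyc_contr a b c)
      - phi a b c * (\<Sigma> i. th i * psi i a b c)" for a b c
    unfolding T_eq cyc_contr_def by (simp add: algebra_simps)
  then have "(\<Sigma> a. \<Sigma> b. \<Sigma> c. phi a b c * T a b c) = tr\<tau> / 6 * 42 - 1/2 * (18 * tr\<tau>) - 0"
    by (simp only: sum_subtractf sum_distrib_left[symmetric] phi_phi2 phi_cyc_contr z) simp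
  then show ?thesis unfolding al_eq by simp
qed

lemma psi_T:
  assumes th: "\<And>i. th i = (\<Sigma> j. \<Sigma> k. \<Sigma> l. sd j k l * psi j k l i) / 18"
  shows "(\<Sigma> j. \<Sigma> k. \<Sigma> l. psi i j k l * T j k l) = - 6 * th i"
proof -
  have 1: "(\<Sigma> j. \<Sigma> k. \<Sigma> l. psi i j k l * sd j k l) = - 18 * th i"
    using psi_cyc4[where a = i] by (simp add: th sum_negf mult.commute)
  have 2: "(\<Sigma> j. \<Sigma> k. \<Sigma> l. al / 6 * (phi j k l * psi i j k l)) = 0"
    by (simp only: sum_distrib_left[symmetric] phi_psi2) simp
  have "(\<Sigma> j. \<Sigma> k. \<Sigma> l. psi i j k l * (\<Sigma> m. th m * psi m j k l))
      = (\<Sigma> j. \<Sigma> m. \<Sigma> k. \<Sigma> l. th m * (psi i j k l * psi m j k l))"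
    unfolding sum_distrib_left by (subst sum_rot3[symmetric]) (simp add: mult_ac)
  also have "\<dots> = (\<Sigma> m. th m * (\<Sigma> j. \<Sigma> k. \<Sigma> l. psi i j k l * psi m j k l))"
    unfolding sum_distrib_left by (rule sum.swap)
  finally have 3: "(\<Sigma> j. \<Sigma> k. \<Sigma> l. psi i j k l * (\<Sigma> m. th m * psi m j k l)) = 24 * th i"
    unfolding psi_psi3 by (simp add: mult.left_commute[of _ 24] sum_distrib_left[symmetric])
  have "psi i j k l * T j k l = al / 6 * (phi j k l * psi i j k l) - psi i j k l * sd j k l
      - psi i j k l * (\<Sigma> m. th m * psi m j k l)" for j k l
    unfolding T_def by (simp add: algebra_simps)
  then show ?thesis by (simp only: sum_subtractf 1 2 3)
qed

lemma vec_part_T: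
  "vec_part (T i) a = - 2 * \<tau> a i - (\<Sigma> m. \<Sigma> j. \<tau> m j * psi m j a i) - 4 * (\<Sigma> m. th m * phi m i a)"
proof -
  have 1: "(\<Sigma> j. \<Sigma> k. tr\<tau> / 6 * (phi i j k * phi a j k)) = tr\<tau> * dl i a"
    unfolding sum_distrib_left[symmetric] phi_phi2 by simp
  have 2: "(\<Sigma> j. \<Sigma> k. \<Sigma> m. \<tau> m i * (phi m j k * phi a j k)) = 6 * \<tau> a i"
    by (subst sum_rot3[symmetric], unfold sum_distrib_left[symmetric] phi_phi2)
    (simp add: mult.left_commute[of _ 6] sum_distrib_left[symmetric])
  have 3: "(\<Sigma> j. \<Sigma> k. \<Sigma> m. \<tau> m j * (phi m k i * phi j k a))
     = tr\<tau> * dl i a - \<tau> a i + (\<Sigma> m. \<Sigma> j. \<tau> m j * psi m j a i)"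
  proof -
    have "(\<Sigma> j. \<Sigma> k. \<Sigma> m. \<tau> m j * (phi m k i * phi j k a)) 
      = (\<Sigma> m. \<Sigma> j. \<tau> m j * (\<Sigma> k. phi m k i * phi j k a))"
      unfolding sum_distrib_left by (subst sum_rot3[symmetric]) (rule refl)
    also have "\<dots> = (\<Sigma> m. \<Sigma> j. \<tau> m j * (dl j m * dl i a)) - (\<Sigma> m. \<Sigma> j. \<tau> m j * (dl m a * dl i j))
        + (\<Sigma> m. \<Sigma> j. \<tau> m j * psi m j a i)"
      unfolding phi_psi_mid
      by (simp add: distrib_left right_diff_distrib sum.distrib sum_subtractf mult_ac dl_sym del: sum_dl)
    also have "(\<Sigma> m. \<Sigma> j. \<tau> m j * (dl j m * dl i a)) = tr\<tau> * dl i a"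
      by (simp add: mult.assoc[symmetric] sum_distrib_right[symmetric])
    also have "(\<Sigma> m. \<Sigma> j. \<tau> m j * (dl m a * dl i j)) = \<tau> a i"
      unfolding sum_contract by simp
    finally show ?thesis .
  qed
  have 4: "(\<Sigma> j. \<Sigma> k. \<Sigma> m. \<tau> m k * (phi m j i * phi k j a))
     = tr\<tau> * dl i a - \<tau> a i + (\<Sigma> m. \<Sigma> j. \<tau> m j * psi m j a i)"
    unfolding 3[symmetric] by (rule sum.swap)
  have 5: "(\<Sigma> j. \<Sigma> k. \<Sigma> m. th m * (phi a j k * psi m i j k)) = 4 * (\<Sigma> m. th m * phi m i a)"
    by (subst sum_rot3[symmetric], unfold sum_distrib_left[symmetric] phi_psi2)
    (simp add: mult.left_commute[of _ 4] sum_distrib_left[symmetric] phi_perms(1)[where x = a and z = i])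
  have "T i j k * phi j k a = tr\<tau> / 6 * (phi i j k * phi a j k) - 1/2 * (\<Sigma> m. \<tau> m i * (phi m j k * phi a j k))
     - 1/2 * (\<Sigma> m. \<tau> m j * (phi m k i * phi j k a)) - 1/2 * (\<Sigma> m. \<tau> m k * (phi m j i * phi k j a))
     - (\<Sigma> m. th m * (phi a j k * psi m i j k))" for j k
  proof -
    have "phi j k a = phi a j k" "phi k j a = - phi a j k" "phi m j i = - phi m i j" for m
      by (metis phi_cyc, metis phi_cyc phi_skew, rule phi_perms(4))
    then show ?thesis
      unfolding T_eq by (simp add: algebra_simps sum.distrib sum_distrib_left sum_divide_distrib)
  qed
  then show ?thesis unfolding vec_part_def[of "T i"]
    by (simp only: sum_subtractf sum_distrib_left[symmetric] 1 2 3 4 5) (simp add: phi_phi2)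
qed

text \<open>Integrability as stated controls the contraction of \<open>\<tau>\<close> with \<open>psi\<close>. The defect \<open>\<gamma>\<close> below is
  skew, and the same contraction shows that \<open>psi\<close> annihilates it, so it is zero. It is
  the seven-dimensional part of the connection \<open>A + T / 2\<close>.\<close>
lemma vec_part_char_connection:
  assumes integrable: "\<And>a b. (\<Sigma> i. th i * phi i a b) = - (\<Sigma> i. act3 (A i) phi i a b)"
  shows "vec_part (\<lambda>j k. A i j k + T i j k / 2) a = 0"
proof -
  have Y: "(\<Sigma> m. \<Sigma> j. \<tau> m j * psi m j a b) = 2 * (\<Sigma> m. th m * phi m a b)" for a b
  proof -
    have "(\<Sigma> m. \<Sigma> j. \<tau> m j * psi m j a b) = - (\<Sigma> m. \<Sigma> j. \<tau> m j * psi j m a b)"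
      unfolding sum_negf[symmetric]
    proof (intro sum.cong refl)
      fix m j show "\<tau> m j * psi m j a b = - (\<tau> m j * psi j m a b)" by (simp add: psi_skew12[of m j])
    qed
    then show ?thesis
      unfolding integrable act3_phi[of "A _", OF A_skew] by (simp add: sum_distrib_left)
  qed
  \<comment> \<open>The value of the claimed expression once \<open>vec_part_T\<close> and \<open>Y\<close> have been inserted.\<close>
  define \<gamma> where "\<gamma> i a = \<tau> i a - \<tau> a i - (\<Sigma> m. th m * phi m i a)" for i a
  have skew: "\<gamma> k j = - \<gamma> j k" for j k
    unfolding \<gamma>_def by (simp add: phi_perms(4)[where y = j and z = k] sum_negf)
  have "(\<Sigma> j. \<Sigma> k. psi j k m n * \<gamma> j k) = 0" for m n
  proof -
    have 1: "(\<Sigma> j. \<Sigma> k. psi j k m n * \<tau> j k) = 2 * (\<Sigma> p. th p * phi p m n)"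
      using Y[of m n] by (simp add: mult.commute)
    have 2: "(\<Sigma> j. \<Sigma> k. psi j k m n * \<tau> k j) = - 2 * (\<Sigma> p. th p * phi p m n)"
    proof -
      have "(\<Sigma> j. \<Sigma> k. psi j k m n * \<tau> k j) = (\<Sigma> k. \<Sigma> j. psi j k m n * \<tau> k j)" by (rule sum.swap)
      also have "\<dots> = - (\<Sigma> k. \<Sigma> j. psi k j m n * \<tau> k j)"
        unfolding sum_negf[symmetric]
      proof (intro sum.cong refl)
        fix k j show "psi j k m n * \<tau> k j = - (psi k j m n * \<tau> k j)" by (simp add: psi_skew12[of j k])
      qed
      finally show ?thesis unfolding 1 by simp
    qed
    have 3: "(\<Sigma> j. \<Sigma> k. \<Sigma> p. th p * (phi p j k * psi m n j k)) = 4 * (\<Sigma> p. th p * phi p m n)"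
      by (subst sum_rot3[symmetric], unfold sum_distrib_left[symmetric] phi_psi2)
      (simp add: mult.left_commute[of _ 4] sum_distrib_left[symmetric])
    have "psi j k m n * \<gamma> j k = psi j k m n * \<tau> j k - psi j k m n * \<tau> k j - (\<Sigma> p. th p * (phi p j k * psi m n j k))" for j k
      unfolding \<gamma>_def by (simp add: right_diff_distrib sum_distrib_left mult_ac psi_pair[of m n])
    then show ?thesis by (simp only: sum_subtractf 1 2 3)
  qed
  then have \<gamma>0: "\<gamma> i a = 0"
    by (rule psi_on_2forms_injective[where B = \<gamma>, OF skew])
  have "vec_part (\<lambda>j k. A i j k + T i j k / 2) a = \<tau> i a + vec_part (T i) a / 2"
    unfolding vec_part_def by (simp add: distrib_right sum.distrib sum_divide_distrib)
  also have "\<dots> = \<gamma> i a"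
    unfolding vec_part_T Y \<gamma>_def 
    by (simp add: phi_perms(4)[where y = i and z = a] sum_negf field_simps)
  finally show ?thesis using \<gamma>0 by simp
qed

text \<open>Since \<open>A + T / 2\<close> annihilates \<open>psi\<close>, the form \<open>*d\<omega>\<close> is also an expression in \<open>T\<close> and
  \<open>psi\<close> alone. Pairing \<open>T\<close> with its defining formula then gives \<open>\<parallel>T\<parallel>\<^sup>2\<close> as a quadratic expression in
  \<open>T\<close> plus the two scalar pairings \<open>phi_T\<close> and \<open>psi_T\<close>.\<close>
lemma T_norm:
  assumes integrable: "\<And>a b. (\<Sigma> i. th i * phi i a b) = - (\<Sigma> i. act3 (A i) phi i a b)"
    and th: "\<And>i. th i = (\<Sigma> j. \<Sigma> k. \<Sigma> l. sd j k l * psi j k l i) / 18"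
  shows "(\<Sigma> a. \<Sigma> b. \<Sigma> c. (T a b c)\<^sup>2)
    = 3/2 * (\<Sigma> a. \<Sigma> b. \<Sigma> c. T a b c * (\<Sigma> i. \<Sigma> m. T i a m * psi i m b c)) + al\<^sup>2 / 6 + 6 * (\<Sigma> i. (th i)\<^sup>2)"
proof -
  note Tr = skew3_rules[of T, OF T_skew]
  define f where "f a b c = (\<Sigma> i. \<Sigma> m. T i a m * psi i m b c)" for a b c
  have sd: "sd a b c = - (f a b c + f b c a + f c a b) / 2" for a b c
  proof -
    have "act4 (\<lambda>j k. A i j k + T i j k / 2) psi i a b c = 0" for i
    proof (rule act4_psi_eq_0)
      show "A i k j + T i k j / 2 = - (A i j k + T i j k / 2)" for j k
        using A_skew[of i k j] T_skew(2)[of i k j] by simp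
    qed (rule vec_part_char_connection[OF integrable])
    then have "act4 (A i) psi i a b c = - act4 (T i) psi i a b c / 2" for i
      unfolding act4_add by (simp add: eq_neg_iff_add_eq_0)
    moreover have "act4 (T i) psi i a b c = (\<Sigma> m. T i a m * psi i m b c) + (\<Sigma> m. T i b m * psi i m c a) + (\<Sigma> m. T i c m * psi i m a b)" for i
    proof -
      have "psi i a m c = psi i m c a" "psi i a b m = psi i m a b" for m
        by (metis psi_cyc3(2))+
      then show ?thesis unfolding act4_def by (simp add: sum.distrib Tr(4))
    qed
    ultimately have "act4 (A i) psi i a b c = - ((\<Sigma> m. T i a m * psi i m b c) + (\<Sigma> m. T i b m * psi i m c a)
        + (\<Sigma> m. T i c m * psi i m a b)) / 2" for i by simp
    then show ?thesis
      unfolding sd_def f_def by (simp only: sum.distrib sum_negf sum_divide_distrib[symmetric])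
  qed
  have rot: "(\<Sigma> a. \<Sigma> b. \<Sigma> c. T a b c * f b c a) = (\<Sigma> a. \<Sigma> b. \<Sigma> c. T a b c * f a b c)"
  proof -
    have "(\<Sigma> a. \<Sigma> b. \<Sigma> c. T a b c * f b c a) = (\<Sigma> a. \<Sigma> b. \<Sigma> c. T b c a * f b c a)"
      by (intro sum.cong refl) (metis Tr(1))
    then show ?thesis by (simp only: sum_rot3[of "\<lambda>a b c. T b c a * f b c a"])
  qed
  have rot2: "(\<Sigma> a. \<Sigma> b. \<Sigma> c. T a b c * f c a b) = (\<Sigma> a. \<Sigma> b. \<Sigma> c. T a b c * f a b c)"
  proof -
    have "(\<Sigma> a. \<Sigma> b. \<Sigma> c. T a b c * f c a b) = (\<Sigma> a. \<Sigma> b. \<Sigma> c. T c a b * f c a b)"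
      by (intro sum.cong refl) (metis Tr(2))
    then show ?thesis using sum_rot3[of "\<lambda>a b c. T a b c * f a b c"] by simp
  qed
  have th_T: "(\<Sigma> a. \<Sigma> b. \<Sigma> c. T a b c * (\<Sigma> i. th i * psi i a b c)) = - 6 * (\<Sigma> i. (th i)\<^sup>2)"
  proof -
    have "(\<Sigma> a. \<Sigma> b. \<Sigma> c. T a b c * (\<Sigma> i. th i * psi i a b c))
       = (\<Sigma> a. \<Sigma> i. \<Sigma> b. \<Sigma> c. th i * (psi i a b c * T a b c))"
      unfolding sum_distrib_left by (subst sum_rot3[symmetric]) (simp add: mult_ac)
    also have "\<dots> = (\<Sigma> i. th i * (\<Sigma> a. \<Sigma> b. \<Sigma> c. psi i a b c * T a b c))"
      unfolding sum_distrib_left by (rule sum.swap)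
    finally show ?thesis
      unfolding psi_T[OF th] by (simp add: sum_negf power2_eq_square sum_distrib_left mult_ac)
  qed
  have "(T a b c)\<^sup>2 = 1/2 * (T a b c * f a b c + T a b c * f b c a + T a b c * f c a b)
     + al / 6 * (phi a b c * T a b c) - T a b c * (\<Sigma> i. th i * psi i a b c)" for a b c
  proof -
    have Tc: "T a b c = 1/2 * (f a b c + f b c a + f c a b) + al / 6 * phi a b c - (\<Sigma> i. th i * psi i a b c)"
      by (subst T_def) (simp add: sd field_simps)
    have "(T a b c)\<^sup>2 = T a b c * (1/2 * (f a b c + f b c a + f c a b) + al / 6 * phi a b c - (\<Sigma> i. th i * psi i a b c))"
      using Tc by (simp add: power2_eq_square)
    then show ?thesis by (simp only: distrib_left right_diff_distrib mult_ac)
  qed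
  then show ?thesis
    by (simp only: sum_subtractf sum.distrib sum_distrib_left[symmetric] rot rot2 th_T phi_T f_def[symmetric])
      (simp add: power2_eq_square)
qed

end

section \<open>Repeatedly differentiable maps\<close>

lemma has_derivative_cong_open:
  assumes "open S" "x \<in> S" "\<And>y. y \<in> S \<Longrightarrow> f y = g y"
  shows "(f has_derivative f') (at x) \<longleftrightarrow> (g has_derivative f') (at x)"
  using has_derivative_transform_within_open[of f f' x UNIV S g] has_derivative_transform_within_open[of g f' x UNIV S f] assms
  by auto

lemma frechet_derivative_cong_open:
  assumes "open S" "x \<in> S" "\<And>y. y \<in> S \<Longrightarrow> f y = g y"
  shows "frechet_derivative f (at x) = frechet_derivative g (at x)"
  unfolding frechet_derivative_def using has_derivative_cong_open[OF assms] by simp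

lemma differentiable_cong_open:
  assumes "open S" "x \<in> S" "\<And>y. y \<in> S \<Longrightarrow> f y = g y"
  shows "f differentiable (at x) \<longleftrightarrow> g differentiable (at x)"
  unfolding differentiable_def using has_derivative_cong_open[OF assms] by simp

lemma times_diff_on_cong:
  assumes "open S" "\<And>y. y \<in> S \<Longrightarrow> f y = g y"
  shows "times_diff_on n S f \<longleftrightarrow> times_diff_on n S g"
  using assms(2)
proof (induction n arbitrary: f g)
  case 0 then show ?case by (simp cong: continuous_on_cong)
next
  case (Suc n)
  have "times_diff_on n S (\<lambda>x. frechet_derivative f (at x) v) = times_diff_on n S (\<lambda>x. frechet_derivative g (at x) v)" for v
    using frechet_derivative_cong_open[OF assms(1) _ Suc.prems] by (intro Suc.IH) auto
  moreover have "(\<forall>x\<in>S. f differentiable (at x)) \<longleftrightarrow> (\<forall>x\<in>S. g differentiable (at x))"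
    using differentiable_cong_open[OF assms(1) _ Suc.prems] by auto
  ultimately show ?case by simp
qed

lemma times_diff_on_subset:
  "times_diff_on n S f \<Longrightarrow> U \<subseteq> S \<Longrightarrow> times_diff_on n U f"
  by (induction n arbitrary: f) (auto intro: continuous_on_subset)

text \<open>Smoothness of the characteristic connection is known near each point only, in the domain of an adapted
  coframe; this assembles it on the whole chart.\<close>
lemma times_diff_on_local:
  assumes "\<And>x. x \<in> S \<Longrightarrow> \<exists>U. open U \<and> x \<in> U \<and> times_diff_on n U f"
  shows "times_diff_on n S f"
  using assms
proof (induction n arbitrary: f)
  case 0
  then have "continuous (at x) f" if "x \<in> S" for x
    using that by (metis continuous_on_eq_continuous_at times_diff_on.simps(1))
  then show ?case by (simp add: continuous_at_imp_continuous_on)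
next
  case (Suc n)
  have "f differentiable (at x)" if "x \<in> S" for x
    using Suc.prems[OF that] by auto
  moreover have "times_diff_on n S (\<lambda>x. frechet_derivative f (at x) v)" for v
    using Suc.prems by (intro Suc.IH) (metis times_diff_on.simps(2))
  ultimately show ?case by simp
qed

lemma times_diff_on_Suc_D: "times_diff_on (Suc n) S f \<Longrightarrow> times_diff_on n S f"
proof (induction n arbitrary: f)
  case 0
  then show ?case by (auto intro: continuous_at_imp_continuous_on differentiable_imp_continuous_within)
next
  case (Suc n) 
  from Suc.prems have "\<forall>x\<in>S. f differentiable (at x)" "\<forall>v. times_diff_on (Suc n) S (\<lambda>x. frechet_derivative f (at x) v)"
    by simp_all
  with Suc.IH show ?case by auto
qed

lemma times_diff_on_SucI:
  assumes "open S" "\<And>x. x \<in> S \<Longrightarrow> (f has_derivative D x) (at x)" "\<And>v. times_diff_on n S (\<lambda>x. D x v)"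
  shows "times_diff_on (Suc n) S f"
proof -
  have "frechet_derivative f (at x) = D x" if "x \<in> S" for x
    using frechet_derivative_at[OF assms(2)[OF that]] by simp
  then have "times_diff_on n S (\<lambda>x. frechet_derivative f (at x) v)" for v
    using assms(3)[of v] times_diff_on_cong[OF assms(1), of "\<lambda>x. frechet_derivative f (at x) v" "\<lambda>x. D x v" n] by simp
  then show ?thesis using assms(2) by (auto simp: differentiable_def)
qed

lemma times_diff_on_deriv:
  assumes "times_diff_on (Suc n) S f"
  shows "x \<in> S \<Longrightarrow> (f has_derivative frechet_derivative f (at x)) (at x)"
    "times_diff_on n S (\<lambda>x. frechet_derivative f (at x) v)"
  using assms by (auto simp: frechet_derivative_works)

lemma times_diff_on_const: "open S \<Longrightarrow> times_diff_on n S (\<lambda>x. c)"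
proof (induction n arbitrary: c)
  case (Suc n)
  show ?case by (rule times_diff_on_SucI[OF Suc.prems has_derivative_const]) (use Suc in auto)
qed simp

lemma times_diff_on_linear:
  assumes "bounded_linear h" "open S" "times_diff_on n S f"
  shows "times_diff_on n S (\<lambda>x. h (f x))"
  using assms(3)
proof (induction n arbitrary: f)
  case 0 then show ?case using assms(1) by (simp add: bounded_linear.continuous_on)
next
  case (Suc n)
  show ?case
    by (rule times_diff_on_SucI[OF assms(2) bounded_linear.has_derivative[OF assms(1)]])
      (use times_diff_on_deriv[OF Suc.prems] Suc.IH in auto)
qed

lemma times_diff_on_add:
  assumes "open S" "times_diff_on n S f" "times_diff_on n S g"
  shows "times_diff_on n S (\<lambda>x. f x + g x)"
  using assms(2,3)
proof (induction n arbitrary: f g)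
  case 0 then show ?case by (simp add: continuous_on_add)
next
  case (Suc n)
  show ?case
    by (rule times_diff_on_SucI[OF assms(1) has_derivative_add])
      (use times_diff_on_deriv[OF Suc.prems(1)] times_diff_on_deriv[OF Suc.prems(2)] Suc.IH in auto)
qed

lemma times_diff_on_sum:
  assumes "open S" "\<And>i. i \<in> I \<Longrightarrow> times_diff_on n S (f i)"
  shows "times_diff_on n S (\<lambda>x. \<Sum>i\<in>I. f i x)"
proof (cases "finite I")
  case True
  then show ?thesis using assms(2)
    by (induction I) (auto intro!: times_diff_on_add times_diff_on_const assms(1))
qed (simp add: times_diff_on_const assms(1))

lemma times_diff_on_bilinear:
  assumes "bounded_bilinear h" "open S" "times_diff_on n S f" "times_diff_on n S g"
  shows "times_diff_on n S (\<lambda>x. h (f x) (g x))"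
  using assms(3,4)
proof (induction n arbitrary: f g)
  case 0 then show ?case using assms(1) by (simp add: bounded_bilinear.continuous_on)
next
  case (Suc n)
  show ?case
    by (rule times_diff_on_SucI[OF assms(2) bounded_bilinear.FDERIV[OF assms(1)]])
      (use times_diff_on_deriv[OF Suc.prems(1)] times_diff_on_deriv[OF Suc.prems(2)] times_diff_on_Suc_D[OF Suc.prems(1)]
       times_diff_on_Suc_D[OF Suc.prems(2)] Suc.IH in \<open>auto intro!: times_diff_on_add assms(2)\<close>)
qed

lemmas times_diff_on_mult = times_diff_on_bilinear[OF bounded_bilinear_mult]
lemmas times_diff_on_scaleR = times_diff_on_bilinear[OF bounded_bilinear_scaleR]

lemma times_diff_on_minus:
  "open S \<Longrightarrow> times_diff_on n S f \<Longrightarrow> times_diff_on n S (\<lambda>x. - f x)"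
  by (rule times_diff_on_linear[OF bounded_linear_minus[OF bounded_linear_ident]])

lemma times_diff_on_diff:
  assumes "open S" "times_diff_on n S f" "times_diff_on n S g"
  shows "times_diff_on n S (\<lambda>x. f x - g x)"
  using times_diff_on_add[OF assms(1,2) times_diff_on_minus[OF assms(1,3)]] by simp

lemma times_diff_on_prod:
  fixes f :: "'i \<Rightarrow> 'a::euclidean_space \<Rightarrow> real"
  assumes "open S" "\<And>i. i \<in> I \<Longrightarrow> times_diff_on n S (f i)"
  shows "times_diff_on n S (\<lambda>x. \<Prod>i\<in>I. f i x)"
proof (cases "finite I")
  case True
  then show ?thesis using assms(2)
    by (induction I) (auto intro!: times_diff_on_mult times_diff_on_const assms(1))
qed (simp add: times_diff_on_const assms(1))

lemma times_diff_on_inverse: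
  fixes f :: "'a::euclidean_space \<Rightarrow> real"
  assumes "open S" "times_diff_on n S f" "\<And>x. x \<in> S \<Longrightarrow> f x \<noteq> 0"
  shows "times_diff_on n S (\<lambda>x. inverse (f x))"
  using assms(2,3)
proof (induction n arbitrary: f)
  case 0 then show ?case by (simp add: continuous_on_inverse)
next
  case (Suc n)
  have inv: "times_diff_on n S (\<lambda>x. inverse (f x))"
    using Suc times_diff_on_Suc_D by blast
  show ?case
    by (rule times_diff_on_SucI[OF assms(1) Deriv.has_derivative_inverse])
      (use times_diff_on_deriv[OF Suc.prems(1)] Suc.prems(2) inv in 
        \<open>auto intro!: times_diff_on_minus times_diff_on_mult assms(1)\<close>)
qed

lemma times_diff_on_det:
  fixes M :: "'a::euclidean_space \<Rightarrow> real^'n^'n"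
  assumes "open S" "\<And>i j. times_diff_on n S (\<lambda>x. M x $ i $ j)"
  shows "times_diff_on n S (\<lambda>x. det (M x))"
  unfolding det_def by (intro times_diff_on_sum times_diff_on_mult times_diff_on_const times_diff_on_prod assms)

lemma smooth_on_frechet_derivative:
  "smooth_on S f \<Longrightarrow> smooth_on S (\<lambda>x. frechet_derivative f (at x) v)"
  unfolding smooth_on_def by (metis times_diff_on.simps(2))

lemma smooth_on_D: 
  assumes "smooth_on S f" "x \<in> S" shows "(f has_derivative frechet_derivative f (at x)) (at x)"
  by (metis assms smooth_on_def times_diff_on_deriv(1))

text \<open>The mean value theorem, first along \<open>u\<close> for the difference in direction \<open>v\<close>, then along \<open>v\<close>.\<close>
lemma second_difference_mean_value:
  fixes f :: "'a::euclidean_space \<Rightarrow> real"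
  assumes "open S" "times_diff_on 2 S f" "h > 0" "ball x d \<subseteq> S" "h * (norm u + norm v) < d"
  shows "\<exists>s t. 0 < s \<and> s < h \<and> 0 < t \<and> t < h \<and>
     f (x + h *\<^sub>R u + h *\<^sub>R v) - f (x + h *\<^sub>R u) - f (x + h *\<^sub>R v) + f x
     = h * h * frechet_derivative (\<lambda>y. frechet_derivative f (at y) u) (at (x + s *\<^sub>R u + t *\<^sub>R v)) v"
proof -
  have in_S: "x + s *\<^sub>R u + t *\<^sub>R v \<in> S" if "0 \<le> s" "s \<le> h" "0 \<le> t" "t \<le> h" for s t
  proof -
    have "norm (s *\<^sub>R u + t *\<^sub>R v) \<le> s * norm u + t * norm v"
      using that norm_triangle_ineq[of "s *\<^sub>R u" "t *\<^sub>R v"] by simp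
    also have "\<dots> \<le> h * norm u + h * norm v" using that by (intro add_mono mult_right_mono) auto
    also have "\<dots> < d" using assms(5) by (simp add: distrib_left)
    finally show ?thesis using assms(4) by (auto simp: dist_norm add.assoc norm_minus_commute subset_iff)
  qed
  have f2: "times_diff_on (Suc (Suc 0)) S f" using assms(2) by (simp add: numeral_2_eq_2)
  have line: "((\<lambda>s. F (p + s *\<^sub>R w)) has_real_derivative frechet_derivative F (at (p + s *\<^sub>R w)) w) (at s)"
    if "times_diff_on (Suc 0) S F" "p + s *\<^sub>R w \<in> S" for F :: "'a \<Rightarrow> real" and p w s
  proof -
    have "((\<lambda>s. p + s *\<^sub>R w) has_derivative (\<lambda>s. s *\<^sub>R w)) (at s)" by (auto intro!: derivative_eq_intros)
    from diff_chain_at[OF this times_diff_on_deriv(1)[OF that]]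
    show ?thesis
      by (simp add: has_field_derivative_def comp_def linear_cmul[OF has_derivative_linear[OF times_diff_on_deriv(1)[OF that]]] mult_commute_abs)
  qed
  define G where "G s = f (x + h *\<^sub>R v + s *\<^sub>R u) - f (x + s *\<^sub>R u)" for s
  have "\<exists>s. 0 < s \<and> s < h \<and> G h - G 0 = (h - 0) *
      (frechet_derivative f (at (x + h *\<^sub>R v + s *\<^sub>R u)) u - frechet_derivative f (at (x + s *\<^sub>R u)) u)"
    unfolding G_def
    by (rule MVT2[OF assms(3)], intro DERIV_diff line times_diff_on_Suc_D[OF f2])
      (use in_S[of _ h] in_S[of _ 0] assms(3) in \<open>auto simp: algebra_simps\<close>)
  then obtain s where s: "0 < s" "s < h" "G h - G 0 = h *
      (frechet_derivative f (at (x + s *\<^sub>R u + h *\<^sub>R v)) u - frechet_derivative f (at (x + s *\<^sub>R u)) u)"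
    by (auto simp: algebra_simps)
  define K where "K t = frechet_derivative f (at (x + s *\<^sub>R u + t *\<^sub>R v)) u" for t
  have "\<exists>t. 0 < t \<and> t < h \<and> K h - K 0 = (h - 0) *
      frechet_derivative (\<lambda>y. frechet_derivative f (at y) u) (at (x + s *\<^sub>R u + t *\<^sub>R v)) v"
    unfolding K_def
    by (rule MVT2[OF assms(3)], rule line[of "\<lambda>y. frechet_derivative f (at y) u"], rule times_diff_on_deriv(2)[OF f2])
      (use in_S s in auto)
  then obtain t where "0 < t" "t < h" "K h - K 0 = h *
      frechet_derivative (\<lambda>y. frechet_derivative f (at y) u) (at (x + s *\<^sub>R u + t *\<^sub>R v)) v" by auto
  with s show ?thesis
    unfolding G_def K_def by (intro exI[of _ s] exI[of _ t]) (auto simp: algebra_simps)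
qed

text \<open>The second difference is symmetric in \<open>u\<close> and \<open>v\<close>, and it equals both iterated derivatives at nearby
  points; continuity of these derivatives does the rest.\<close>
lemma second_derivative_symmetric_real:
  fixes f :: "'a::euclidean_space \<Rightarrow> real"
  assumes "open S" "times_diff_on 2 S f" "x \<in> S"
  shows "frechet_derivative (\<lambda>y. frechet_derivative f (at y) u) (at x) v
       = frechet_derivative (\<lambda>y. frechet_derivative f (at y) v) (at x) u" (is "?a = ?b")
proof (rule ccontr)
  assume ne: "?a \<noteq> ?b"
  define e where "e = \<bar>?a - ?b\<bar> / 2"
  have e: "e > 0" using ne by (simp add: e_def)
  define F where "F u v y = frechet_derivative (\<lambda>y. frechet_derivative f (at y) u) (at y) v" for u v y
  have cont: "continuous (at x) (F u v)" for u v
    using assms unfolding F_def by (simp add: numeral_2_eq_2 continuous_on_eq_continuous_at)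
  obtain d1 where d1: "d1 > 0" "\<And>y. dist y x < d1 \<Longrightarrow> \<bar>F u v y - ?a\<bar> < e"
    using cont[of u v] e unfolding continuous_at_eps_delta dist_real_def by (metis F_def)
  obtain d2 where d2: "d2 > 0" "\<And>y. dist y x < d2 \<Longrightarrow> \<bar>F v u y - ?b\<bar> < e"
    using cont[of v u] e unfolding continuous_at_eps_delta dist_real_def by (metis F_def)
  obtain d3 where d3: "d3 > 0" "ball x d3 \<subseteq> S" using assms openE by blast
  define d where "d = min d1 (min d2 d3)"
  have d: "d > 0" "ball x d \<subseteq> S" using d1 d2 d3 by (auto simp: d_def)
  define N where "N = norm u + norm v + 1"
  \<comment> \<open>Small enough that the parallelogram spanned by \<open>h u\<close> and \<open>h v\<close> stays in the ball of radius \<open>d\<close>.\<close>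
  define h where "h = d / (2 * N)"
  have n: "N > 0" unfolding N_def by (smt (verit) norm_ge_zero)
  then have h: "h > 0" using d by (simp add: h_def)
  have hd: "h * (norm u + norm v) < d"
  proof -
    have "h * (norm u + norm v) \<le> h * N" using h by (simp add: N_def)
    also have "\<dots> = d / 2" using n by (simp add: h_def)
    finally show ?thesis using d by simp
  qed
  have near: "dist (x + s *\<^sub>R u + t *\<^sub>R v) x < d" if "0 < s" "s < h" "0 < t" "t < h" for s t u' v'
  proof -
    have "norm (s *\<^sub>R u + t *\<^sub>R v) \<le> s * norm u + t * norm v"
      using that norm_triangle_ineq[of "s *\<^sub>R u" "t *\<^sub>R v"] by simp
    also have "\<dots> \<le> h * norm u + h * norm v" using that by (intro add_mono mult_right_mono) auto
    also have "\<dots> < d" using hd by (simp add: distrib_left)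
    finally show ?thesis by (simp add: dist_norm add.assoc)
  qed
  let ?\<Delta> = "f (x + h *\<^sub>R u + h *\<^sub>R v) - f (x + h *\<^sub>R u) - f (x + h *\<^sub>R v) + f x"
  obtain s t where st: "0 < s" "s < h" "0 < t" "t < h" "?\<Delta> = h * h * F u v (x + s *\<^sub>R u + t *\<^sub>R v)"
    using second_difference_mean_value[OF assms(1,2) h d(2) hd] unfolding F_def by blast
  obtain s' t' where st': "0 < s'" "s' < h" "0 < t'" "t' < h" "?\<Delta> = h * h * F v u (x + s' *\<^sub>R v + t' *\<^sub>R u)"
    using second_difference_mean_value[OF assms(1,2) h d(2), of v u] hd unfolding F_def
    by (auto simp: algebra_simps)
  have "F u v (x + s *\<^sub>R u + t *\<^sub>R v) = F v u (x + t' *\<^sub>R u + s' *\<^sub>R v)"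
    using st(5) st'(5) h by (simp add: algebra_simps)
  moreover have "\<bar>F u v (x + s *\<^sub>R u + t *\<^sub>R v) - ?a\<bar> < e" 
    using d1(2) near[OF st(1-4)] by (simp add: d_def)
  moreover have "\<bar>F v u (x + t' *\<^sub>R u + s' *\<^sub>R v) - ?b\<bar> < e" 
    using d2(2) near[OF st'(3,4,1,2)] by (simp add: d_def)
  ultimately have "\<bar>?a - ?b\<bar> < 2 * e" by linarith
  then show False by (simp add: e_def)
qed

lemma second_derivative_symmetric:
  fixes f :: "'a::euclidean_space \<Rightarrow> 'b::euclidean_space"
  assumes S: "open S" "x \<in> S" and f: "times_diff_on 2 S f"
  shows "frechet_derivative (\<lambda>y. frechet_derivative f (at y) u) (at x) v
       = frechet_derivative (\<lambda>y. frechet_derivative f (at y) v) (at x) u"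
proof (rule euclidean_eqI)
  fix b :: 'b
  have f2: "times_diff_on (Suc (Suc 0)) S f" using f by (simp add: numeral_2_eq_2)
  have lin: "frechet_derivative (\<lambda>y. F y \<bullet> b) (at x) v = frechet_derivative F (at x) v \<bullet> b"
    if "times_diff_on (Suc 0) S F" "x \<in> S" for F :: "'a \<Rightarrow> 'b" and x v
    using bounded_linear.has_derivative[OF bounded_linear_inner_left times_diff_on_deriv(1)[OF that], of b]
    by (metis frechet_derivative_at)
  have "times_diff_on 2 S (\<lambda>y. f y \<bullet> b)"
    by (rule times_diff_on_linear[OF bounded_linear_inner_left S(1) f])
  from second_derivative_symmetric_real[OF S(1) this S(2)]
  have "frechet_derivative (\<lambda>y. frechet_derivative (\<lambda>y. f y \<bullet> b) (at y) u) (at x) v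
       = frechet_derivative (\<lambda>y. frechet_derivative (\<lambda>y. f y \<bullet> b) (at y) v) (at x) u" for u v .
  moreover have "frechet_derivative (\<lambda>y. frechet_derivative (\<lambda>y. f y \<bullet> b) (at y) u) (at x) v
     = frechet_derivative (\<lambda>y. frechet_derivative f (at y) u) (at x) v \<bullet> b" for u v
  proof -
    have "frechet_derivative (\<lambda>y. frechet_derivative (\<lambda>y. f y \<bullet> b) (at y) u) (at x)
        = frechet_derivative (\<lambda>y. frechet_derivative f (at y) u \<bullet> b) (at x)"
      by (rule frechet_derivative_cong_open[OF S]) (rule lin[OF times_diff_on_Suc_D[OF f2]])
    then show ?thesis using lin[OF times_diff_on_deriv(2)[OF f2, of u] S(2)] by simp
  qed
  ultimately show "frechet_derivative (\<lambda>y. frechet_derivative f (at y) u) (at x) v \<bullet> b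
       = frechet_derivative (\<lambda>y. frechet_derivative f (at y) v) (at x) u \<bullet> b" by simp
qed

section \<open>Alternating forms on lists of vectors\<close>

lemma finite_index_lists [simp]: "finite {is :: 7 list. length is = k}"
  using finite_lists_length_eq[of "UNIV :: 7 set" k] by simp

lemma sum_lists_Suc:
  "(\<Sum>is | length (is :: 7 list) = Suc k. f is) = (\<Sigma> i. \<Sum>is | length is = k. f (i # is))"
proof -
  have "(\<Sum>is | length (is :: 7 list) = Suc k. f is) = (\<Sum>(i, is)\<in>UNIV \<times> {is. length is = k}. f (i # is))"
    by (rule sum.reindex_bij_witness[of _ "\<lambda>(i, is). i # is" "\<lambda>is. (hd is, tl is)"]) (auto simp: length_Suc_conv)
  then show ?thesis by (simp add: sum.cartesian_product)
qed

text \<open>A sum over multi-indices may be organised by the entry at any fixed position, not only the first.\<close>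
lemma sum_lists_insert:
  assumes "i \<le> k"
  shows "(\<Sum>vs | length (vs :: 7 list) = Suc k. G (vs ! i) (take i vs @ drop (Suc i) vs))
       = (\<Sigma> a. \<Sum>bs | length bs = k. G a bs)"
  using assms
proof (induction i arbitrary: k G)
  case 0
  show ?case by (simp add: sum_lists_Suc)
next
  case (Suc i)
  then obtain k' where k: "k = Suc k'" "i \<le> k'" by (cases k) auto
  have "(\<Sum>vs | length (vs :: 7 list) = Suc k. G (vs ! Suc i) (take (Suc i) vs @ drop (Suc (Suc i)) vs))
      = (\<Sigma> b. \<Sum>vs | length vs = Suc k'. G (vs ! i) (b # (take i vs @ drop (Suc i) vs)))"
    unfolding k sum_lists_Suc[of _ "Suc k'"] by simp
  also have "\<dots> = (\<Sigma> b. \<Sigma> a. \<Sum>bs | length bs = k'. G a (b # bs))"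
    by (simp only: Suc.IH[OF k(2), of "\<lambda>a bs. G a (_ # bs)"])
  also have "\<dots> = (\<Sigma> a. \<Sum>bs | length bs = k. G a bs)"
    unfolding k sum_lists_Suc by (rule sum.swap)
  finally show ?case .
qed

text \<open>Splitting a multi-index into the entries at positions in \<open>I\<close> and the others is a bijection; this
  separates the two factors of a wedge product.\<close>
lemma sum_lists_nths:
  assumes "I \<subseteq> {..<n}"
  shows "(\<Sum>vs | length (vs :: 7 list) = n. G (nths vs I) (nths vs (- I)))
       = (\<Sum>as | length as = card I. \<Sum>bs | length bs = n - card I. G as bs :: real)"
  using assms
proof (induction n arbitrary: I G)
  case 0
  then show ?case by simp
next
  case (Suc n)
  define J where "J = {j. Suc j \<in> I}"
  have J: "J \<subseteq> {..<n}" using Suc.prems by (auto simp: J_def)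
  have fin: "finite J" "finite I" using J Suc.prems finite_subset by blast+
  have card_J: "card J \<le> n" using card_mono[OF _ J] by simp
  have compl: "{j. Suc j \<notin> I} = - J" by (auto simp: J_def)
  have I: "I = (if 0 \<in> I then insert 0 (Suc ` J) else Suc ` J)"
  proof -
    have "n \<in> Suc ` J" if "n \<in> I" "n \<noteq> 0" for n using that by (cases n) (auto simp: J_def)
    then show ?thesis by (auto simp: J_def)
  qed
  have card_I: "card I = (if 0 \<in> I then Suc (card J) else card J)"
  proof -
    have "card (Suc ` J) = card J" by (simp add: card_image)
    then show ?thesis using I fin(1) by (metis card_insert_disjoint finite_imageI image_iff nat.simps(3))
  qed
  show ?case
  proof (cases "0 \<in> I")
    case True
    have "(\<Sum>vs | length (vs :: 7 list) = Suc n. G (nths vs I) (nths vs (- I)))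
        = (\<Sigma> v. \<Sum>vs | length vs = n. G (v # nths vs J) (nths vs (- J)))"
      unfolding sum_lists_Suc using True by (simp add: nths_Cons J_def[symmetric] compl)
    also have "\<dots> = (\<Sigma> v. \<Sum>as | length as = card J. \<Sum>bs | length bs = n - card J. G (v # as) bs)"
      by (simp only: Suc.IH[OF J, of "\<lambda>as bs. G (_ # as) bs"])
    finally show ?thesis using True by (simp add: card_I sum_lists_Suc)
  next
    case False
    have "(\<Sum>vs | length (vs :: 7 list) = Suc n. G (nths vs I) (nths vs (- I)))
        = (\<Sigma> v. \<Sum>vs | length vs = n. G (nths vs J) (v # nths vs (- J)))"
      unfolding sum_lists_Suc using False by (simp add: nths_Cons J_def[symmetric] compl)
    also have "\<dots> = (\<Sigma> v. \<Sum>as | length as = card J. \<Sum>bs | length bs = n - card J. G as (v # bs))"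
      by (simp only: Suc.IH[OF J, of "\<lambda>as bs. G as (_ # bs)"])
    also have "\<dots> = (\<Sum>as | length as = card J. \<Sum>bs | length bs = Suc n - card J. G as bs)"
      using card_J by (subst sum.swap) (simp add: Suc_diff_le sum_lists_Suc)
    finally show ?thesis using False by (simp add: card_I)
  qed
qed

definition multilinear :: "nat \<Rightarrow> (vec7 list \<Rightarrow> real) \<Rightarrow> bool" where
  "multilinear k F \<longleftrightarrow> (\<forall>vs i. length vs = k \<and> i < k \<longrightarrow> linear (\<lambda>v. F (vs[i := v])))"

lemma multilinear_Cons:
  assumes "multilinear (Suc k) F"
  shows "multilinear k (\<lambda>vs. F (v # vs))" "length vs = k \<Longrightarrow> linear (\<lambda>v. F (v # vs))"
proof -
  have *: "linear (\<lambda>w. F (us[i := w]))" if "length us = Suc k" "i < Suc k" for us i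
    using assms that by (simp add: multilinear_def)
  show "multilinear k (\<lambda>vs. F (v # vs))"
    unfolding multilinear_def using *[of "v # _" "Suc _"] by auto
  show "linear (\<lambda>v. F (v # vs))" if "length vs = k"
    using *[of "0 # vs" 0] that by simp
qed

lemma multilinear_append:
  assumes "multilinear k F" "length us + n = k"
  shows "multilinear n (\<lambda>vs. F (us @ vs))"
  using assms
proof (induction us arbitrary: F k)
  case (Cons u us)
  then obtain k' where k: "k = Suc k'" "length us + n = k'" by auto
  show ?case using Cons.IH[OF multilinear_Cons(1)[of k' F u]] Cons.prems k by simp
qed simp

lemma multilinear_prefix:
  assumes "multilinear (n + length us) F"
  shows "multilinear n (\<lambda>vs. F (vs @ us))"
  unfolding multilinear_def
proof (intro allI impI)
  fix vs :: "vec7 list" and i assume *: "length vs = n \<and> i < n"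
  then have "linear (\<lambda>v. F ((vs @ us)[i := v]))" 
    using assms unfolding multilinear_def by (metis length_append trans_less_add1)
  then show "linear (\<lambda>v. F (vs[i := v] @ us))" using * by (simp add: list_update_append)
qed

lemma multilinear_mult:
  assumes "multilinear k F"
  shows "multilinear k (\<lambda>vs. c * F vs)"
proof -
  have "linear (\<lambda>v. c * G v)" if "linear G" for G :: "vec7 \<Rightarrow> real"
    using linear_compose_scale_right[OF that, of c] by simp
  then show ?thesis using assms unfolding multilinear_def by auto
qed

lemma multilinear_ext_frame:
  assumes "multilinear k F" "multilinear k G" "\<And>is. length is = k \<Longrightarrow> F (map E is) = G (map E is)"
    and E: "\<And>v. v = (\<Sum>i\<in>(UNIV::7 set). e i v *\<^sub>R E i)" and "length vs = k"
  shows "F vs = G vs"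
  using assms(1-3,5)
proof (induction k arbitrary: F G vs)
  case (Suc k)
  obtain v ws where vs: "vs = v # ws" "length ws = k" using Suc.prems(4) by (cases vs) auto
  have lin: "linear (\<lambda>v. F (v # ws))" "linear (\<lambda>v. G (v # ws))"
    using multilinear_Cons(2) Suc.prems(1,2) vs(2) by blast+
  have "F (E i # ws) = G (E i # ws)" for i
    using Suc.IH[OF multilinear_Cons(1)[OF Suc.prems(1), of "E i"] multilinear_Cons(1)[OF Suc.prems(2), of "E i"] _ vs(2)]
      Suc.prems(3)[of "i # _"] by simp
  then show ?case
    unfolding vs(1) by (subst (1 2) E) (simp add: linear_sum[OF lin(1)] linear_sum[OF lin(2)] linear_cmul[OF lin(1)] linear_cmul[OF lin(2)])
qed simp

lemma alternating_form_multilinear: "alternating_form k F \<Longrightarrow> multilinear k F"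
  unfolding alternating_form_def multilinear_def by blast

lemma alternating_form_zero: "alternating_form k F \<Longrightarrow> length vs \<noteq> k \<Longrightarrow> F vs = 0"
  unfolding alternating_form_def by blast

lemma alternating_form_repeat:
  assumes "alternating_form k F" "\<not> distinct vs" shows "F vs = 0"
proof (cases "length vs = k")
  case True
  from assms(2) obtain i j where "i < j" "j < length vs" "vs ! i = vs ! j"
    by (metis distinct_conv_nth linorder_neqE_nat)
  then show ?thesis using assms(1) True unfolding alternating_form_def by blast
qed (use alternating_form_zero[OF assms(1)] in blast)

text \<open>Polarisation: the form vanishes when both slots carry \<open>a + b\<close>.\<close>
lemma alternating_form_exchange:
  assumes F: "alternating_form k F" and ij: "i < j" "j < length vs"
  shows "F (vs[i := a, j := b]) = - F (vs[i := b, j := a])"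
proof (cases "length vs = k")
  case True
  have lin: "linear (\<lambda>v. F (us[i := v]))" if "length us = k" "i < k" for us i
    using F that unfolding alternating_form_def by blast
  have li: "F (vs[i := a + b, j := c]) = F (vs[i := a, j := c]) + F (vs[i := b, j := c])" for c
    using linear_add[OF lin[of "vs[j := c]" i], of a b] True ij by (simp add: list_update_swap)
  have lj: "F (vs[i := c, j := a + b]) = F (vs[i := c, j := a]) + F (vs[i := c, j := b])" for c
    using linear_add[OF lin[of "vs[i := c]" j], of a b] True ij by simp
  have z: "F (vs[i := c, j := c]) = 0" for c
  proof -
    have "length (vs[i := c, j := c]) = k \<and> i < j \<and> j < k \<and> vs[i := c, j := c] ! i = vs[i := c, j := c] ! j"
      using True ij by simp
    then show ?thesis using F unfolding alternating_form_def by blast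
  qed
  from z[of "a + b"] have "F (vs[i := a, j := b]) + F (vs[i := b, j := a]) = 0"
    unfolding li lj z[of a] z[of b] by simp
  then show ?thesis by simp
qed (use alternating_form_zero[OF F] in simp)

lemma alternating_form_swap:
  assumes "alternating_form k F"
  shows "F (us @ v # w # ws) = - F (us @ w # v # ws)"
  using alternating_form_exchange[OF assms, of "length us" "Suc (length us)" "us @ v # w # ws" v w]
  by (simp add: list_update_append)

lemma alternating_form_move:
  assumes "alternating_form k F"
  shows "F (us @ vs @ w # ws) = (-1) ^ length vs * F (us @ w # vs @ ws)"
proof (induction vs arbitrary: us)
  case (Cons v vs)
  show ?case using Cons[of "us @ [v]"] alternating_form_swap[OF assms, of us v w "vs @ ws"] by simp
qed simp

lemma alternating_form_move_block:
  assumes "alternating_form k F"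
  shows "F (us @ vs @ ws @ zs) = (-1) ^ (length vs * length ws) * F (us @ ws @ vs @ zs)"
proof (induction ws arbitrary: us)
  case (Cons w ws)
  show ?case using Cons[of "us @ [w]"] alternating_form_move[OF assms, of us vs w "ws @ zs"]
    by (simp add: power_add)
qed simp

text \<open>Each position in \<open>I\<close> is moved to the front past the earlier positions outside \<open>I\<close>. This matches the sign
  in the definition of the wedge product.\<close>
lemma alternating_form_shuffle:
  assumes F: "alternating_form k F" and "I \<subseteq> {..<length vs}"
  shows "F (us @ vs @ ws) = (-1) ^ card {(i, j). i \<in> I \<and> j \<notin> I \<and> j < i} * F (us @ nths vs I @ nths vs (- I) @ ws)"
  using assms(2)
proof (induction vs arbitrary: us I)
  case Nil
  then show ?case by simp
next
  case (Cons v vs)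
  define J where "J = {j. Suc j \<in> I}"
  let ?inv = "\<lambda>I. {(i, j). i \<in> I \<and> j \<notin> I \<and> j < i} :: (nat \<times> nat) set"
  have J: "J \<subseteq> {..<length vs}" using Cons.prems by (auto simp: J_def)
  have finJ: "finite J" using J finite_subset by blast
  have compl: "{j. Suc j \<notin> I} = - J" by (auto simp: J_def)
  have finv: "finite (?inv J)"
    by (rule finite_subset[of _ "{..length vs} \<times> {..length vs}"]) (use J in auto)
  have len: "length (nths vs J) = card J"
    using J by (simp add: length_nths) (metis (no_types, lifting) Collect_cong Collect_mem_eq lessThan_iff subset_iff)
  let ?S = "(\<lambda>(i, j). (Suc i, Suc j)) ` ?inv J"
  have cS: "card ?S = card (?inv J)" by (intro card_image inj_onI) auto
  show ?case
  proof (cases "0 \<in> I")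
    case True
    have "?inv I = ?S"
    proof (intro set_eqI iffI; clarsimp)
      fix a b assume "a \<in> I" "b \<notin> I" "b < a"
      then show "(a, b) \<in> ?S" using True by (cases a; cases b) (auto simp: J_def)
    qed (auto simp: J_def)
    then show ?thesis
      using Cons.IH[OF J, of "us @ [v]"] True cS by (simp add: nths_Cons J_def[symmetric] compl)
  next
    case False
    have "?inv I = ?S \<union> (\<lambda>i. (Suc i, 0)) ` J"
    proof (intro set_eqI iffI; clarsimp)
      fix a b assume *: "a \<in> I" "b \<notin> I" "b < a" "(a, b) \<notin> (\<lambda>i. (Suc i, 0)) ` J"
      then show "(a, b) \<in> ?S" using False by (cases a; cases b) (auto simp: J_def)
    qed (use False in \<open>auto simp: J_def\<close>)
    moreover have "card (?S \<union> (\<lambda>i. (Suc i, 0)) ` J) = card (?inv J) + card J"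
      by (subst card_Un_disjoint) (use finJ finv cS in \<open>auto simp: card_image inj_on_def\<close>)
    ultimately have "card (?inv I) = card (?inv J) + card J" by simp
    then show ?thesis
      using Cons.IH[OF J, of "us @ [v]"] False alternating_form_move[OF F, of us "nths vs J" v "nths vs (- J) @ ws"] len
      by (simp add: nths_Cons J_def[symmetric] compl power_add)
  qed
qed

text \<open>Adjacent transpositions connect all rearrangements of a list, so a property invariant under them depends on
  the multiset only.\<close>
lemma mset_eq_by_swaps:
  assumes swap: "\<And>us x y vs. P (us @ x # y # vs) = P (us @ y # x # vs)" and "mset xs = mset ys"
  shows "P xs = P ys"
  using assms
proof (induction xs arbitrary: ys P)
  case (Cons x xs)
  have "x \<in> set ys" using Cons.prems(2) by (metis list.set_intros(1) set_mset_mset)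
  then obtain us vs where ys: "ys = us @ x # vs" by (meson split_list)
  note sw = Cons.prems(1)
  have "P (zs @ us @ x # vs) = P (zs @ x # us @ vs)" for zs
  proof (induction us arbitrary: zs)
    case (Cons u us)
    show ?case using Cons[of "zs @ [u]"] sw[of zs u x "us @ vs"] by simp
  qed simp
  from this[of "[]"] have "P ys = P (x # us @ vs)" by (simp add: ys)
  also have "P (x # us @ vs) = P (x # xs)"
    using Cons.IH[of "\<lambda>zs. P (x # zs)" "us @ vs"] Cons.prems(1)[of "x # _"] Cons.prems(2) by (simp add: ys)
  finally show ?case by simp
qed simp

section \<open>Orthonormal frames and the Hodge operator\<close>

text \<open>The tangent space at one point, carrying an inner product.\<close>
locale inner_at =
  fixes g :: metric and x :: vec7
  assumes bil: "bilinear (g x)" and sym: "g x u v = g x v u" and pos: "v \<noteq> 0 \<Longrightarrow> g x v v > 0"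
begin

lemma g_linear: "linear (g x u)" "linear (\<lambda>u. g x u v)"
  using bil by (auto simp: bilinear_def)

lemma g_sum: "g x (\<Sum>i\<in>I. c i *\<^sub>R f i) v = (\<Sum>i\<in>I. c i * g x (f i) v)"
    "g x v (\<Sum>i\<in>I. c i *\<^sub>R f i) = (\<Sum>i\<in>I. c i * g x v (f i))"
  by (simp_all add: linear_sum[OF g_linear(2)] linear_cmul[OF g_linear(2)] linear_sum[OF g_linear(1)] linear_cmul[OF g_linear(1)])

lemma g_ext: "(\<And>w. g x u w = g x v w) \<Longrightarrow> u = v"
  using pos[of "u - v"] linear_diff[OF g_linear(2), of u v "u - v"] by fastforce

definition orthonormal :: "(7 \<Rightarrow> vec7) \<Rightarrow> bool" where
  "orthonormal B \<longleftrightarrow> (\<forall>i j. g x (B i) (B j) = dl i j)"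

lemma orthonormal_expand:
  assumes "orthonormal B"
  shows "v = (\<Sum>i\<in>UNIV. g x v (B i) *\<^sub>R B i)"
proof -
  define f where "f c = (\<Sum>i\<in>UNIV. (c $ i) *\<^sub>R B i)" for c :: vec7
  have f: "g x (f c) (B j) = c $ j" for c j
    using assms by (simp add: f_def g_sum orthonormal_def)
  have lin: "linear f"
    unfolding f_def by (intro linearI) (simp_all add: scaleR_add_left sum.distrib scaleR_sum_right)
  have "inj f" by (intro injI) (metis f vec_eq_iff)
  then have "surj f" using lin linear_injective_imp_surjective by blast
  then obtain c where c: "v = f c" by (meson surjD)
  show ?thesis using f[of c] unfolding c by (simp add: f_def)
qed

text \<open>The basic trace argument behind the independence of all constructions of the choice hidden in \<open>onb\<close>.\<close>
lemma bilinear_trace_indep: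
  assumes B: "orthonormal B" and C: "orthonormal C" 
    and lin: "\<And>v. linear (\<lambda>u. F u v)" "\<And>u. linear (F u)"
  shows "(\<Sigma> i. F (B i) (B i)) = (\<Sigma> i. F (C i) (C i))"
proof -
  have exp: "F u v = (\<Sigma> j. \<Sigma> k. g x u (C j) * g x v (C k) * F (C j) (C k))" for u v
  proof -
    have "F u v = (\<Sigma> j. g x u (C j) * F (C j) v)"
      by (subst orthonormal_expand[OF C, of u]) (simp add: linear_sum[OF lin(1)] linear_cmul[OF lin(1)])
    moreover have "F w v = (\<Sigma> k. g x v (C k) * F w (C k))" for w
      by (subst orthonormal_expand[OF C, of v]) (simp add: linear_sum[OF lin(2)] linear_cmul[OF lin(2)])
    ultimately show ?thesis by (simp only: sum_distrib_left mult.assoc)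
  qed
  have "(\<Sigma> i. F (B i) (B i)) = (\<Sigma> i. \<Sigma> j. \<Sigma> k. g x (B i) (C j) * g x (B i) (C k) * F (C j) (C k))"
    by (simp only: exp[of "B _" "B _"])
  also have "\<dots> = (\<Sigma> j. \<Sigma> k. (\<Sigma> i. g x (C k) (B i) * g x (B i) (C j)) * F (C j) (C k))"
    by (subst sum_rot3) (simp add: sum_distrib_right sum_distrib_left sym[of "C _"] mult_ac)
  also have "\<dots> = (\<Sigma> j. \<Sigma> k. dl k j * F (C j) (C k))"
  proof -
    have "(\<Sigma> i. g x (C k) (B i) * g x (B i) (C j)) = g x (C k) (C j)" for j k
      using g_sum(1)[of "\<lambda>i. g x (C k) (B i)" B UNIV "C j"] orthonormal_expand[OF B, of "C k"] by simp
    then show ?thesis using C by (simp add: orthonormal_def)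
  qed
  finally show ?thesis by simp
qed

lemma list_contraction_indep:
  assumes B: "orthonormal B" and C: "orthonormal C" 
    and "multilinear k \<alpha>" "multilinear k \<beta>"
  shows "(\<Sum>is | length is = k. \<alpha> (map B is) * \<beta> (map B is)) = (\<Sum>is | length is = k. \<alpha> (map C is) * \<beta> (map C is))"
  using assms(3,4)
proof (induction k arbitrary: \<alpha> \<beta>)
  case (Suc k)
  define F where "F u v = (\<Sum>is | length is = k. \<alpha> (u # map C is) * \<beta> (v # map C is))" for u v
  have "(\<Sum>is | length is = Suc k. \<alpha> (map B is) * \<beta> (map B is)) = (\<Sigma> i. F (B i) (B i))"
    unfolding F_def sum_lists_Suc
    using Suc.IH[OF multilinear_Cons(1)[OF Suc.prems(1)] multilinear_Cons(1)[OF Suc.prems(2)]] by simp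
  also have "\<dots> = (\<Sigma> i. F (C i) (C i))"
  proof (rule bilinear_trace_indep[where F = F, OF B C])
    have *: "linear (\<lambda>v. c * G v)" if "linear G" for G :: "vec7 \<Rightarrow> real" and c
      using linear_compose_scale_right[OF that, of c] by simp
    show "linear (\<lambda>u. F u v)" for v
      unfolding F_def by (intro linear_compose_sum ballI, subst mult.commute, intro * multilinear_Cons(2)[OF Suc.prems(1)]) auto
    show "linear (F u)" for u
      unfolding F_def by (intro linear_compose_sum ballI * multilinear_Cons(2)[OF Suc.prems(2)]) auto
  qed
  finally show ?case by (simp add: F_def sum_lists_Suc)
qed simp

end

text \<open>An oriented orthonormal frame at a point, written as a volume form taking the value 1 on it. Such a frame
  replaces the arbitrary choice in \<open>onb\<close> in all formulas below.\<close>
locale frame_at = inner_at +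
  fixes vol :: field and E :: "7 \<Rightarrow> vec7"
  assumes orth: "g x (E i) (E j) = dl i j"
    and vol_alt: "alternating_form 7 (vol x)"
    and vol_frame: "vol x (map E [1,2,3,4,5,6,7]) = 1"
begin

lemma E_orthonormal: "orthonormal E" by (simp add: orthonormal_def orth)

lemmas E_expand = orthonormal_expand[OF E_orthonormal]

lemma onb_orthonormal: "orthonormal (onb g x)"
proof -
  have "\<exists>B :: 7 \<Rightarrow> vec7. \<forall>i j. g x (B i) (B j) = (if i = j then 1 else 0)"
    by (rule exI[of _ E]) (simp add: orth dl_def)
  from someI_ex[OF this] show ?thesis unfolding onb_def orthonormal_def dl_def .
qed

lemmas vol_multilinear = alternating_form_multilinear[OF vol_alt]

lemma multilinear_ext:
  assumes "multilinear k F" "multilinear k G" "\<And>is. length is = k \<Longrightarrow> F (map E is) = G (map E is)" "length vs = k"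
  shows "F vs = G vs"
  using multilinear_ext_frame[OF assms(1-3) E_expand assms(4)] .

lemma form_inner_frame:
  "multilinear k (\<alpha> x) \<Longrightarrow> multilinear k (\<beta> x) \<Longrightarrow>
   form_inner k g \<alpha> \<beta> x = (\<Sum>is | length is = k. \<alpha> x (map E is) * \<beta> x (map E is)) / fact k"
  unfolding form_inner_def using list_contraction_indep[OF onb_orthonormal E_orthonormal] by simp

lemma hodge_frame:
  assumes "multilinear k (\<alpha> x)" "length ws + k = 7"
  shows "hodge g vol \<alpha> x ws = (\<Sum>is | length is = k. \<alpha> x (map E is) * vol x (map E is @ ws)) / fact k"
proof -
  have "7 - length ws = k" using assms(2) by simp
  moreover have "multilinear k (\<lambda>us. vol x (us @ ws))"
    using multilinear_prefix[of k ws "vol x"] vol_multilinear assms(2) by (simp add: add.commute)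
  ultimately show ?thesis
    unfolding hodge_def Let_def using list_contraction_indep[OF onb_orthonormal E_orthonormal assms(1)] by simp
qed

lemma hodge_alternating:
  assumes "\<And>vs. length vs \<noteq> k \<Longrightarrow> \<alpha> x vs = 0" "k \<le> 7"
  shows "alternating_form (7 - k) (hodge g vol \<alpha> x)"
  unfolding alternating_form_def
proof (intro conjI allI impI)
  let ?O = "onb g x"
  fix vs :: "vec7 list"
  show "hodge g vol \<alpha> x vs = 0" if "length vs \<noteq> 7 - k"
  proof (cases "length vs \<le> 7")
    case True
    then have "7 - length vs \<noteq> k" using that by auto
    then show ?thesis unfolding hodge_def Let_def using assms(1) by (auto intro!: sum.neutral)
  next
    case False
    then show ?thesis unfolding hodge_def Let_def using alternating_form_zero[OF vol_alt] by (auto intro!: sum.neutral)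
  qed
  fix i j
  show "hodge g vol \<alpha> x vs = 0" if "length vs = 7 - k \<and> i < j \<and> j < 7 - k \<and> vs ! i = vs ! j"
  proof -
    have "\<not> distinct vs" using that by (metis distinct_conv_nth less_trans order_less_irrefl)
    then show ?thesis unfolding hodge_def Let_def using alternating_form_repeat[OF vol_alt] by (auto intro!: sum.neutral)
  qed
  show "linear (\<lambda>v. hodge g vol \<alpha> x (vs[i := v]))" if "length vs = 7 - k \<and> i < 7 - k"
  proof -
    have *: "linear (\<lambda>v. vol x (us @ vs[i := v]))" if "length us = k" for us
    proof -
      have "multilinear (7 - k) (\<lambda>vs. vol x (us @ vs))"
        using multilinear_append[OF vol_multilinear, of us "7 - k"] that assms(2) by simp
      then show ?thesis using \<open>length vs = 7 - k \<and> i < 7 - k\<close> unfolding multilinear_def by blast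
    qed
    have **: "linear (\<lambda>v. c * G v)" "linear (\<lambda>v. G v / c)" if "linear G" for G :: "vec7 \<Rightarrow> real" and c
      using linear_compose_scale_right[OF that, of c] linear_compose_scale_right[OF that, of "inverse c"] 
      by (simp_all add: divide_inverse mult.commute)
    have "7 - (7 - k) = k" using assms(2) by simp
    then show ?thesis unfolding hodge_def Let_def using that
      by (auto intro!: linear_compose_sum ** *)
  qed
qed

text \<open>The star of a wedge product is an interior product with the star of the second factor. Each of the
  \<open>(p + q)\<close>-choose-\<open>p\<close> shuffles contributes the same amount, since the sign of the shuffle is cancelled by
  reordering the arguments of the volume form.\<close>
lemma hodge_wedge:
  assumes \<alpha>: "\<And>vs. length vs \<noteq> p \<Longrightarrow> \<alpha> x vs = 0" "multilinear p (\<alpha> x)"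
    and \<beta>: "\<And>vs. length vs \<noteq> q \<Longrightarrow> \<beta> x vs = 0" and len: "p + q + length ws = 7"
  shows "hodge g vol (\<alpha> \<and>\<^sub>f \<beta>) x ws
    = (- 1) ^ (p * q) * (\<Sum>is | length is = p. \<alpha> x (map E is) * hodge g vol \<beta> x (map E is @ ws)) / fact p"
proof -
  let ?O = "onb g x"
  define sh :: "nat set \<Rightarrow> real" where "sh I = (-1) ^ card {(i, j). i \<in> I \<and> j \<notin> I \<and> j < i}" for I
  have sh2: "sh I * sh I = 1" for I unfolding sh_def by (simp flip: power_add)
  define K where "K = (\<Sum>as | length as = p. \<Sum>bs | length bs = q.
     \<alpha> x (map ?O as) * \<beta> x (map ?O bs) * vol x (map ?O as @ map ?O bs @ ws))"
  have one: "(\<Sum>is | length is = p + q. sh I * \<alpha> x (nths (map ?O is) I) * \<beta> x (nths (map ?O is) (- I)) * vol x (map ?O is @ ws))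
     = (if card I = p then K else 0)" if I: "I \<in> Pow {..<p+q}" for I
  proof -
    have v: "vol x (map ?O is @ ws) = sh I * vol x (map ?O (nths is I) @ map ?O (nths is (- I)) @ ws)" if "length is = p + q" for "is"
      using alternating_form_shuffle[OF vol_alt, of I "map ?O is" "[]" ws] I that by (simp add: sh_def nths_map)
    have "(\<Sum>is | length is = p + q. sh I * \<alpha> x (nths (map ?O is) I) * \<beta> x (nths (map ?O is) (- I)) * vol x (map ?O is @ ws))
      = (\<Sum>is | length is = p + q. (sh I * sh I) * (\<alpha> x (map ?O (nths is I)) * \<beta> x (map ?O (nths is (- I)))
              * vol x (map ?O (nths is I) @ map ?O (nths is (- I)) @ ws)))"
      by (intro sum.cong refl) (simp add: v nths_map mult_ac)
    also have "\<dots> = (\<Sum>as | length as = card I. \<Sum>bs | length bs = p + q - card I. 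
       \<alpha> x (map ?O as) * \<beta> x (map ?O bs) * vol x (map ?O as @ map ?O bs @ ws))"
      unfolding sh2 mult_1 using sum_lists_nths[of I "p + q" "\<lambda>as bs. \<alpha> x (map ?O as) * \<beta> x (map ?O bs) * vol x (map ?O as @ map ?O bs @ ws)"] I
      by simp
    also have "\<dots> = (if card I = p then K else 0)"
      unfolding K_def using \<alpha>(1) by (auto intro!: sum.neutral)
    finally show ?thesis .
  qed
  have "hodge g vol (\<alpha> \<and>\<^sub>f \<beta>) x ws = (\<Sum>is | length is = p + q. (\<Sum>I\<in>Pow {..<p+q}. 
      sh I * \<alpha> x (nths (map ?O is) I) * \<beta> x (nths (map ?O is) (- I)) * vol x (map ?O is @ ws))) / fact (p + q)"
  proof -
    have "7 - length ws = p + q" using len by simp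
    then show ?thesis
      unfolding hodge_def wedge_def Let_def sh_def by (simp add: sum_distrib_right)
  qed
  also have "\<dots> = (\<Sum>I\<in>Pow {..<p+q}. if card I = p then K else 0) / fact (p + q)"
    by (subst sum.swap) (simp add: one)
  also have "(\<Sum>I\<in>Pow {..<p+q}. if card I = p then K else 0) = real ((p + q) choose p) * K"
  proof -
    have "(\<Sum>I\<in>Pow {..<p+q}. if card I = p then K else 0) = (\<Sum>I\<in>{I \<in> Pow {..<p+q}. card I = p}. K)"
      by (rule sum.inter_filter[symmetric]) simp
    also have "{I \<in> Pow {..<p+q}. card I = p} = {I. I \<subseteq> {..<p+q} \<and> card I = p}" by auto
    finally show ?thesis by (simp add: n_subsets)
  qed
  also have "real ((p + q) choose p) * K / fact (p + q) = K / fact q / fact p"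
    by (simp add: binomial_fact field_simps)
  also have "K / fact q = (-1) ^ (p * q) * (\<Sum>as | length as = p. \<alpha> x (map ?O as) * hodge g vol \<beta> x (map ?O as @ ws))"
  proof -
    have "(\<Sum>bs | length bs = q. \<alpha> x (map ?O as) * \<beta> x (map ?O bs) * vol x (map ?O as @ map ?O bs @ ws)) / fact q
        = (-1) ^ (p * q) * (\<alpha> x (map ?O as) * hodge g vol \<beta> x (map ?O as @ ws))" if "length as = p" for as
    proof -
      have "7 - (p + length ws) = q" using len by simp
      then have "hodge g vol \<beta> x (map ?O as @ ws) = (\<Sum>bs | length bs = q. \<beta> x (map ?O bs) * vol x (map ?O bs @ map ?O as @ ws)) / fact q"
        unfolding hodge_def Let_def using that by simp
      moreover have "vol x (map ?O as @ map ?O bs @ ws) = (-1) ^ (p * q) * vol x (map ?O bs @ map ?O as @ ws)" if "length bs = q" for bs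
        using alternating_form_move_block[OF vol_alt, of "[]" "map ?O as" "map ?O bs" ws] that \<open>length as = p\<close> by simp
      ultimately show ?thesis by (simp add: sum_distrib_left sum_divide_distrib mult_ac)
    qed
    then show ?thesis unfolding K_def by (simp add: sum_divide_distrib sum_distrib_left)
  qed
  also have "(\<Sum>as | length as = p. \<alpha> x (map ?O as) * hodge g vol \<beta> x (map ?O as @ ws)) = 
     (\<Sum>as | length as = p. \<alpha> x (map E as) * hodge g vol \<beta> x (map E as @ ws))"
  proof (rule list_contraction_indep[OF onb_orthonormal E_orthonormal \<alpha>(2)])
    have "multilinear (7 - q) (hodge g vol \<beta> x)"
      using hodge_alternating[of q \<beta>] \<beta> len alternating_form_multilinear by simp
    then show "multilinear p (\<lambda>us. hodge g vol \<beta> x (us @ ws))"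
      using multilinear_prefix[of p ws] len by (metis add.commute add_diff_cancel_left' add.assoc)
  qed
  finally show ?thesis .
qed

end

section \<open>Skew maps, the double Hodge star and the exterior derivative\<close>

lemma sum_lessThan_add: "(\<Sum>j<k + l. f j) = (\<Sum>j<k. f j) + (\<Sum>j<l. f (k + j) :: real)" for k l :: nat
  by (induction l) auto

text \<open>The derivation induced by an endomorphism on covariant tensors, without the conventional minus sign. With
  it, the covariant derivative of a tensor \<open>F\<close> in a direction \<open>u\<close> is the directional derivative of \<open>F\<close> minus
  \<open>act (\<Gamma> u) F\<close>.\<close>
definition act :: "(vec7 \<Rightarrow> vec7) \<Rightarrow> (vec7 list \<Rightarrow> real) \<Rightarrow> vec7 list \<Rightarrow> real" where
  "act A F vs = (\<Sum>j<length vs. F (vs[j := A (vs ! j)]))"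

lemma multilinear_act:
  assumes "linear A" "multilinear k F"
  shows "multilinear k (act A F)"
  unfolding multilinear_def
proof (intro allI impI)
  fix vs :: "vec7 list" and i assume *: "length vs = k \<and> i < k"
  have lin: "linear (\<lambda>v. F (us[i := v]))" if "length us = k" for us
    using assms(2) * that unfolding multilinear_def by blast
  have "linear (\<lambda>v. F ((vs[i := v])[j := A (vs[i := v] ! j)]))" if "j < k" for j
  proof (cases "j = i")
    case True
    then show ?thesis using linear_compose[OF assms(1) lin[of vs]] * by (simp add: comp_def)
  next
    case False
    then show ?thesis using lin[of "vs[j := A (vs ! j)]"] * by (simp add: list_update_swap)
  qed
  then show "linear (\<lambda>v. act A F (vs[i := v]))"
    unfolding act_def using * by (auto intro!: linear_compose_sum)
qed

lemma act_alternating_repeat: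
  assumes F: "alternating_form k F" and "\<not> distinct vs"
  shows "act A F vs = 0"
proof -
  from assms(2) obtain p q where pq: "p < q" "q < length vs" "vs ! p = vs ! q"
    by (metis distinct_conv_nth linorder_neqE_nat)
  define t where "t j = F (vs[j := A (vs ! j)])" for j
  have "t j = 0" if "j \<noteq> p" "j \<noteq> q" "j < length vs" for j
  proof -
    have "vs[j := A (vs ! j)] ! p = vs[j := A (vs ! j)] ! q" using that pq by simp
    then have "\<not> distinct (vs[j := A (vs ! j)])" 
      using pq by (metis distinct_conv_nth length_list_update less_trans order_less_irrefl)
    then show ?thesis unfolding t_def using alternating_form_repeat[OF F] by blast
  qed
  then have "(\<Sum>j<length vs. t j) = (\<Sum>j\<in>{p, q}. t j)"
    using pq by (intro sum.mono_neutral_right) auto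
  also have "\<dots> = t p + t q" using pq by simp
  also have "t p = - t q"
  proof -
    let ?w = "vs ! p"
    have "vs[p := A ?w, q := ?w] = vs[p := A ?w]"
      using pq by (intro nth_equalityI) (auto simp: nth_list_update)
    moreover have "vs[p := ?w, q := A ?w] = vs[q := A ?w]" by simp
    ultimately show ?thesis
      using alternating_form_exchange[OF F pq(1,2), of "A ?w" ?w] pq(3) unfolding t_def by simp
  qed
  finally show ?thesis by (simp add: act_def t_def)
qed

context frame_at
begin

text \<open>Moving a skew map from one factor of an orthonormal contraction to the other costs a sign.\<close>
lemma skew_contract:
  assumes A: "\<And>u v. g x (A u) v = - g x u (A v)" and l: "linear l1" "linear (l2 :: vec7 \<Rightarrow> real)"
  shows "(\<Sigma> b. l1 (A (E b)) * l2 (E b)) = - (\<Sigma> b. l1 (E b) * l2 (A (E b)))"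
proof -
  have e: "l (A (E b)) = (\<Sigma> m. g x (A (E b)) (E m) * l (E m))" if "linear l" for l :: "vec7 \<Rightarrow> real" and b
    by (subst E_expand[of "A (E b)"]) (simp add: linear_sum[OF that] linear_cmul[OF that])
  have "(\<Sigma> b. l1 (A (E b)) * l2 (E b)) = (\<Sigma> b. \<Sigma> m. g x (A (E b)) (E m) * l1 (E m) * l2 (E b))"
    by (simp add: e[OF l(1)] sum_distrib_right)
  also have "\<dots> = (\<Sigma> m. \<Sigma> b. g x (A (E b)) (E m) * l1 (E m) * l2 (E b))" by (rule sum.swap)
  also have "\<dots> = (\<Sigma> m. \<Sigma> b. - (l1 (E m) * (g x (A (E m)) (E b) * l2 (E b))))"
  proof (intro sum.cong refl)
    fix m b
    have "g x (A (E b)) (E m) = - g x (A (E m)) (E b)" using A[of "E b" "E m"] sym[of "E b" "A (E m)"] by simp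
    then show "g x (A (E b)) (E m) * l1 (E m) * l2 (E b) = - (l1 (E m) * (g x (A (E m)) (E b) * l2 (E b)))" by simp
  qed
  finally show ?thesis by (simp add: e[OF l(2)] sum_distrib_left sum_negf)
qed

lemma set_distinct_UNIV: "distinct is \<Longrightarrow> length is = 7 \<Longrightarrow> set is = (UNIV :: 7 set)"
  by (intro card_subset_eq) (auto simp: distinct_card)

text \<open>A skew map has trace zero.\<close>
lemma act_vol:
  assumes A: "\<And>u v. g x (A u) v = - g x u (A v)" "linear A"
  shows "act A (vol x) vs = 0"
proof (cases "length vs = 7")
  case False
  then show ?thesis unfolding act_def using alternating_form_zero[OF vol_alt] by simp
next
  case True
  have "act A (vol x) (map E is) = 0" if len: "length is = 7" for "is"
  proof (cases "distinct is")
    case False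
    then show ?thesis using act_alternating_repeat[OF vol_alt] by (meson distinct_map)
  next
    case True
    have "vol x ((map E is)[j := A (E (is ! j))]) = 0" if j: "j < 7" for j
    proof -
      have lin: "linear (\<lambda>v. vol x ((map E is)[j := v]))"
        using vol_multilinear len j unfolding multilinear_def by simp
      have "vol x ((map E is)[j := E m]) = 0" if "m \<noteq> is ! j" for m
      proof -
        obtain l where l: "l < 7" "is ! l = m"
          using set_distinct_UNIV[OF True len] len by (metis UNIV_I in_set_conv_nth)
        then have "l \<noteq> j" using that by auto
        then have "(map E is)[j := E m] ! l = (map E is)[j := E m] ! j" using l len j by simp
        then have "\<not> distinct ((map E is)[j := E m])"
          using \<open>l \<noteq> j\<close> l len j by (metis distinct_conv_nth length_list_update length_map)
        then show ?thesis using alternating_form_repeat[OF vol_alt] by blast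
      qed
      moreover have "g x (A (E (is ! j))) (E (is ! j)) = 0" using A(1)[of "E (is ! j)" "E (is ! j)"] sym by simp
      ultimately have "g x (A (E (is ! j))) (E m) * vol x ((map E is)[j := E m]) = 0" for m by (cases "m = is ! j") auto
      moreover have "vol x ((map E is)[j := A (E (is ! j))])
          = (\<Sigma> m. g x (A (E (is ! j))) (E m) * vol x ((map E is)[j := E m]))"
        by (subst E_expand[of "A (E (is ! j))"]) (simp add: linear_sum[OF lin] linear_cmul[OF lin])
      ultimately show ?thesis by (simp only: sum.neutral_const)
    qed
    then show ?thesis unfolding act_def using len by simp
  qed
  then show ?thesis
    using multilinear_ext[OF multilinear_act[OF A(2) vol_multilinear], of "\<lambda>_. 0"] True
    by (simp add: multilinear_def linear_zero)
qed

text \<open>Invariance of the star under the orthogonal group, in infinitesimal form. Moving the map off \<open>\<alpha>\<close>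
  produces its action on the first arguments of the volume form, which by \<open>act_vol\<close> is minus the action
  on the remaining ones.\<close>
lemma hodge_act:
  assumes A: "\<And>u v. g x (A u) v = - g x u (A v)" "linear A" and \<alpha>: "multilinear k (\<alpha> x)"
    and len: "length ws + k = 7"
  shows "hodge g vol (\<lambda>_. act A (\<alpha> x)) x ws = act A (hodge g vol \<alpha> x) ws"
proof -
  have j_term: "(\<Sum>bs | length bs = k. \<alpha> x ((map E bs)[j := A (E (bs ! j))]) * vol x (map E bs @ ws))
     = - (\<Sum>bs | length bs = k. \<alpha> x (map E bs) * vol x ((map E bs)[j := A (E (bs ! j))] @ ws))" if j: "j < k" for j
  proof -
    obtain k' where k': "k = Suc k'" "j \<le> k'" using j by (cases k) auto
    have upd: "(map E bs)[j := v] = map E (take j bs) @ v # map E (drop (Suc j) bs)" if "length bs = k" for bs v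
      using j that by (simp add: upd_conv_take_nth_drop take_map drop_map)
    have split: "map E bs = map E (take j bs) @ E (bs ! j) # map E (drop (Suc j) bs)" if "length bs = k" for bs
      using j that id_take_nth_drop[of j "map E bs"] by (simp add: take_map drop_map)
    have om: "take j (take j bs @ drop (Suc j) bs) = take j bs" "drop j (take j bs @ drop (Suc j) bs) = drop (Suc j) bs"
      if "length bs = k" for bs :: "7 list" using j that by auto
    have lin: "linear (\<lambda>v. \<alpha> x (map E (take j cs) @ v # map E (drop j cs)))"
      "linear (\<lambda>v. vol x (map E (take j cs) @ v # map E (drop j cs) @ ws))" if "length cs = k'" for cs
    proof -
      have "length (map E (take j cs) @ 0 # map E (drop j cs)) = k \<and> j < k"
        "length (map E (take j cs) @ 0 # map E (drop j cs) @ ws) = 7 \<and> j < 7" using that j k' len by auto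
      from \<alpha>[unfolded multilinear_def, rule_format, OF this(1)] vol_multilinear[unfolded multilinear_def, rule_format, OF this(2)]
      show "linear (\<lambda>v. \<alpha> x (map E (take j cs) @ v # map E (drop j cs)))"
        "linear (\<lambda>v. vol x (map E (take j cs) @ v # map E (drop j cs) @ ws))"
        using that k' by (simp_all add: list_update_append)
    qed
    define G where "G u v cs = \<alpha> x (map E (take j cs) @ u # map E (drop j cs))
              * vol x (map E (take j cs) @ v # map E (drop j cs) @ ws)" for u v and cs :: "7 list"
    have G1: "\<alpha> x ((map E bs)[j := A (E (bs ! j))]) * vol x (map E bs @ ws) = G (A (E (bs ! j))) (E (bs ! j)) (take j bs @ drop (Suc j) bs)"
      and G2: "\<alpha> x (map E bs) * vol x ((map E bs)[j := A (E (bs ! j))] @ ws) = G (E (bs ! j)) (A (E (bs ! j))) (take j bs @ drop (Suc j) bs)"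
      if "length bs = k" for bs
      unfolding G_def om[OF that] upd[OF that] by (subst split[OF that], simp)+
    have "(\<Sum>bs | length bs = k. \<alpha> x ((map E bs)[j := A (E (bs ! j))]) * vol x (map E bs @ ws))
       = (\<Sigma> b. \<Sum>cs | length cs = k'. G (A (E b)) (E b) cs)"
      using sum_lists_insert[OF k'(2), of "\<lambda>b cs. G (A (E b)) (E b) cs"] G1 k'(1) by simp
    also have "\<dots> = (\<Sum>cs | length cs = k'. \<Sigma> b. G (A (E b)) (E b) cs)" by (rule sum.swap)
    also have "\<dots> = (\<Sum>cs | length cs = k'. - (\<Sigma> b. G (E b) (A (E b)) cs))"
      unfolding G_def by (intro sum.cong refl, rule skew_contract[OF A(1) lin]) auto
    also have "\<dots> = - (\<Sigma> b. \<Sum>cs | length cs = k'. G (E b) (A (E b)) cs)"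
      unfolding sum_negf by (subst sum.swap) (rule refl)
    also have "\<dots> = - (\<Sum>bs | length bs = k. \<alpha> x (map E bs) * vol x ((map E bs)[j := A (E (bs ! j))] @ ws))"
      using sum_lists_insert[OF k'(2), of "\<lambda>b cs. G (E b) (A (E b)) cs"] G2 k'(1) by simp
    finally show ?thesis .
  qed
  have vol0: "(\<Sum>j<k. vol x ((map E bs)[j := A (E (bs ! j))] @ ws)) = - (\<Sum>j<length ws. vol x (map E bs @ ws[j := A (ws ! j)]))"
    if "length bs = k" for bs
  proof -
    have "0 = (\<Sum>j<k + length ws. vol x ((map E bs @ ws)[j := A ((map E bs @ ws) ! j)]))"
      using act_vol[OF A, of "map E bs @ ws"] that by (simp add: act_def)
    also have "\<dots> = (\<Sum>j<k. vol x ((map E bs @ ws)[j := A ((map E bs @ ws) ! j)]))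
       + (\<Sum>j<length ws. vol x ((map E bs @ ws)[k + j := A ((map E bs @ ws) ! (k + j))]))"
      by (rule sum_lessThan_add)
    finally show ?thesis using that by (simp add: list_update_append nth_append)
  qed
  have "(\<Sum>bs | length bs = k. act A (\<alpha> x) (map E bs) * vol x (map E bs @ ws))
      = (\<Sum>j<k. \<Sum>bs | length bs = k. \<alpha> x ((map E bs)[j := A (E (bs ! j))]) * vol x (map E bs @ ws))"
    unfolding act_def by (subst sum.swap) (simp add: sum_distrib_right)
  also have "\<dots> = - (\<Sum>bs | length bs = k. \<alpha> x (map E bs) * (\<Sum>j<k. vol x ((map E bs)[j := A (E (bs ! j))] @ ws)))"
    by (simp add: j_term sum_negf sum_distrib_left) (rule sum.swap)
  also have "\<dots> = (\<Sum>bs | length bs = k. \<Sum>j<length ws. \<alpha> x (map E bs) * vol x (map E bs @ ws[j := A (ws ! j)]))"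
    by (simp add: vol0 sum_negf sum_distrib_left)
  also have "\<dots> = (\<Sum>j<length ws. \<Sum>bs | length bs = k. \<alpha> x (map E bs) * vol x (map E bs @ ws[j := A (ws ! j)]))"
    by (rule sum.swap)
  finally have "(\<Sum>bs | length bs = k. act A (\<alpha> x) (map E bs) * vol x (map E bs @ ws)) = \<dots>" .
  then show ?thesis
    unfolding act_def[of A "hodge g vol \<alpha> x"]
    using hodge_frame[of k \<alpha>, OF \<alpha>] hodge_frame[of k "\<lambda>_. act A (\<alpha> x)" ws, OF multilinear_act[OF A(2) \<alpha>] len] len
    by (simp add: sum_divide_distrib)
qed

lemma vol_frame_sq: 
  assumes "distinct is" "length is = 7" shows "(vol x (map E is))\<^sup>2 = 1"
proof -
  have "mset is = mset [1,2,3,4,5,6,7]"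
    using set_distinct_UNIV[OF assms] assms(1) UNIV_7 by (intro set_eq_iff_mset_eq_distinct[THEN iffD1]) simp_all
  then have "(vol x (map E is))\<^sup>2 = (vol x (map E [1,2,3,4,5,6,7]))\<^sup>2"
  proof (rule mset_eq_by_swaps[where P = "\<lambda>is. (vol x (map E is))\<^sup>2", rotated])
    show "(vol x (map E (us @ i # j # vs)))\<^sup>2 = (vol x (map E (us @ j # i # vs)))\<^sup>2" for us i j vs
      using alternating_form_swap[OF vol_alt, of "map E us" "E i" "E j" "map E vs"] by simp
  qed
  then show ?thesis using vol_frame by simp
qed

lemma card_permutations_of_list:
  assumes "card C = k"
  shows "card {is :: 7 list. length is = k \<and> distinct is \<and> set is \<subseteq> C} = fact k"
  using card_lists_distinct_length_eq[of C k] assms by (simp add: fact_prod)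

text \<open>In dimension seven the sign \<open>(-1)\<^bsup>k (7 - k)\<^esup>\<close> is always \<open>+ 1\<close>. On frame vectors only rearrangements of
  complementary index sets survive, and they all contribute equally.\<close>
lemma hodge_hodge:
  assumes \<alpha>: "alternating_form k (\<alpha> x)" and len: "length vs = k" and k: "k \<le> 7"
  shows "hodge g vol (hodge g vol \<alpha>) x vs = \<alpha> x vs"
proof -
  have alt: "alternating_form (7 - k) (hodge g vol \<alpha> x)" 
    using hodge_alternating[of k \<alpha>] alternating_form_zero[OF \<alpha>] k by blast
  have "alternating_form (7 - (7 - k)) (hodge g vol (hodge g vol \<alpha>) x)"
    using alternating_form_zero[OF alt] by (intro hodge_alternating) auto
  then have mult: "multilinear k (hodge g vol (hodge g vol \<alpha>) x)" using k alternating_form_multilinear by simp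
  have "hodge g vol (hodge g vol \<alpha>) x (map E cs) = \<alpha> x (map E cs)" if cs: "length cs = k" for cs
  proof -
    define V where "V is = vol x (map E is)" for "is"
    have V0: "V is = 0" if "\<not> distinct is" for "is"
      unfolding V_def using alternating_form_repeat[OF vol_alt] that by (meson distinct_map)
    have lhs: "hodge g vol (hodge g vol \<alpha>) x (map E cs) = (\<Sum>js | length js = 7 - k. 
       (\<Sum>is | length is = k. \<alpha> x (map E is) * V (is @ js)) * V (js @ cs)) / (fact k * fact (7 - k))"
      using k cs alternating_form_multilinear[OF \<alpha>] alternating_form_multilinear[OF alt] 
      by (simp add: hodge_frame[of "7 - k"] hodge_frame[of k] V_def sum_divide_distrib[symmetric])
    show ?thesis
    proof (cases "distinct cs")
      case False
      then have "V (js @ cs) = 0" for js using V0 by simp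
      moreover have "\<alpha> x (map E cs) = 0" using False alternating_form_repeat[OF \<alpha>] by (meson distinct_map)
      ultimately show ?thesis using lhs by simp
    next
      case True
      let ?J = "{js. length js = 7 - k \<and> distinct js \<and> set js \<subseteq> - set cs}"
      have card_cs: "card (set cs) = k" "card (- set cs) = 7 - k"
        using True cs by (simp_all add: distinct_card Compl_eq_Diff_UNIV card_Diff_subset)
      have inner: "(\<Sum>is | length is = k. \<alpha> x (map E is) * V (is @ js)) * V (js @ cs) = fact k * \<alpha> x (map E cs)"
        if js: "js \<in> ?J" for js
      proof -
        have set_js: "- set js = set cs"
        proof (rule card_subset_eq[symmetric])
          show "card (set cs) = card (- set js)" using js card_cs k by (simp add: Compl_eq_Diff_UNIV card_Diff_subset distinct_card)
        qed (use js in auto)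
        have "\<alpha> x (map E is) * V (is @ js) = 0" if "\<not> (distinct is \<and> set is \<subseteq> set cs)" for "is"
          using V0[of "is @ js"] that set_js by auto
        then have "(\<Sum>is | length is = k. \<alpha> x (map E is) * V (is @ js)) =
            (\<Sum>is | length is = k \<and> distinct is \<and> set is \<subseteq> set cs. \<alpha> x (map E is) * V (is @ js))"
          by (intro sum.mono_neutral_right) auto
        also have "\<dots> = (\<Sum>is | length is = k \<and> distinct is \<and> set is \<subseteq> set cs. \<alpha> x (map E cs) * V (cs @ js))"
        proof (intro sum.cong refl)
          fix "is" assume i: "is \<in> {is. length is = k \<and> distinct is \<and> set is \<subseteq> set cs}"
          then have "set is = set cs" using card_cs by (intro card_subset_eq) (auto simp: distinct_card)
          then have "mset is = mset cs" using i True set_eq_iff_mset_eq_distinct by blast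
          then show "\<alpha> x (map E is) * V (is @ js) = \<alpha> x (map E cs) * V (cs @ js)"
          proof (rule mset_eq_by_swaps[where P = "\<lambda>is. \<alpha> x (map E is) * V (is @ js)", rotated])
            show "\<alpha> x (map E (us @ i # j # vs)) * V ((us @ i # j # vs) @ js)
                = \<alpha> x (map E (us @ j # i # vs)) * V ((us @ j # i # vs) @ js)" for us i j vs
              unfolding V_def using alternating_form_swap[OF vol_alt, of "map E us" "E i" "E j" "map E vs @ map E js"] 
                alternating_form_swap[OF \<alpha>, of "map E us" "E i" "E j" "map E vs"] by simp
          qed
        qed
        also have "\<dots> = fact k * (\<alpha> x (map E cs) * V (cs @ js))"
          using card_permutations_of_list[OF card_cs(1)] by simp
        finally have *: "(\<Sum>is | length is = k. \<alpha> x (map E is) * V (is @ js)) = fact k * (\<alpha> x (map E cs) * V (cs @ js))" .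
        have "even ((7 - k) * k)" using k by (cases "even k") auto
        then have "V (js @ cs) = V (cs @ js)"
          using alternating_form_move_block[OF vol_alt, of "[]" "map E js" "map E cs" "[]"] js cs by (simp add: V_def)
        moreover have "(V (cs @ js))\<^sup>2 = 1"
          unfolding V_def using js cs True k by (intro vol_frame_sq) auto
        ultimately show ?thesis unfolding * by (simp add: power2_eq_square mult.assoc)
      qed
      have "V (js @ cs) = 0" if "\<not> (distinct js \<and> set js \<subseteq> - set cs)" for js
        using V0[of "js @ cs"] that by auto
      then have "(\<Sum>js | length js = 7 - k. (\<Sum>is | length is = k. \<alpha> x (map E is) * V (is @ js)) * V (js @ cs))
         = (\<Sum>js\<in>?J. (\<Sum>is | length is = k. \<alpha> x (map E is) * V (is @ js)) * V (js @ cs))"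
        by (intro sum.mono_neutral_right) auto
      also have "\<dots> = (\<Sum>js\<in>?J. fact k * \<alpha> x (map E cs))"
        by (intro sum.cong refl inner)
      also have "\<dots> = fact (7 - k) * (fact k * \<alpha> x (map E cs))"
        using card_permutations_of_list[OF card_cs(2)] by simp
      finally show ?thesis unfolding lhs by simp
    qed
  qed
  then show ?thesis by (rule multilinear_ext[OF mult alternating_form_multilinear[OF \<alpha>] _ len])
qed

text \<open>The exterior derivative may be computed with a torsion-free covariant derivative: \<open>N u\<close> is the
  covariant derivative of \<open>\<alpha>\<close> for the connection \<open>L\<close>, and the terms with \<open>L\<close> cancel on alternation because
  \<open>L\<close> is symmetric. The star turns the alternation into a contraction.\<close>
lemma hodge_ext_deriv:
  assumes \<alpha>: "alternating_form k (\<alpha> x)" and len: "length ws + Suc k = 7"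
    and D: "\<And>u vs. length vs = k \<Longrightarrow> frechet_derivative (\<lambda>y. \<alpha> y vs) (at x) u = N u vs + act (L u) (\<alpha> x) vs"
    and L: "\<And>u v. L u v = L v u"
    and N: "\<And>u. multilinear k (N u)" "\<And>vs. length vs = k \<Longrightarrow> linear (\<lambda>u. N u vs)"
  shows "hodge g vol (ext_deriv \<alpha>) x ws = (-1) ^ k * (\<Sigma> a. hodge g vol (\<lambda>_. N (E a)) x (E a # ws))"
proof -
  let ?O = "onb g x"
  define \<beta> where "\<beta> u vs = frechet_derivative (\<lambda>y. \<alpha> y vs) (at x) u" for u vs
  define M where "M \<beta> = (\<Sigma> a. \<Sum>bs | length bs = k. \<beta> (?O a) (map ?O bs) * vol x (?O a # map ?O bs @ ws))" for \<beta>
  have i_term: "(\<Sum>is | length is = Suc k. (-1) ^ i * \<beta> (?O (is ! i)) (take i (map ?O is) @ drop (Suc i) (map ?O is)) * vol x (map ?O is @ ws))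
     = M \<beta>" if i: "i \<le> k" for i
  proof -
    have "(-1) ^ i * \<beta> (?O (is ! i)) (take i (map ?O is) @ drop (Suc i) (map ?O is)) * vol x (map ?O is @ ws)
       = \<beta> (?O (is ! i)) (map ?O (take i is @ drop (Suc i) is)) * vol x (?O (is ! i) # map ?O (take i is @ drop (Suc i) is) @ ws)"
      if "length is = Suc k" for "is"
    proof -
      have "map ?O is @ ws = [] @ map ?O (take i is) @ ?O (is ! i) # map ?O (drop (Suc i) is) @ ws"
        using i that id_take_nth_drop[of i "map ?O is"] by (simp add: take_map drop_map)
      then have "vol x (map ?O is @ ws) = (-1) ^ i * vol x (?O (is ! i) # map ?O (take i is) @ map ?O (drop (Suc i) is) @ ws)"
        using alternating_form_move[OF vol_alt, of "[]" "map ?O (take i is)" "?O (is ! i)" "map ?O (drop (Suc i) is) @ ws"] i that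
        by simp
      moreover have "(-1) ^ i * b * ((-1) ^ i * v) = b * v" for b v :: real
        by (cases "even i") auto
      ultimately show ?thesis by (simp add: take_map drop_map)
    qed
    then show ?thesis
      unfolding M_def using sum_lists_insert[OF i, of "\<lambda>a bs. \<beta> (?O a) (map ?O bs) * vol x (?O a # map ?O bs @ ws)"] by simp
  qed
  have n: "7 - length ws = Suc k" using len by simp
  have "hodge g vol (ext_deriv \<alpha>) x ws = (\<Sum>is | length is = Suc k. \<Sum>i<Suc k.
      (-1) ^ i * \<beta> (?O (is ! i)) (take i (map ?O is) @ drop (Suc i) (map ?O is)) * vol x (map ?O is @ ws)) / fact (Suc k)"
    unfolding hodge_def n Let_def ext_deriv_def \<beta>_def by (simp add: sum_distrib_right del: sum.lessThan_Suc)
  also have "\<dots> = (\<Sum>i<Suc k. M \<beta>) / fact (Suc k)"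
    by (subst sum.swap) (simp add: i_term del: sum.lessThan_Suc)
  also have "\<dots> = M \<beta> / fact k"
    by (simp add: fact_Suc[where 'a = real] del: of_nat_Suc)
  also have "M \<beta> = M N + M (\<lambda>u. act (L u) (\<alpha> x))"
    unfolding M_def \<beta>_def by (simp add: D distrib_right sum.distrib)
  also have "M (\<lambda>u. act (L u) (\<alpha> x)) = 0"
  proof -
    have "(\<Sigma> a. \<Sum>bs | length bs = k. \<alpha> x ((map ?O bs)[j := L (?O a) (?O (bs ! j))]) * vol x (?O a # map ?O bs @ ws)) = 0"
      if j: "j < k" for j
    proof -
      define f where "f = (\<lambda>(a, bs). \<alpha> x ((map ?O bs)[j := L (?O a) (?O (bs ! j))]) * vol x (?O a # map ?O bs @ ws))"
      \<comment> \<open>Exchanging the index of differentiation with the \<open>j\<close>-th argument changes the sign of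
        the volume form and nothing else.\<close>
      define \<sigma> where "\<sigma> = (\<lambda>(a :: 7, bs :: 7 list). (bs ! j, bs[j := a]))"
      let ?X = "(UNIV :: 7 set) \<times> {bs :: 7 list. length bs = k}"
      have "(\<Sum>p\<in>?X. f p) = (\<Sum>p\<in>?X. f (\<sigma> p))"
        by (rule sum.reindex_bij_witness[of _ \<sigma> \<sigma>]) (use j in \<open>auto simp: \<sigma>_def\<close>)
      also have "\<dots> = (\<Sum>p\<in>?X. - f p)"
      proof (intro sum.cong refl)
        fix p assume "p \<in> ?X"
        then obtain a bs where p: "p = (a, bs)" "length bs = k" by auto
        have "vol x (?O (bs ! j) # map ?O (bs[j := a]) @ ws) = - vol x (?O a # map ?O bs @ ws)"
          using alternating_form_exchange[OF vol_alt, of 0 "Suc j" "?O a # map ?O bs @ ws" "?O (bs ! j)" "?O a"] p(2) j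
          by (simp add: list_update_append map_update) (metis list_update_id map_update nth_map)
        moreover have "(map ?O (bs[j := a]))[j := v] = (map ?O bs)[j := v]" for v by (simp add: map_update)
        ultimately show "f (\<sigma> p) = - f p"
          using p j by (simp add: f_def \<sigma>_def L[of "?O (bs ! j)" "?O a"])
      qed
      finally have "(\<Sum>p\<in>?X. f p) = 0" by (simp add: sum_negf)
      then show ?thesis by (simp add: f_def sum.cartesian_product)
    qed
    then have "(\<Sum>j<k. \<Sigma> a. \<Sum>bs | length bs = k. \<alpha> x ((map ?O bs)[j := L (?O a) (?O (bs ! j))]) * vol x (?O a # map ?O bs @ ws)) = 0"
      by simp
    also have "(\<Sum>j<k. \<Sigma> a. \<Sum>bs | length bs = k. \<alpha> x ((map ?O bs)[j := L (?O a) (?O (bs ! j))]) * vol x (?O a # map ?O bs @ ws))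
       = M (\<lambda>u. act (L u) (\<alpha> x))"
      unfolding M_def act_def by (subst sum.swap) (simp add: sum_distrib_right sum.swap[of _ "{..<k}"])
    finally show ?thesis .
  qed
  also have "(M N + 0) / fact k = (-1) ^ k * (\<Sigma> a. hodge g vol (\<lambda>_. N (?O a)) x (?O a # ws))"
  proof -
    have "vol x (?O a # map ?O bs @ ws) = (-1) ^ k * vol x (map ?O bs @ ?O a # ws)" if "length bs = k" for a bs
      using alternating_form_move[OF vol_alt, of "[]" "map ?O bs" "?O a" ws] that by (simp flip: mult.assoc power_add)
    moreover have "7 - Suc (length ws) = k" using len by simp
    ultimately show ?thesis unfolding M_def hodge_def Let_def
      by (simp add: sum_distrib_left sum_divide_distrib mult_ac)
  qed
  also have "(\<Sigma> a. hodge g vol (\<lambda>_. N (?O a)) x (?O a # ws)) = (\<Sigma> a. hodge g vol (\<lambda>_. N (E a)) x (E a # ws))"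
  proof (rule bilinear_trace_indep[where F = "\<lambda>u v. hodge g vol (\<lambda>_. N u) x (v # ws)", OF onb_orthonormal E_orthonormal])
    have c: "7 - Suc (length ws) = k" using len by simp
    have *: "linear (\<lambda>v. c * G v)" "linear (\<lambda>v. G v * c)" "linear (\<lambda>v. G v / c)" if "linear G" for G :: "vec7 \<Rightarrow> real" and c
      using linear_compose_scale_right[OF that, of c] linear_compose_scale_right[OF that, of "inverse c"] 
      by (simp_all add: divide_inverse mult.commute)
    show "linear (\<lambda>u. hodge g vol (\<lambda>_. N u) x (v # ws))" for v
      unfolding hodge_def Let_def using c by (auto intro!: linear_compose_sum * N(2))
    have "linear (\<lambda>v. vol x (map ?O bs @ v # ws))" if "length bs = k" for bs
      using multilinear_Cons(2)[OF multilinear_append[OF vol_multilinear, of "map ?O bs" "Suc (length ws)"]] that len by simp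
    then show "linear (\<lambda>v. hodge g vol (\<lambda>_. N u) x (v # ws))" for u
      unfolding hodge_def Let_def using c by (auto intro!: linear_compose_sum *)
  qed
  finally show ?thesis .
qed

end

section \<open>The Hodge dual of the three-form\<close>

lemma nths_singleton:
  assumes "i < length vs"
  shows "nths vs {i} = [vs ! i]" "nths vs (- {i}) = take i vs @ drop (Suc i) vs"
proof -
  have "nths vs {i} = [vs ! i] \<and> nths vs (- {i}) = take i vs @ drop (Suc i) vs"
    using assms
  proof (induction vs arbitrary: i)
    case (Cons v vs)
    show ?case
    proof (cases i)
      case 0
      have "{j. Suc j \<in> - {0}} = UNIV" by auto
      then show ?thesis using 0 by (simp add: nths_Cons nths_all)
    next
      case (Suc i')
      have "{j. Suc j \<in> {Suc i'}} = {i'}" "{j. Suc j \<in> - {Suc i'}} = - {i'}" by auto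
      then show ?thesis using Suc Cons.IH[of i'] Cons.prems by (simp add: nths_Cons)
    qed
  qed simp
  then show "nths vs {i} = [vs ! i]" "nths vs (- {i}) = take i vs @ drop (Suc i) vs" by blast+
qed

lemma wedge_1:
  assumes \<alpha>: "\<And>vs. length vs \<noteq> 1 \<Longrightarrow> \<alpha> x vs = 0"
  shows "(\<alpha> \<and>\<^sub>f \<beta>) x vs = (\<Sum>i<length vs. (-1) ^ i * \<alpha> x [vs ! i] * \<beta> x (take i vs @ drop (Suc i) vs))"
proof -
  let ?n = "length vs"
  define F where "F I = (-1) ^ card {(i, j). i \<in> I \<and> j \<notin> I \<and> j < i} * \<alpha> x (nths vs I) * \<beta> x (nths vs (- I))" for I
  have "F I = 0" if "I \<in> Pow {..<?n}" "I \<notin> (\<lambda>i. {i}) ` {..<?n}" for I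
  proof -
    have "card I \<noteq> 1" using that by (auto simp: card_1_singleton_iff)
    moreover have "length (nths vs I) = card I"
      using that(1) by (simp add: length_nths) (metis (no_types, lifting) Collect_cong Collect_mem_eq lessThan_iff subset_iff)
    ultimately show ?thesis using \<alpha> by (simp add: F_def)
  qed
  then have "(\<Sum>I\<in>Pow {..<?n}. F I) = (\<Sum>I\<in>(\<lambda>i. {i}) ` {..<?n}. F I)"
    by (intro sum.mono_neutral_right) auto
  also have "\<dots> = (\<Sum>i<?n. F {i})" by (subst sum.reindex) (auto simp: inj_on_def)
  also have "\<dots> = (\<Sum>i<?n. (-1) ^ i * \<alpha> x [vs ! i] * \<beta> x (take i vs @ drop (Suc i) vs))"
  proof (intro sum.cong refl)
    fix i assume i: "i \<in> {..<?n}"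
    have "{(a, b). a \<in> {i} \<and> b \<notin> {i} \<and> b < a} = (\<lambda>b. (i, b)) ` {..<i}" by auto
    then have "card {(a, b). a \<in> {i} \<and> b \<notin> {i} \<and> b < a} = i" by (simp add: card_image inj_on_def)
    moreover note nths_singleton[of i vs]
    ultimately show "F {i} = (-1) ^ i * \<alpha> x [vs ! i] * \<beta> x (take i vs @ drop (Suc i) vs)" using i by (simp add: F_def)
  qed
  finally show ?thesis by (simp add: wedge_def F_def)
qed

lemma sum_det3:
  assumes "\<And>i j k. f j i k = - f i j k" "\<And>i j k. f i k j = - f i j k"
  shows "(\<Sigma> i. \<Sigma> j. \<Sigma> k. det3 p q r i j k * f i j k) = 6 * f p q r"
proof -
  have "(\<Sigma> i. \<Sigma> j. \<Sigma> k. det3 p q r i j k * f i j k) = f p q r + f r p q + f q r p - f p r q - f q p r - f r q p"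
    unfolding det3_def left_diff_distrib distrib_right sum.distrib sum_subtractf mult.assoc
    by (simp only: sum_distrib_left[symmetric] sum_dl)
  also have "\<dots> = 6 * f p q r"
  proof -
    have "f r p q = f p q r" "f q r p = f p q r" "f r q p = - f p q r" "f p r q = - f p q r" "f q p r = - f p q r"
      by (rule skew3_rules[of f, OF assms] assms)+
    then show ?thesis by simp
  qed
  finally show ?thesis .
qed

text \<open>The order \<open>1 < 2 < \<dots> < 7\<close> of frame indices. The order of the type itself is unsuitable,
  since \<open>7 = 0\<close> there.\<close>
definition index_key :: "7 \<Rightarrow> nat" where
  "index_key i = (if i = 1 then 1 else if i = 2 then 2 else if i = 3 then 3 else if i = 4 then 4
      else if i = 5 then 5 else if i = 6 then 6 else 7)"

lemma index_key_simps: "index_key 1 = 1" "index_key 2 = 2" "index_key 3 = 3" "index_key 4 = 4"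
   "index_key 5 = 5" "index_key 6 = 6" "index_key 7 = 7"
  by (simp_all add: index_key_def)

lemma index_key_inj: "index_key i = index_key j \<longleftrightarrow> i = j"
proof -
  have "\<forall>i j. index_key i = index_key j \<longrightarrow> i = j"
    unfolding forall_7 by (simp add: index_key_simps del: One_nat_def)
  then show ?thesis by blast
qed

lemma index_key_less:
  "index_key 1 < index_key b \<longleftrightarrow> b = 2 \<or> b = 3 \<or> b = 4 \<or> b = 5 \<or> b = 6 \<or> b = 7"
  "index_key 2 < index_key b \<longleftrightarrow> b = 3 \<or> b = 4 \<or> b = 5 \<or> b = 6 \<or> b = 7"
  "index_key 3 < index_key b \<longleftrightarrow> b = 4 \<or> b = 5 \<or> b = 6 \<or> b = 7"
  "index_key 4 < index_key b \<longleftrightarrow> b = 5 \<or> b = 6 \<or> b = 7"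
  "index_key 5 < index_key b \<longleftrightarrow> b = 6 \<or> b = 7"
  "index_key 6 < index_key b \<longleftrightarrow> b = 7"
  "\<not> index_key 7 < index_key b"
proof -
  have *: "b = 1 \<or> b = 2 \<or> b = 3 \<or> b = 4 \<or> b = 5 \<or> b = 6 \<or> b = 7"
    using UNIV_7 by blast
  show "index_key 1 < index_key b \<longleftrightarrow> b = 2 \<or> b = 3 \<or> b = 4 \<or> b = 5 \<or> b = 6 \<or> b = 7"
  "index_key 2 < index_key b \<longleftrightarrow> b = 3 \<or> b = 4 \<or> b = 5 \<or> b = 6 \<or> b = 7"
  "index_key 3 < index_key b \<longleftrightarrow> b = 4 \<or> b = 5 \<or> b = 6 \<or> b = 7"
  "index_key 4 < index_key b \<longleftrightarrow> b = 5 \<or> b = 6 \<or> b = 7"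
  "index_key 5 < index_key b \<longleftrightarrow> b = 6 \<or> b = 7"
  "index_key 6 < index_key b \<longleftrightarrow> b = 7"
  "\<not> index_key 7 < index_key b"
    using * by (elim disjE; simp add: index_key_simps del: One_nat_def)+
qed

text \<open>The 35 increasing quadruples of frame indices.\<close>
lemma ordered_quadruple_induct:
  assumes "index_key a < index_key b" "index_key b < index_key c" "index_key c < index_key d"
    and "P 1 2 3 4" "P 1 2 3 5" "P 1 2 3 6" "P 1 2 3 7" "P 1 2 4 5" "P 1 2 4 6" "P 1 2 4 7" "P 1 2 5 6" "P 1 2 5 7" "P 1 2 6 7"
      "P 1 3 4 5" "P 1 3 4 6" "P 1 3 4 7" "P 1 3 5 6" "P 1 3 5 7" "P 1 3 6 7" "P 1 4 5 6" "P 1 4 5 7" "P 1 4 6 7" "P 1 5 6 7"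
      "P 2 3 4 5" "P 2 3 4 6" "P 2 3 4 7" "P 2 3 5 6" "P 2 3 5 7" "P 2 3 6 7" "P 2 4 5 6" "P 2 4 5 7" "P 2 4 6 7" "P 2 5 6 7"
      "P 3 4 5 6" "P 3 4 5 7" "P 3 4 6 7" "P 3 5 6 7" "P 4 5 6 7"
  shows "P a b c d"
proof -
  have "a = 1 \<or> a = 2 \<or> a = 3 \<or> a = 4 \<or> a = 5 \<or> a = 6 \<or> a = 7"
    using UNIV_7 by blast
  then show ?thesis using assms(1-3) by (auto simp: index_key_less assms(4-))
qed

context frame_at
begin

text \<open>The signs of the permutations that complete the seven monomials of \<open>\<omega>\<close>.\<close>
lemma vol_frame_signs:
  "vol x (map E [1,2,7,3,4,5,6]) = 1" "vol x (map E [1,3,5,2,4,6,7]) = - 1" "vol x (map E [1,4,6,2,3,5,7]) = - 1"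
  "vol x (map E [2,3,6,1,4,5,7]) = - 1" "vol x (map E [2,4,5,1,3,6,7]) = - 1" "vol x (map E [3,4,7,1,2,5,6]) = 1"
  "vol x (map E [5,6,7,1,2,3,4]) = 1"
proof -
  have mv: "vol x (map E (us @ vs @ w # ws)) = (-1) ^ length vs * vol x (map E (us @ w # vs @ ws))" for us vs w ws
    using alternating_form_move[OF vol_alt, of "map E us" "map E vs" "E w" "map E ws"] by simp
  note v = vol_frame
  show "vol x (map E [1,2,7,3,4,5,6]) = 1"
    using mv[of "[1,2]" "[3,4,5,6]" 7 "[]"] v by simp
  show "vol x (map E [1,3,5,2,4,6,7]) = - 1"
    using mv[of "[1]" "[3,5]" 2 "[4,6,7]"] mv[of "[1,2,3]" "[5]" 4 "[6,7]"] v by simp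
  show "vol x (map E [1,4,6,2,3,5,7]) = - 1"
    using mv[of "[1]" "[4,6]" 2 "[3,5,7]"] mv[of "[1,2]" "[4,6]" 3 "[5,7]"] mv[of "[1,2,3,4]" "[6]" 5 "[7]"] v by simp
  show "vol x (map E [2,3,6,1,4,5,7]) = - 1"
    using mv[of "[]" "[2,3,6]" 1 "[4,5,7]"] mv[of "[1,2,3]" "[6]" 4 "[5,7]"] mv[of "[1,2,3,4]" "[6]" 5 "[7]"] v by simp
  show "vol x (map E [2,4,5,1,3,6,7]) = - 1"
    using mv[of "[]" "[2,4,5]" 1 "[3,6,7]"] mv[of "[1,2]" "[4,5]" 3 "[6,7]"] v by simp
  show "vol x (map E [3,4,7,1,2,5,6]) = 1"
    using mv[of "[]" "[3,4,7]" 1 "[2,5,6]"] mv[of "[1]" "[3,4,7]" 2 "[5,6]"] mv[of "[1,2,3,4]" "[7]" 5 "[6]"] mv[of "[1,2,3,4,5]" "[7]" 6 "[]"] v by simp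
  show "vol x (map E [5,6,7,1,2,3,4]) = 1"
    using mv[of "[]" "[5,6,7]" 1 "[2,3,4]"] mv[of "[1]" "[5,6,7]" 2 "[3,4]"] mv[of "[1,2]" "[5,6,7]" 3 "[4]"] mv[of "[1,2,3]" "[5,6,7]" 4 "[]"] v by simp
qed

text \<open>Both sides are alternating, so it suffices to compare them on increasing quadruples, where the values of the
  volume form are known signs.\<close>
lemma hodge_phi:
  assumes \<omega>: "alternating_form 3 (\<omega> x)" "\<And>a b c. \<omega> x [E a, E b, E c] = phi a b c"
  shows "hodge g vol \<omega> x [E a, E b, E c, E d] = psi a b c d"
proof -
  define V where "V is = vol x (map E is)" for "is"
  have V0: "V is = 0" if "\<not> distinct is" for "is"
    unfolding V_def using alternating_form_repeat[OF vol_alt] that by (meson distinct_map)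
  have Vs: "V (us @ i # j # vs) = - V (us @ j # i # vs)" for us i j vs
    unfolding V_def using alternating_form_swap[OF vol_alt, of "map E us" "E i" "E j" "map E vs"] by simp
  have L: "hodge g vol \<omega> x [E a, E b, E c, E d] = V [1,2,7,a,b,c,d] + V [1,3,5,a,b,c,d] - V [1,4,6,a,b,c,d]
      - V [2,3,6,a,b,c,d] - V [2,4,5,a,b,c,d] + V [3,4,7,a,b,c,d] + V [5,6,7,a,b,c,d]" for a b c d
  proof -
    define f where "f i j k = V [i,j,k,a,b,c,d]" for i j k
    have f: "f j i k = - f i j k" "f i k j = - f i j k" for i j k
      unfolding f_def using Vs[of "[]" j i "[k,a,b,c,d]"] Vs[of "[i]" k j "[a,b,c,d]"] by simp_all
    have "hodge g vol \<omega> x [E a, E b, E c, E d] = (\<Sigma> i. \<Sigma> j. \<Sigma> k. phi i j k * f i j k) / 6"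
      using hodge_frame[of 3 \<omega> "[E a, E b, E c, E d]"] alternating_form_multilinear[OF \<omega>(1)] \<omega>(2)
      by (simp add: numeral_3_eq_3 sum_lists_Suc f_def V_def fact_Suc)
    also have "(\<Sigma> i. \<Sigma> j. \<Sigma> k. phi i j k * f i j k) = 6 * f 1 2 7 + 6 * f 1 3 5 - 6 * f 1 4 6 - 6 * f 2 3 6 - 6 * f 2 4 5 + 6 * f 3 4 7 + 6 * f 5 6 7"
      unfolding phi_def left_diff_distrib distrib_right sum.distrib sum_subtractf sum_det3[of f, OF f] by simp
    finally show ?thesis by (simp add: f_def)
  qed
  define Q where "Q xs \<longleftrightarrow> (\<forall>a b c d. xs = [a,b,c,d] \<longrightarrow> hodge g vol \<omega> x [E a, E b, E c, E d] = psi a b c d)" for xs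
  have swap: "hodge g vol \<omega> x [E b, E a, E c, E d] = - hodge g vol \<omega> x [E a, E b, E c, E d]"
     "hodge g vol \<omega> x [E a, E c, E b, E d] = - hodge g vol \<omega> x [E a, E b, E c, E d]"
     "hodge g vol \<omega> x [E a, E b, E d, E c] = - hodge g vol \<omega> x [E a, E b, E c, E d]" for a b c d
  proof -
    have h: "alternating_form 4 (hodge g vol \<omega> x)"
      using hodge_alternating[of 3 \<omega>] alternating_form_zero[OF \<omega>(1)] by simp
    show "hodge g vol \<omega> x [E b, E a, E c, E d] = - hodge g vol \<omega> x [E a, E b, E c, E d]"
     "hodge g vol \<omega> x [E a, E c, E b, E d] = - hodge g vol \<omega> x [E a, E b, E c, E d]"
     "hodge g vol \<omega> x [E a, E b, E d, E c] = - hodge g vol \<omega> x [E a, E b, E c, E d]"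
      using alternating_form_swap[OF h, of "[]" "E b" "E a" "[E c, E d]"] alternating_form_swap[OF h, of "[E a]" "E c" "E b" "[E d]"]
        alternating_form_swap[OF h, of "[E a, E b]" "E d" "E c" "[]"] by simp_all
  qed
  have Qswap: "Q (us @ i # j # vs) = Q (us @ j # i # vs)" for us i j vs
  proof -
    consider "length us + length vs \<noteq> 2" | c d where "us = []" "vs = [c, d]" | c d where "us = [c]" "vs = [d]"
      | c d where "us = [c, d]" "vs = []"
      by (cases us; cases vs; cases "tl us"; cases "tl vs"; cases "tl (tl us)"; cases "tl (tl vs)") auto
    then show ?thesis
    proof cases
      case 1
      then have "Q (us @ i # j # vs)" "Q (us @ j # i # vs)" for i j
        unfolding Q_def by (auto dest: arg_cong[of _ _ length])
      then show ?thesis by blast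
    next
      case 2
      then show ?thesis using swap(1)[of i j c d] psi_skew12[of j i c d] by (auto simp: Q_def)
    next
      case 3
      then show ?thesis using swap(2)[of c i j d] psi_skew23[of c j i d] by (auto simp: Q_def)
    next
      case 4
      then show ?thesis using swap(3)[of c d i j] psi_skew34[of c d j i] by (auto simp: Q_def)
    qed
  qed
  have ordered: "V [1,2,7,a,b,c,d] + V [1,3,5,a,b,c,d] - V [1,4,6,a,b,c,d]
      - V [2,3,6,a,b,c,d] - V [2,4,5,a,b,c,d] + V [3,4,7,a,b,c,d] + V [5,6,7,a,b,c,d] = psi a b c d"
    if "index_key a < index_key b" "index_key b < index_key c" "index_key c < index_key d" for a b c d
    by (rule ordered_quadruple_induct[OF that]; simp add: V0 vol_frame_signs[folded V_def] psi_def phi_rows dl_eval sum_negf)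
  show ?thesis
  proof (cases "distinct [a,b,c,d]")
    case False
    then have "hodge g vol \<omega> x [E a, E b, E c, E d] = 0" unfolding L by (simp add: V0)
    moreover have "psi a b c d = 0" using False by auto
    ultimately show ?thesis by simp
  next
    case True
    define ys where "ys = sort_key index_key [a,b,c,d]"
    have "length ys = 4" by (simp add: ys_def)
    then obtain a' b' c' d' where s: "sort_key index_key [a,b,c,d] = [a',b',c',d']"
      unfolding ys_def[symmetric] by (auto simp: length_Suc_conv numeral_eq_Suc)
    have m: "mset [a',b',c',d'] = mset [a,b,c,d]" by (metis s mset_sort)
    have "sorted (map index_key [a',b',c',d'])" "distinct [a',b',c',d']"
      using sorted_sort_key[of index_key "[a,b,c,d]"] True unfolding s by (simp, metis s distinct_sort)
    then have "index_key a' < index_key b' \<and> index_key b' < index_key c' \<and> index_key c' < index_key d'"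
      by (auto simp: order_less_le index_key_inj)
    then have "Q [a',b',c',d']" using ordered unfolding Q_def L by blast
    then have "Q [a,b,c,d]" using mset_eq_by_swaps[where P = Q, OF Qswap m] by simp
    then show ?thesis by (simp add: Q_def)
  qed
qed

end

section \<open>Adapted coframes\<close>

lemma smooth_on_const: "open S \<Longrightarrow> smooth_on S (\<lambda>x. c)"
  and smooth_on_add: "open S \<Longrightarrow> smooth_on S f \<Longrightarrow> smooth_on S g \<Longrightarrow> smooth_on S (\<lambda>x. f x + g x)"
  and smooth_on_diff: "open S \<Longrightarrow> smooth_on S f \<Longrightarrow> smooth_on S g \<Longrightarrow> smooth_on S (\<lambda>x. f x - g x)"
  and smooth_on_minus: "open S \<Longrightarrow> smooth_on S f \<Longrightarrow> smooth_on S (\<lambda>x. - f x)"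
  and smooth_on_sum: "open S \<Longrightarrow> (\<And>i. i \<in> I \<Longrightarrow> smooth_on S (F i)) \<Longrightarrow> smooth_on S (\<lambda>x. \<Sum>i\<in>I. F i x)"
  and smooth_on_mult: "open S \<Longrightarrow> smooth_on S h \<Longrightarrow> smooth_on S k \<Longrightarrow> smooth_on S (\<lambda>x. h x * k x :: real)"
  and smooth_on_scaleR: "open S \<Longrightarrow> smooth_on S h \<Longrightarrow> smooth_on S f \<Longrightarrow> smooth_on S (\<lambda>x. h x *\<^sub>R f x)"
  and smooth_on_linear: "open S \<Longrightarrow> bounded_linear l \<Longrightarrow> smooth_on S f \<Longrightarrow> smooth_on S (\<lambda>x. l (f x))"
  and smooth_on_divide: "open S \<Longrightarrow> smooth_on S h \<Longrightarrow> smooth_on S k \<Longrightarrow> (\<And>x. x \<in> S \<Longrightarrow> k x \<noteq> 0) \<Longrightarrow> smooth_on S (\<lambda>x. h x / k x)"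
  unfolding smooth_on_def divide_inverse
  by (auto intro!: times_diff_on_const times_diff_on_add times_diff_on_diff times_diff_on_minus times_diff_on_sum
      times_diff_on_mult times_diff_on_scaleR times_diff_on_inverse intro: times_diff_on_linear)

lemma smooth_on_det:
  fixes M :: "'a::euclidean_space \<Rightarrow> real^'n^'n"
  assumes "open S" "\<And>i j. smooth_on S (\<lambda>x. M x $ i $ j)"
  shows "smooth_on S (\<lambda>x. det (M x))"
  using assms unfolding smooth_on_def by (auto intro: times_diff_on_det)

lemma smooth_on_cong: "open S \<Longrightarrow> (\<And>x. x \<in> S \<Longrightarrow> f x = g x) \<Longrightarrow> smooth_on S f \<longleftrightarrow> smooth_on S g"
  unfolding smooth_on_def using times_diff_on_cong by metis

lemma smooth_on_nth: "open S \<Longrightarrow> smooth_on S (X :: vec7 \<Rightarrow> vec7) \<Longrightarrow> smooth_on S (\<lambda>y. X y $ k)"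
  by (rule smooth_on_linear[OF _ bounded_linear_vec_nth])

lemma vec7_expand: "(v::vec7) = (\<Sum>k\<in>UNIV. v $ k *\<^sub>R axis k 1)"
  using basis_expansion[of v] by (simp add: scalar_mult_eq_scaleR)

lemma vec7_sum_axis: "(\<Sum>k\<in>UNIV. f k *\<^sub>R axis k 1) = (\<chi> k. f k)" for f :: "7 \<Rightarrow> real"
  using vec7_expand[of "\<chi> k. f k"] by simp

lemma linear_axis_expand:
  fixes l :: "vec7 \<Rightarrow> 'b::real_vector"
  assumes "linear l" shows "l v = (\<Sum>k\<in>UNIV. v $ k *\<^sub>R l (axis k 1))"
  by (subst vec7_expand[of v]) (simp add: linear_sum[OF assms] linear_cmul[OF assms])

lemma linear_scaleR_const: "linear l \<Longrightarrow> linear (\<lambda>u. l u *\<^sub>R c)"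
  for l :: "'a::real_vector \<Rightarrow> real" and c :: "'b::real_vector"
  by (intro linearI) (simp_all add: linear_add linear_cmul scaleR_add_left)

text \<open>Smoothness of a tensor field is given on constant vectors only; expansion in the standard basis extends it
  to smooth vector fields.\<close>
lemma smooth_on_linear_field:
  fixes l :: "vec7 \<Rightarrow> vec7 \<Rightarrow> 'b::real_normed_vector"
  assumes S: "open S" and "\<And>y. y \<in> S \<Longrightarrow> linear (l y)" "\<And>v. smooth_on S (\<lambda>y. l y v)" "smooth_on S X"
  shows "smooth_on S (\<lambda>y. l y (X y))"
proof -
  have "smooth_on S (\<lambda>y. \<Sum>k\<in>UNIV. X y $ k *\<^sub>R l y (axis k 1))"
    by (intro smooth_on_sum smooth_on_scaleR smooth_on_nth S assms(3,4))
  moreover have "l y (X y) = (\<Sum>k\<in>UNIV. X y $ k *\<^sub>R l y (axis k 1))" if "y \<in> S" for y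
    by (rule linear_axis_expand[OF assms(2)[OF that]])
  ultimately show ?thesis using smooth_on_cong[OF S, of "\<lambda>y. l y (X y)"] by simp
qed

lemma smooth_on_bilinear_field:
  fixes B :: "vec7 \<Rightarrow> vec7 \<Rightarrow> vec7 \<Rightarrow> 'b::real_normed_vector"
  assumes S: "open S" and B: "\<And>y. y \<in> S \<Longrightarrow> bilinear (B y)" "\<And>u v. smooth_on S (\<lambda>y. B y u v)" 
    and X: "smooth_on S X" "smooth_on S Y"
  shows "smooth_on S (\<lambda>y. B y (X y) (Y y))"
proof -
  have "smooth_on S (\<lambda>y. B y u (Y y))" for u
    by (rule smooth_on_linear_field[OF S _ B(2) X(2)]) (use B(1) in \<open>simp add: bilinear_def\<close>)
  then show ?thesis
    by (intro smooth_on_linear_field[where l = "\<lambda>y u. B y u (Y y)", OF S _ _ X(1)])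
      (use B(1) in \<open>auto simp: bilinear_def\<close>)
qed

lemma multilinear_expand:
  assumes "multilinear k F" and E: "\<And>v. v = (\<Sum>i\<in>(UNIV::7 set). e i v *\<^sub>R E i)" and "length vs = k"
  shows "F vs = (\<Sum>is | length is = k. (\<Prod>j<k. e (is ! j) (vs ! j)) * F (map E is))"
  using assms(1,3)
proof (induction k arbitrary: F vs)
  case (Suc k)
  obtain v ws where vs: "vs = v # ws" "length ws = k" using Suc.prems(2) by (cases vs) auto
  note lin = multilinear_Cons(2)[OF Suc.prems(1) vs(2)]
  have "F vs = (\<Sigma> i. e i v * F (E i # ws))"
    unfolding vs(1) using arg_cong[OF E[of v], of "\<lambda>v. F (v # ws)"]
    by (simp only: linear_sum[OF lin] linear_cmul[OF lin] real_scaleR_def)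
  also have "\<dots> = (\<Sigma> i. e i v * (\<Sum>is | length is = k. (\<Prod>j<k. e (is ! j) (ws ! j)) * F (E i # map E is)))"
    using Suc.IH[OF multilinear_Cons(1)[OF Suc.prems(1)] vs(2)] by simp
  finally show ?case
    by (simp add: sum_lists_Suc vs(1) prod.lessThan_Suc_shift sum_distrib_left mult_ac del: prod.lessThan_Suc)
qed simp

context frame_at
begin

text \<open>The star is self-adjoint in every degree, because the sign \<open>(-1)\<^bsup>k (7 - k)\<^esup>\<close> is always \<open>+ 1\<close>.\<close>
lemma form_inner_hodge:
  assumes "k \<le> 7"
  shows "form_inner (7 - k) g \<beta> (hodge g vol \<alpha>) x = form_inner k g \<alpha> (hodge g vol \<beta>) x"
proof -
  let ?O = "onb g x"
  have v: "vol x (map ?O js @ map ?O is) = vol x (map ?O is @ map ?O js)" if "length is = k" "length js = 7 - k" for "is" js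
  proof -
    have "even ((7 - k) * k)" using assms by (cases "even k") auto
    then show ?thesis using alternating_form_move_block[OF vol_alt, of "[]" "map ?O js" "map ?O is" "[]"] that by simp
  qed
  have "form_inner (7 - k) g \<beta> (hodge g vol \<alpha>) x = (\<Sum>js | length js = 7 - k. \<Sum>is | length is = k. 
      \<beta> x (map ?O js) * (\<alpha> x (map ?O is) * vol x (map ?O is @ map ?O js))) / (fact k * fact (7 - k))"
    using assms by (simp add: form_inner_def hodge_def Let_def sum_distrib_left sum_divide_distrib)
  also have "\<dots> = (\<Sum>is | length is = k. \<Sum>js | length js = 7 - k. 
      \<alpha> x (map ?O is) * (\<beta> x (map ?O js) * vol x (map ?O js @ map ?O is))) / (fact k * fact (7 - k))"
    by (subst sum.swap) (simp add: v mult.left_commute)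
  also have "\<dots> = form_inner k g \<alpha> (hodge g vol \<beta>) x"
    using assms by (simp add: form_inner_def hodge_def Let_def sum_distrib_left sum_divide_distrib mult.commute[of "fact (7 - k)"])
  finally show ?thesis .
qed

end

text \<open>The domain of an adapted coframe in a chart. All local geometry below refers to it.\<close>
locale adapted_chart =
  fixes S :: "vec7 set" and \<omega> :: field and g :: metric and vol :: field and e :: "7 \<Rightarrow> field"
  assumes S: "open S" and adapted: "adapted_coframe_on S \<omega> g vol e"
    and \<omega>_alt: "\<And>y. y \<in> S \<Longrightarrow> alternating_form 3 (\<omega> y)"
    and vol_alternating: "\<And>y. y \<in> S \<Longrightarrow> alternating_form 7 (vol y)"
begin

lemma e_form: "smooth_form_on 1 S (e i)"
  and e_inj: "y \<in> S \<Longrightarrow> (\<And>i. e i y [v] = 0) \<Longrightarrow> v = 0"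
  and \<omega>_e: "y \<in> S \<Longrightarrow> \<omega> y vs = e3 e 1 2 7 y vs + e3 e 1 3 5 y vs - e3 e 1 4 6 y vs - e3 e 2 3 6 y vs
                      - e3 e 2 4 5 y vs + e3 e 3 4 7 y vs + e3 e 5 6 7 y vs"
  and g_e: "y \<in> S \<Longrightarrow> g y u v = (\<Sigma> i. e i y [u] * e i y [v])"
  and vol_e: "y \<in> S \<Longrightarrow> vol y vs = (e 1 \<and>\<^sub>f e 2 \<and>\<^sub>f e 3 \<and>\<^sub>f e 4 \<and>\<^sub>f e 5 \<and>\<^sub>f e 6 \<and>\<^sub>f e 7) y vs"
  using adapted unfolding adapted_coframe_on_def coframe_on_def by blast+

lemma e_linear: assumes "y \<in> S" shows "linear (\<lambda>v. e i y [v])"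
proof -
  have "alternating_form 1 (e i y)" using e_form assms by (simp add: smooth_form_on_def)
  then have "linear (\<lambda>v. e i y ([0][0 := v]))" unfolding alternating_form_def by (metis length_Cons list.size(3) One_nat_def zero_less_one)
  then show ?thesis by simp
qed

lemma e_off: "y \<in> S \<Longrightarrow> length vs \<noteq> 1 \<Longrightarrow> e i y vs = 0"
  using e_form alternating_form_zero unfolding smooth_form_on_def by blast

lemma smooth_e: "smooth_on S (\<lambda>y. e i y [v])"
  using e_form by (simp add: smooth_form_on_def)

definition coframe_matrix :: "vec7 \<Rightarrow> real^7^7" where
  "coframe_matrix y = (\<chi> a j. e a y [axis j 1])"

text \<open>Cramer's rule for the dual frame.\<close>
definition E :: "vec7 \<Rightarrow> 7 \<Rightarrow> vec7" where
  "E y i = (\<Sum>k\<in>UNIV. (det (\<chi> a j. if j = k then axis i 1 $ a else coframe_matrix y $ a $ j) / det (coframe_matrix y)) *\<^sub>R axis k 1)"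

lemma coframe_matrix_mult: assumes "y \<in> S" shows "coframe_matrix y *v v = (\<chi> a. e a y [v])"
proof (rule vec_eq_iff[THEN iffD2], rule allI)
  fix a
  have "(coframe_matrix y *v v) $ a = (\<Sigma> k. v $ k * e a y [axis k 1])"
    by (simp add: matrix_vector_mult_def coframe_matrix_def) (simp add: mult.commute)
  also have "\<dots> = e a y [v]"
    using linear_axis_expand[OF e_linear[OF assms], of a v] by (simp only: real_scaleR_def)
  finally show "(coframe_matrix y *v v) $ a = (\<chi> a. e a y [v]) $ a" by simp
qed

lemma det_coframe: assumes "y \<in> S" shows "det (coframe_matrix y) \<noteq> 0"
proof -
  have "\<forall>v. coframe_matrix y *v v = 0 \<longrightarrow> v = 0"
  proof (intro allI impI)
    fix v assume "coframe_matrix y *v v = 0"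
    then have "(\<chi> a. e a y [v]) = 0" unfolding coframe_matrix_mult[OF assms] .
    then have "e i y [v] = 0" for i by (metis vec_lambda_beta zero_index)
    then show "v = 0" by (rule e_inj[OF assms])
  qed
  then have "\<exists>B. B ** coframe_matrix y = mat 1"
    unfolding matrix_left_invertible_ker .
  then show ?thesis
    using invertible_left_inverse invertible_det_nz by blast
qed

lemma e_E: assumes "y \<in> S" shows "e a y [E y i] = dl a i"
proof -
  have "E y i = (\<chi> k. det (\<chi> a j. if j = k then axis i 1 $ a else coframe_matrix y $ a $ j) / det (coframe_matrix y))"
    unfolding E_def by (rule vec7_sum_axis)
  then have "coframe_matrix y *v E y i = axis i 1" 
    using cramer[OF det_coframe[OF assms], of "E y i" "axis i 1"] by simp
  then show ?thesis
    by (simp add: coframe_matrix_mult[OF assms] vec_eq_iff axis_def dl_def)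
qed

lemma E_expand: assumes "y \<in> S" shows "v = (\<Sum>i\<in>UNIV. e i y [v] *\<^sub>R E y i)"
proof -
  have "e a y [v - (\<Sum>i\<in>UNIV. e i y [v] *\<^sub>R E y i)] = 0" for a
    by (simp add: linear_diff[OF e_linear[OF assms]] linear_sum[OF e_linear[OF assms]] linear_cmul[OF e_linear[OF assms]] e_E[OF assms])
  then have "v - (\<Sum>i\<in>UNIV. e i y [v] *\<^sub>R E y i) = 0" by (rule e_inj[OF assms])
  then show ?thesis by (simp only: right_minus_eq)
qed

lemma smooth_E: "smooth_on S (\<lambda>y. E y i)"
proof -
  have c: "smooth_on S (\<lambda>y. coframe_matrix y $ a $ j)" for a j by (simp add: coframe_matrix_def smooth_e)
  have c': "smooth_on S (\<lambda>y. (\<chi> a j. if j = k then axis i 1 $ a else coframe_matrix y $ a $ j) $ a $ j)" for a j k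
    by (cases "j = k") (simp_all add: smooth_on_const[OF S] c)
  show ?thesis unfolding E_def
    by (intro smooth_on_sum smooth_on_scaleR smooth_on_divide smooth_on_const smooth_on_det S det_coframe c c')
qed

lemma g_bilinear: "y \<in> S \<Longrightarrow> bilinear (g y)"
  unfolding bilinear_def
proof (intro conjI allI)
  assume y: "y \<in> S"
  have *: "linear (\<lambda>v. c * G v)" "linear (\<lambda>v. G v * c)" if "linear G" for G :: "vec7 \<Rightarrow> real" and c
    using linear_compose_scale_right[OF that, of c] by (simp_all add: mult.commute)
  show "linear (g y u)" "linear (\<lambda>u. g y u v)" for u v
  proof -
    have "g y u = (\<lambda>v. \<Sigma> i. e i y [u] * e i y [v])" "(\<lambda>u. g y u v) = (\<lambda>u. \<Sigma> i. e i y [u] * e i y [v])"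
      by (simp_all add: g_e[OF y] fun_eq_iff)
    then show "linear (g y u)" "linear (\<lambda>u. g y u v)"
      by (simp_all add: linear_compose_sum * e_linear[OF y])
  qed
qed

lemma g_E: "y \<in> S \<Longrightarrow> g y v (E y i) = e i y [v]"
  by (simp add: g_e e_E)

lemma e_wedge: "y \<in> S \<Longrightarrow> (e a \<and>\<^sub>f \<beta>) y vs = (\<Sum>i<length vs. (-1) ^ i * e a y [vs ! i] * \<beta> y (take i vs @ drop (Suc i) vs))"
  by (rule wedge_1) (rule e_off)

lemma e_wedge_first:
  assumes "y \<in> S" "a \<notin> set is"
  shows "(e a \<and>\<^sub>f \<beta>) y (map (E y) (a # is)) = \<beta> y (map (E y) is)"
proof -
  have "e a y [E y (is ! i)] = 0" if "i < length is" for i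
    using assms that by (auto simp: e_E dl_def)
  then show ?thesis
    using assms(1) by (simp add: e_wedge sum.lessThan_Suc_shift e_E del: sum.lessThan_Suc)
qed

lemma frame: assumes "y \<in> S" shows "frame_at g y vol (E y)"
proof
  show "bilinear (g y)" using g_bilinear assms by simp
  show "g y u v = g y v u" for u v using assms by (simp add: g_e mult.commute)
  show "g y v v > 0" if "v \<noteq> 0" for v
  proof -
    obtain i where "e i y [v] \<noteq> 0" using e_inj[OF assms] \<open>v \<noteq> 0\<close> by blast
    then have "0 < (\<Sigma> i. e i y [v] * e i y [v])"
      by (intro sum_pos2[of _ i]) (auto simp: not_real_square_gt_zero[symmetric] simp del: not_real_square_gt_zero)
    then show ?thesis by (simp add: g_e assms)
  qed
  show "g y (E y i) (E y j) = dl i j" for i j using assms by (simp add: g_E e_E dl_sym)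
  show "alternating_form 7 (vol y)" using vol_alternating assms .
  have "vol y (map (E y) [1,2,3,4,5,6,7]) = e 7 y (map (E y) [7])"
    unfolding vol_e[OF assms] by (subst e_wedge_first[OF assms], simp)+ (rule refl)
  then show "vol y (map (E y) [1,2,3,4,5,6,7]) = 1" by (simp add: e_E assms)
qed

lemma \<omega>_frame: assumes "y \<in> S" shows "\<omega> y [E y i, E y j, E y k] = phi i j k"
proof -
  have "e3 e a b c y [E y i, E y j, E y k] = det3 a b c i j k" for a b c
    unfolding e3_def by (simp add: e_wedge[OF assms] numeral_eq_Suc e_E[OF assms] det3_def algebra_simps)
  then show ?thesis by (simp add: \<omega>_e[OF assms] phi_def)
qed

lemma smooth_e_field: "smooth_on S X \<Longrightarrow> smooth_on S (\<lambda>y. e i y [X y])"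
  by (rule smooth_on_linear_field[OF S e_linear smooth_e])

lemma smooth_g_field: "smooth_on S X \<Longrightarrow> smooth_on S Y \<Longrightarrow> smooth_on S (\<lambda>y. g y (X y) (Y y))"
  using smooth_on_cong[OF S, of "\<lambda>y. g y (X y) (Y y)" "\<lambda>y. \<Sigma> i. e i y [X y] * e i y [Y y]"] g_e
  by (simp add: smooth_on_sum smooth_on_mult smooth_e_field S)

definition de :: "7 \<Rightarrow> vec7 \<Rightarrow> vec7 \<Rightarrow> vec7 \<Rightarrow> real" where
  "de i y u v = frechet_derivative (\<lambda>z. e i z [v]) (at y) u"

lemma de: "y \<in> S \<Longrightarrow> ((\<lambda>z. e i z [v]) has_derivative (\<lambda>u. de i y u v)) (at y)"
  unfolding de_def using smooth_on_D[OF smooth_e] by simp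

lemma bilinear_de: assumes "y \<in> S" shows "bilinear (de i y)"
  unfolding bilinear_def
proof (intro conjI allI)
  show "linear (\<lambda>u. de i y u v)" for v using de[OF assms] has_derivative_linear by blast
  show "linear (de i y u)" for u
  proof (rule linearI)
    fix v w :: vec7 and c :: real
    have "((\<lambda>z. e i z [v] + e i z [w]) has_derivative (\<lambda>u. de i y u v + de i y u w)) (at y)"
      by (intro has_derivative_add de assms)
    then have "((\<lambda>z. e i z [v + w]) has_derivative (\<lambda>u. de i y u v + de i y u w)) (at y)"
      using has_derivative_cong_open[OF S assms, of "\<lambda>z. e i z [v + w]" "\<lambda>z. e i z [v] + e i z [w]"] linear_add[OF e_linear] by simp
    from fun_cong[OF has_derivative_unique[OF de[OF assms, of i "v + w"] this], of u]
    show "de i y u (v + w) = de i y u v + de i y u w" .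
    have "((\<lambda>z. c * e i z [v]) has_derivative (\<lambda>u. c * de i y u v)) (at y)"
      by (intro has_derivative_mult_right de assms)
    then have "((\<lambda>z. e i z [c *\<^sub>R v]) has_derivative (\<lambda>u. c * de i y u v)) (at y)"
      using has_derivative_cong_open[OF S assms, of "\<lambda>z. e i z [c *\<^sub>R v]" "\<lambda>z. c * e i z [v]"] linear_cmul[OF e_linear] by simp
    from fun_cong[OF has_derivative_unique[OF de[OF assms, of i "c *\<^sub>R v"] this], of u]
    show "de i y u (c *\<^sub>R v) = c *\<^sub>R de i y u v" by simp
  qed
qed

text \<open>The connection for which the frame \<open>E\<close> is parallel, since \<open>e i (W u v)\<close> is the derivative of \<open>e i v\<close>
  for constant \<open>v\<close>. It is flat and metric and preserves \<open>\<omega>\<close>, \<open>*\<omega>\<close> and the volume form, but has torsion.\<close>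
definition W :: christoffel where "W y u v = (\<Sum>i\<in>UNIV. de i y u v *\<^sub>R E y i)"

lemma e_W: "y \<in> S \<Longrightarrow> e i y [W y u v] = de i y u v"
  by (simp add: W_def linear_sum[OF e_linear] linear_cmul[OF e_linear] e_E)

lemma bilinear_W: "y \<in> S \<Longrightarrow> bilinear (W y)"
  using bilinear_de[of y] unfolding bilinear_def W_def
  by (auto intro!: linear_compose_sum linear_scaleR_const)

lemma smooth_de: "smooth_on S (\<lambda>y. de i y u v)"
  unfolding de_def by (rule smooth_on_frechet_derivative[OF smooth_e])

lemma smooth_W: "smooth_on S (\<lambda>y. W y u v)"
  unfolding W_def by (intro smooth_on_sum smooth_on_scaleR smooth_de smooth_E S)

text \<open>Tensors with constant frame components are parallel for \<open>W\<close>.\<close>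
lemma frame_constant_derivative:
  assumes "\<And>y. y \<in> S \<Longrightarrow> multilinear k (\<alpha> y)" 
    and C: "\<And>y is. y \<in> S \<Longrightarrow> length is = k \<Longrightarrow> \<alpha> y (map (E y) is) = C is"
    and y: "y \<in> S" and len: "length vs = k"
  shows "((\<lambda>z. \<alpha> z vs) has_derivative (\<lambda>u. act (W y u) (\<alpha> y) vs)) (at y)"
proof -
  have exp: "\<alpha> z us = (\<Sum>is | length is = k. (\<Prod>j<k. e (is ! j) z [us ! j]) * C is)" if "z \<in> S" "length us = k" for z us
    using multilinear_expand[OF assms(1)[OF that(1)] E_expand[OF that(1)] that(2)] C[OF that(1)] by simp
  have "((\<lambda>z. \<Sum>is | length is = k. (\<Prod>j<k. e (is ! j) z [vs ! j]) * C is) has_derivative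
     (\<lambda>u. \<Sum>is | length is = k. (\<Sum>j<k. de (is ! j) y u (vs ! j) * (\<Prod>l\<in>{..<k} - {j}. e (is ! l) y [vs ! l])) * C is)) (at y)"
    by (intro has_derivative_sum has_derivative_mult_left has_derivative_prod de y)
  moreover have "(\<Sum>is | length is = k. (\<Sum>j<k. de (is ! j) y u (vs ! j) * (\<Prod>l\<in>{..<k} - {j}. e (is ! l) y [vs ! l])) * C is)
     = act (W y u) (\<alpha> y) vs" for u
  proof -
    have "(\<Prod>l<k. e (is ! l) y [vs[j := W y u (vs ! j)] ! l]) = de (is ! j) y u (vs ! j) * (\<Prod>l\<in>{..<k} - {j}. e (is ! l) y [vs ! l])"
      if "j < k" for j "is"
      using that len by (subst prod.remove[of _ j]) (auto simp: e_W[OF y] intro!: prod.cong)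
    then have "\<alpha> y (vs[j := W y u (vs ! j)]) = (\<Sum>is | length is = k. de (is ! j) y u (vs ! j) * (\<Prod>l\<in>{..<k} - {j}. e (is ! l) y [vs ! l]) * C is)"
      if "j < k" for j
      using exp[OF y, of "vs[j := W y u (vs ! j)]"] len that by simp
    then show ?thesis
      unfolding act_def len by (simp add: sum_distrib_right) (rule sum.swap)
  qed
  ultimately show ?thesis
    using has_derivative_cong_open[OF S y, of "\<lambda>z. \<alpha> z vs" "\<lambda>z. \<Sum>is | length is = k. (\<Prod>j<k. e (is ! j) z [vs ! j]) * C is"] exp[OF _ len]
    by simp
qed

end

section \<open>The Levi-Civita connection in an adapted frame\<close>

lemma act_add:
  assumes "multilinear k F" "length vs = k"
  shows "act (\<lambda>v. X v + Y v) F vs = act X F vs + act Y F vs"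
proof -
  have "F (vs[j := X (vs ! j) + Y (vs ! j)]) = F (vs[j := X (vs ! j)]) + F (vs[j := Y (vs ! j)])" if "j < k" for j
  proof -
    have "linear (\<lambda>v. F (vs[j := v]))" using assms that by (simp add: multilinear_def)
    from linear_add[OF this] show ?thesis .
  qed
  then show ?thesis using assms(2) by (simp add: act_def sum.distrib)
qed

lemma linear_act:
  assumes "multilinear k F" "length vs = k" "\<And>v. linear (\<lambda>u. X u v)"
  shows "linear (\<lambda>u. act (X u) F vs)"
  unfolding act_def
proof (intro linear_compose_sum ballI)
  fix j assume "j \<in> {..<length vs}"
  then have "linear (\<lambda>v. F (vs[j := v]))" using assms(1,2) by (simp add: multilinear_def)
  from linear_compose[OF assms(3) this] show "linear (\<lambda>u. F (vs[j := X u (vs ! j)]))" by (simp add: comp_def)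
qed

lemma multilinear_3:
  assumes "multilinear 3 F"
  shows "linear (\<lambda>u. F [u, v, w])" "linear (\<lambda>u. F [v, u, w])" "linear (\<lambda>u. F [v, w, u])"
  using assms[unfolded multilinear_def, rule_format, of "[v, v, w]" 0] assms[unfolded multilinear_def, rule_format, of "[v, v, w]" 1]
    assms[unfolded multilinear_def, rule_format, of "[v, w, w]" 2] by simp_all

lemma multilinear_4:
  assumes "multilinear 4 F"
  shows "linear (\<lambda>u. F [u, v, w, z])" "linear (\<lambda>u. F [v, u, w, z])" "linear (\<lambda>u. F [v, w, u, z])" "linear (\<lambda>u. F [v, w, z, u])"
  using assms[unfolded multilinear_def, rule_format, of "[v, v, w, z]" 0] assms[unfolded multilinear_def, rule_format, of "[v, v, w, z]" 1]
    assms[unfolded multilinear_def, rule_format, of "[v, w, w, z]" 2] assms[unfolded multilinear_def, rule_format, of "[v, w, z, z]" 3] by simp_all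

lemma act_list3: "act B F [u, v, w] = F [B u, v, w] + F [u, B v, w] + F [u, v, B w]"
  by (simp add: act_def numeral_3_eq_3)

lemma act_list4: "act B F [u, v, w, z] = F [B u, v, w, z] + F [u, B v, w, z] + F [u, v, B w, z] + F [u, v, w, B z]"
  by (simp add: act_def eval_nat_numeral)

lemma act_frame3:
  assumes "multilinear 3 F" "\<And>j. B (E j) = (\<Sum>k\<in>UNIV. b j k *\<^sub>R E k)"
  shows "act B F [E i, E j, E k] = act3 b (\<lambda>i j k. F [E i, E j, E k]) i j k"
  unfolding act_list3 assms(2) act3_def
  by (simp add: linear_sum[OF multilinear_3(1)[OF assms(1)]] linear_sum[OF multilinear_3(2)[OF assms(1)]] linear_sum[OF multilinear_3(3)[OF assms(1)]]
    linear_cmul[OF multilinear_3(1)[OF assms(1)]] linear_cmul[OF multilinear_3(2)[OF assms(1)]] linear_cmul[OF multilinear_3(3)[OF assms(1)]] sum.distrib)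

lemma act_frame4:
  assumes "multilinear 4 F" "\<And>j. B (E j) = (\<Sum>k\<in>UNIV. b j k *\<^sub>R E k)"
  shows "act B F [E i, E j, E k, E l] = act4 b (\<lambda>i j k l. F [E i, E j, E k, E l]) i j k l"
  unfolding act_list4 assms(2) act4_def
  by (simp add: linear_sum[OF multilinear_4(1)[OF assms(1)]] linear_sum[OF multilinear_4(2)[OF assms(1)]] linear_sum[OF multilinear_4(3)[OF assms(1)]]
    linear_sum[OF multilinear_4(4)[OF assms(1)]] linear_cmul[OF multilinear_4(1)[OF assms(1)]] linear_cmul[OF multilinear_4(2)[OF assms(1)]]
    linear_cmul[OF multilinear_4(3)[OF assms(1)]] linear_cmul[OF multilinear_4(4)[OF assms(1)]] sum.distrib)

lemma hodge_uminus: "hodge g vol (\<lambda>y vs. - \<alpha> y vs) x ws = - hodge g vol \<alpha> x ws"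
  by (simp add: hodge_def Let_def sum_negf)

lemma hodge_cong:
  assumes "\<And>vs. length vs = 7 - length ws \<Longrightarrow> \<alpha> x vs = \<beta> x vs"
  shows "hodge g vol \<alpha> x ws = hodge g vol \<beta> x ws"
  using assms by (simp add: hodge_def Let_def)

lemma act_cong:
  assumes "\<And>us. length us = length vs \<Longrightarrow> F us = G us"
  shows "act A F vs = act A G vs"
  using assms by (simp add: act_def)

lemma alternating_form_lincomb:
  assumes F: "alternating_form k F" and G: "alternating_form k G"
  shows "alternating_form k (\<lambda>vs. c * F vs + G vs)"
  unfolding alternating_form_def
proof (intro conjI allI impI)
  fix vs :: "vec7 list" and i j
  show "c * F vs + G vs = 0" if "length vs \<noteq> k"
    using alternating_form_zero[OF F that] alternating_form_zero[OF G that] by simp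
  show "linear (\<lambda>v. c * F (vs[i := v]) + G (vs[i := v]))" if "length vs = k \<and> i < k"
  proof -
    have "linear (\<lambda>v. F (vs[i := v]))" "linear (\<lambda>v. G (vs[i := v]))"
      using F G that unfolding alternating_form_def by blast+
    then show ?thesis using linear_compose_add linear_compose_scale_right[of "\<lambda>v. F (vs[i := v])" c] by simp
  qed
  show "c * F vs + G vs = 0" if "length vs = k \<and> i < j \<and> j < k \<and> vs ! i = vs ! j"
  proof -
    have "F vs = 0" "G vs = 0" using F G that unfolding alternating_form_def by blast+
    then show ?thesis by simp
  qed
qed

text \<open>Forms are extended by zero to lists of the wrong length, and the exterior derivative respects this convention.\<close>
lemma ext_deriv_degree:
  assumes "open S" "y \<in> S" "\<And>z us. z \<in> S \<Longrightarrow> length us \<noteq> k \<Longrightarrow> \<alpha> z us = 0" "length vs \<noteq> Suc k"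
  shows "ext_deriv \<alpha> y vs = 0"
proof -
  have "frechet_derivative (\<lambda>z. \<alpha> z us) (at y) u = 0" if "length us \<noteq> k" for us u
  proof -
    have "frechet_derivative (\<lambda>z. \<alpha> z us) (at y) = frechet_derivative (\<lambda>z. 0) (at y)"
      using assms that by (intro frechet_derivative_cong_open) auto
    then show ?thesis by simp
  qed
  then show ?thesis unfolding ext_deriv_def using assms(4) by (intro sum.neutral) auto
qed

context frame_at
begin

text \<open>The difference of the two connections is skew in the last two arguments, since both are metric, and hence
  totally skew, since both torsions are. Its slices annihilate \<open>\<omega>\<close>, and \<open>g2_torsion_eq_0\<close> applies.\<close>
lemma G2_connection_unique:
  assumes \<omega>: "alternating_form 3 (\<omega> x)" "\<And>a b c. \<omega> x [E a, E b, E c] = phi a b c"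
    and bil: "bilinear \<Gamma>" "bilinear \<Gamma>'"
    and par: "\<And>u v w. g x (\<Gamma> u v) w + g x v (\<Gamma> u w) = g x (\<Gamma>' u v) w + g x v (\<Gamma>' u w)"
      "\<And>u vs. length vs = 3 \<Longrightarrow> act (\<Gamma> u) (\<omega> x) vs = act (\<Gamma>' u) (\<omega> x) vs"
    and tor: "\<And>u v w. g x (\<Gamma> u v - \<Gamma> v u) w = - g x (\<Gamma> u w - \<Gamma> w u) v"
      "\<And>u v w. g x (\<Gamma>' u v - \<Gamma>' v u) w = - g x (\<Gamma>' u w - \<Gamma>' w u) v"
  shows "\<Gamma> u v = \<Gamma>' u v"
proof -
  define D where "D u v = \<Gamma> u v - \<Gamma>' u v" for u v
  define d where "d i j k = g x (D (E i) (E j)) (E k)" for i j k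
  have glin: "g x (a - b) c = g x a c - g x b c" "g x a (b - c) = g x a b - g x a c" for a b c
    using linear_diff[OF g_linear(2)] linear_diff[OF g_linear(1)] by auto
  have s23: "g x (D u v) w = - g x (D u w) v" for u v w
    using par(1)[of u v w] sym[of v "\<Gamma> u w"] sym[of v "\<Gamma>' u w"] by (simp add: D_def glin)
  have t: "g x (D u v) w - g x (D v u) w = - g x (D u w) v + g x (D w u) v" for u v w
    using tor(1)[of u v w] tor(2)[of u v w] by (simp add: D_def glin)
  have s12: "g x (D v u) w = - g x (D u v) w" for u v w
    using t[of u w v] t[of w u v] t[of u v w] s23[of u v w] s23[of v u w] s23[of w u v] s23[of w v u] s23[of v w u] s23[of u w v]
    by linarith
  have d_skew: "d j i k = - d i j k" "d i k j = - d i j k" for i j k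
    unfolding d_def using s12[of "E j" "E i" "E k"] s23[of "E i" "E k" "E j"] by simp_all
  have D_E: "D (E i) (E j) = (\<Sum>k\<in>UNIV. d i j k *\<^sub>R E k)" for i j
    unfolding d_def by (rule E_expand)
  have Dlin: "linear (\<lambda>u. D u v)" "linear (D u)" for u v
    using bil unfolding D_def bilinear_def by (auto intro!: linear_compose_sub)
  have \<omega>m: "multilinear 3 (\<omega> x)" using alternating_form_multilinear[OF \<omega>(1)] .
  have "act (D u) (\<omega> x) vs = 0" if "length vs = 3" for u vs
  proof -
    have "act (\<Gamma> u) (\<omega> x) vs = act (\<lambda>v. D u v + \<Gamma>' u v) (\<omega> x) vs" by (simp add: D_def)
    then show ?thesis using act_add[OF \<omega>m that, of "D u" "\<Gamma>' u"] par(2)[OF that, of u] by simp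
  qed
  then have "act3 (d i) phi j k l = 0" for i j k l
    using act_frame3[OF \<omega>m, of "D (E i)" E "d i" j k l] D_E by (simp add: \<omega>(2))
  then have "vec_part (d i) a = 0" for i a
    using vec_part_eq_0_iff[of "d i", OF d_skew(2)] by blast
  then have "d i j k = 0" for i j k
    using g2_torsion_eq_0[of d, OF d_skew] by blast
  then have "D (E i) (E j) = 0" for i j by (simp add: D_E)
  then have "D (E i) v = 0" for i v
    by (subst E_expand[of v]) (simp add: linear_sum[OF Dlin(2)] linear_cmul[OF Dlin(2)])
  then have "D u v = 0"
    by (subst E_expand[of u]) (simp add: linear_sum[OF Dlin(1)] linear_cmul[OF Dlin(1)])
  then show ?thesis by (simp add: D_def)
qed

end

context adapted_chart
begin

text \<open>The derivative of the metric, expressed through the metric connection \<open>W\<close>.\<close>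
definition dg :: "vec7 \<Rightarrow> vec7 \<Rightarrow> vec7 \<Rightarrow> vec7 \<Rightarrow> real" where
  "dg y u v w = g y (W y u v) w + g y v (W y u w)"

lemma dg: assumes y: "y \<in> S" shows "((\<lambda>z. g z v w) has_derivative (\<lambda>u. dg y u v w)) (at y)"
proof -
  have "((\<lambda>z. \<Sigma> i. e i z [v] * e i z [w]) has_derivative (\<lambda>u. \<Sigma> i. e i y [v] * de i y u w + de i y u v * e i y [w])) (at y)"
    by (intro has_derivative_sum has_derivative_mult de y)
  moreover have "(\<Sigma> i. e i y [v] * de i y u w + de i y u v * e i y [w]) = dg y u v w" for u
    by (simp add: dg_def g_e[OF y] e_W[OF y] sum.distrib)
  ultimately show ?thesis
    using has_derivative_cong_open[OF S y, of "\<lambda>z. g z v w" "\<lambda>z. \<Sigma> i. e i z [v] * e i z [w]"] g_e by simp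
qed

lemma frechet_g: "y \<in> S \<Longrightarrow> frechet_derivative (\<lambda>z. g z v w) (at y) u = dg y u v w"
  using frechet_derivative_at[OF dg] by metis

abbreviation "L \<equiv> levi_civita g"

lemma dg_linear: assumes y: "y \<in> S"
  shows "linear (\<lambda>u. dg y u v w)" "linear (\<lambda>v. dg y u v w)" "linear (\<lambda>w. dg y u v w)"
  by (rule linearI; simp add: dg_def bilinear_ladd[OF bilinear_W[OF y]] bilinear_radd[OF bilinear_W[OF y]] bilinear_lmul[OF bilinear_W[OF y]] bilinear_rmul[OF bilinear_W[OF y]]
     bilinear_ladd[OF g_bilinear[OF y]] bilinear_radd[OF g_bilinear[OF y]] bilinear_lmul[OF g_bilinear[OF y]] bilinear_rmul[OF g_bilinear[OF y]] distrib_left)+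

lemma dg_sym: "y \<in> S \<Longrightarrow> dg y u v w = dg y u w v"
  by (simp add: dg_def g_e mult.commute)

text \<open>The definition of the Levi-Civita symbols through an arbitrary orthonormal basis is the Koszul formula in
  disguise, so it may be evaluated in any orthonormal basis.\<close>
lemma levi_civita_frame:
  assumes y: "y \<in> S" and B: "inner_at.orthonormal g y B"
  shows "L y u v = (\<Sum>i\<in>UNIV. ((dg y u v (B i) + dg y v u (B i) - dg y (B i) u v) / 2) *\<^sub>R B i)"
  and koszul: "g y (L y u v) w = (dg y u v w + dg y v u w - dg y w u v) / 2"
proof -
  interpret F: frame_at g y vol "E y" by (rule frame[OF y])
  define l where "l w = (dg y u v w + dg y v u w - dg y w u v) / 2" for w
  have lin: "linear l"
    unfolding l_def
    by (intro linearI) (simp_all add: linear_add[OF dg_linear(1)[OF y]] linear_add[OF dg_linear(3)[OF y]]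
      linear_cmul[OF dg_linear(1)[OF y]] linear_cmul[OF dg_linear(3)[OF y]] field_simps)
  have *: "g y (\<Sum>i\<in>UNIV. l (C i) *\<^sub>R C i) w = l w" if "F.orthonormal C" for C w
  proof -
    have "l w = (\<Sigma> i. g y w (C i) * l (C i))"
      using arg_cong[OF F.orthonormal_expand[OF that, of w], of l] by (simp only: linear_sum[OF lin] linear_cmul[OF lin] real_scaleR_def)
    then show ?thesis by (simp add: F.g_sum F.sym[of w] mult.commute)
  qed
  have L: "L y u v = (\<Sum>i\<in>UNIV. l (onb g y i) *\<^sub>R onb g y i)"
    unfolding levi_civita_def by (simp add: frechet_g[OF y] l_def)
  then show kz: "g y (L y u v) w = (dg y u v w + dg y v u w - dg y w u v) / 2" for w
    using *[OF F.onb_orthonormal] by (simp add: l_def)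
  have "L y u v = (\<Sum>i\<in>UNIV. l (B i) *\<^sub>R B i)"
    by (rule F.g_ext, simp only: kz *[OF B], simp only: l_def)
  then show "L y u v = (\<Sum>i\<in>UNIV. ((dg y u v (B i) + dg y v u (B i) - dg y (B i) u v) / 2) *\<^sub>R B i)"
    by (simp add: l_def)
qed

lemma L_koszul: "y \<in> S \<Longrightarrow> g y (L y u v) w = (dg y u v w + dg y v u w - dg y w u v) / 2"
  using koszul frame_at.E_orthonormal[OF frame] by blast

lemma L_sym: assumes y: "y \<in> S" shows "L y u v = L y v u"
proof -
  interpret F: frame_at g y vol "E y" by (rule frame[OF y])
  show ?thesis by (rule F.g_ext) (simp add: L_koszul[OF y] dg_sym[OF y, of _ u v])
qed

lemma bilinear_L: assumes y: "y \<in> S" shows "bilinear (L y)"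
proof -
  interpret F: frame_at g y vol "E y" by (rule frame[OF y])
  have "linear (L y u)" for u
  proof (rule linearI)
    fix v w and c :: real
    note lin = dg_linear[OF y]
    show "L y u (v + w) = L y u v + L y u w"
      by (rule F.g_ext) (simp add: bilinear_ladd[OF g_bilinear[OF y]] L_koszul[OF y] linear_add[OF lin(1)] linear_add[OF lin(2)] linear_add[OF lin(3)] field_simps)
    show "L y u (c *\<^sub>R v) = c *\<^sub>R L y u v"
      by (rule F.g_ext) (simp add: bilinear_lmul[OF g_bilinear[OF y]] L_koszul[OF y] linear_cmul[OF lin(1)] linear_cmul[OF lin(2)] linear_cmul[OF lin(3)] field_simps)
  qed
  moreover have "(\<lambda>u. L y u v) = L y v" for v using L_sym[OF y] by blast
  ultimately show ?thesis by (simp add: bilinear_def)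
qed

lemma L_metric: "y \<in> S \<Longrightarrow> dg y u v w = g y (L y u v) w + g y v (L y u w)"
proof -
  assume y: "y \<in> S"
  interpret F: frame_at g y vol "E y" by (rule frame[OF y])
  show ?thesis
    unfolding F.sym[of v "L y u w"] L_koszul[OF y]
    unfolding dg_sym[OF y, of u w v] by (simp add: field_simps)
qed

text \<open>The Levi-Civita connection relative to the frame connection; \<open>a\<close> are its frame components.\<close>
definition A :: christoffel where "A y u v = L y u v - W y u v"

lemma bilinear_A: "y \<in> S \<Longrightarrow> bilinear (A y)"
  using bilinear_L[of y] bilinear_W[of y] unfolding bilinear_def A_def by (auto intro!: linear_compose_sub)

lemma A_skew: assumes y: "y \<in> S" shows "g y (A y u v) w = - g y v (A y u w)"
  using L_metric[OF y, of u v w] unfolding dg_def A_def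
  by (simp add: bilinear_lsub[OF g_bilinear[OF y]] bilinear_rsub[OF g_bilinear[OF y]])

definition a :: "vec7 \<Rightarrow> 7 \<Rightarrow> 7 \<Rightarrow> 7 \<Rightarrow> real" where
  "a y i j k = g y (A y (E y i) (E y j)) (E y k)"

lemma a_skew: "y \<in> S \<Longrightarrow> a y i k j = - a y i j k"
proof -
  assume y: "y \<in> S"
  interpret F: frame_at g y vol "E y" by (rule frame[OF y])
  show ?thesis unfolding a_def using A_skew[OF y, of "E y i" "E y k" "E y j"] F.sym by simp
qed

lemma A_E: assumes y: "y \<in> S" shows "A y (E y i) (E y j) = (\<Sum>k\<in>UNIV. a y i j k *\<^sub>R E y k)"
  unfolding a_def by (rule inner_at.orthonormal_expand[OF frame_at.axioms(1)[OF frame[OF y]] frame_at.E_orthonormal[OF frame[OF y]]])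

abbreviation "\<psi> \<equiv> hodge g vol \<omega>"

lemma \<psi>_alt: assumes y: "y \<in> S" shows "alternating_form 4 (\<psi> y)"
  using frame_at.hodge_alternating[OF frame[OF y], of 3 \<omega>] alternating_form_zero[OF \<omega>_alt[OF y]] by simp

lemma \<psi>_frame: assumes y: "y \<in> S" shows "\<psi> y [E y i, E y j, E y k, E y l] = psi i j k l"
  by (rule frame_at.hodge_phi[where \<omega> = \<omega> and E = "E y", OF frame[OF y] \<omega>_alt[OF y] \<omega>_frame[OF y]])

lemma \<omega>_multilinear: "y \<in> S \<Longrightarrow> multilinear 3 (\<omega> y)" and \<psi>_multilinear: "y \<in> S \<Longrightarrow> multilinear 4 (\<psi> y)"
  using alternating_form_multilinear \<omega>_alt \<psi>_alt by blast+

lemma \<omega>_derivative: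
  assumes y: "y \<in> S" "length vs = 3"
  shows "((\<lambda>z. \<omega> z vs) has_derivative (\<lambda>u. act (W y u) (\<omega> y) vs)) (at y)"
proof (rule frame_constant_derivative[OF \<omega>_multilinear _ y])
  show "\<omega> z (map (E z) is) = phi (is ! 0) (is ! 1) (is ! 2)" if "z \<in> S" "length is = 3" for z "is"
    using that \<omega>_frame by (auto simp: length_Suc_conv numeral_3_eq_3)
qed

lemma \<psi>_derivative:
  assumes y: "y \<in> S" "length vs = 4"
  shows "((\<lambda>z. \<psi> z vs) has_derivative (\<lambda>u. act (W y u) (\<psi> y) vs)) (at y)"
proof (rule frame_constant_derivative[OF \<psi>_multilinear _ y])
  show "\<psi> z (map (E z) is) = psi (is ! 0) (is ! 1) (is ! 2) (is ! 3)" if "z \<in> S" "length is = 4" for z "is"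
    using that \<psi>_frame by (auto simp: length_Suc_conv eval_nat_numeral)
qed

text \<open>For a \<open>W\<close>-parallel form the Levi-Civita derivative in direction \<open>u\<close> is minus the action of \<open>A u\<close>. This
  action commutes with the star, so \<open>hodge_ext_deriv\<close> becomes purely algebraic.\<close>
lemma star_ext_deriv_parallel:
  assumes y: "y \<in> S" and \<alpha>: "alternating_form k (\<alpha> y)"
    and der: "\<And>vs. length vs = k \<Longrightarrow> ((\<lambda>z. \<alpha> z vs) has_derivative (\<lambda>u. act (W y u) (\<alpha> y) vs)) (at y)"
    and len: "length ws + Suc k = 7"
  shows "hodge g vol (ext_deriv \<alpha>) y ws = - ((-1) ^ k * (\<Sigma> i. act (A y (E y i)) (hodge g vol \<alpha> y) (E y i # ws)))"
proof -
  interpret F: frame_at g y vol "E y" by (rule frame[OF y])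
  note m = alternating_form_multilinear[OF \<alpha>]
  have Alin: "linear (A y u)" "linear (\<lambda>u. A y u v)" for u v using bilinear_A[OF y] by (auto simp: bilinear_def)
  have "hodge g vol (ext_deriv \<alpha>) y ws = (-1) ^ k * (\<Sigma> i. hodge g vol (\<lambda>_ vs. - act (A y (E y i)) (\<alpha> y) vs) y (E y i # ws))"
  proof (rule F.hodge_ext_deriv[where \<alpha> = \<alpha> and L = "L y" and N = "\<lambda>u vs. - act (A y u) (\<alpha> y) vs", OF \<alpha> len])
    fix u and vs :: "vec7 list" assume vs: "length vs = k"
    have "act (L y u) (\<alpha> y) vs = act (\<lambda>v. W y u v + A y u v) (\<alpha> y) vs" by (simp add: A_def)
    then have "act (L y u) (\<alpha> y) vs = act (W y u) (\<alpha> y) vs + act (A y u) (\<alpha> y) vs"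
      using act_add[OF m vs, of "W y u" "A y u"] by simp
    moreover have "frechet_derivative (\<lambda>z. \<alpha> z vs) (at y) u = act (W y u) (\<alpha> y) vs"
      using frechet_derivative_at[OF der[OF vs]] by metis
    ultimately show "frechet_derivative (\<lambda>z. \<alpha> z vs) (at y) u = - act (A y u) (\<alpha> y) vs + act (L y u) (\<alpha> y) vs" by simp
  next
    show "multilinear k (\<lambda>vs. - act (A y u) (\<alpha> y) vs)" for u
      using multilinear_mult[OF multilinear_act[OF Alin(1) m], of "-1"] by simp
    show "linear (\<lambda>u. - act (A y u) (\<alpha> y) vs)" if "length vs = k" for vs
      using linear_compose_neg[OF linear_act[OF m that Alin(2)]] by simp
  qed (rule L_sym[OF y])
  moreover have "hodge g vol (\<lambda>_ vs. - act (A y (E y i)) (\<alpha> y) vs) y (E y i # ws) = - act (A y (E y i)) (hodge g vol \<alpha> y) (E y i # ws)" for i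
    using F.hodge_act[where A = "A y (E y i)" and \<alpha> = \<alpha> and ws = "E y i # ws", OF A_skew[OF y] Alin(1) m] len hodge_uminus[of g vol "\<lambda>_. act (A y (E y i)) (\<alpha> y)"] by simp
  ultimately show ?thesis by (simp only: sum_negf mult_minus_right)
qed

lemma star_d\<omega>: assumes y: "y \<in> S"
  shows "hodge g vol (ext_deriv \<omega>) y [E y b, E y c, E y d] = g2_first_order.sd (a y) b c d"
proof -
  have loc: "g2_first_order (a y)" by unfold_locales (rule a_skew[OF y])
  have "hodge g vol (ext_deriv \<omega>) y [E y b, E y c, E y d] = (\<Sigma> i. act (A y (E y i)) (\<psi> y) [E y i, E y b, E y c, E y d])"
    using star_ext_deriv_parallel[OF y \<omega>_alt[OF y] \<omega>_derivative[OF y], of "[E y b, E y c, E y d]"] by simp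
  moreover have "act (A y (E y i)) (\<psi> y) [E y i, E y b, E y c, E y d] = act4 (a y i) psi i b c d" for i
    using act_frame4[where F = "\<psi> y" and B = "A y (E y i)" and E = "E y" and b = "a y i", OF \<psi>_multilinear[OF y] A_E[OF y]] by (simp add: \<psi>_frame[OF y])
  ultimately show ?thesis by (simp only: g2_first_order.sd_def[OF loc])
qed

lemma hodge_\<psi>: "y \<in> S \<Longrightarrow> length vs = 3 \<Longrightarrow> hodge g vol \<psi> y vs = \<omega> y vs"
  by (rule frame_at.hodge_hodge[OF frame \<omega>_alt]) auto

lemma star_d\<psi>: assumes y: "y \<in> S"
  shows "hodge g vol (ext_deriv \<psi>) y [E y b, E y c] = - (\<Sigma> i. act3 (a y i) phi i b c)"
proof -
  have "hodge g vol (ext_deriv \<psi>) y [E y b, E y c] = - (\<Sigma> i. act (A y (E y i)) (hodge g vol \<psi> y) [E y i, E y b, E y c])"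
    using star_ext_deriv_parallel[OF y \<psi>_alt[OF y] \<psi>_derivative[OF y], of "[E y b, E y c]"] by simp
  moreover have "act (A y (E y i)) (hodge g vol \<psi> y) [E y i, E y b, E y c] = act (A y (E y i)) (\<omega> y) [E y i, E y b, E y c]" for i
    by (rule act_cong) (simp add: hodge_\<psi>[OF y])
  moreover have "act (A y (E y i)) (\<omega> y) [E y i, E y b, E y c] = act3 (a y i) phi i b c" for i
    using act_frame3[where F = "\<omega> y" and B = "A y (E y i)" and E = "E y" and b = "a y i", OF \<omega>_multilinear[OF y] A_E[OF y]] by (simp add: \<omega>_frame[OF y])
  ultimately show ?thesis by simp
qed

abbreviation "\<theta> \<equiv> lee_form \<omega> g vol"

lemma star_d\<omega>_alt: assumes y: "y \<in> S" shows "alternating_form 3 (hodge g vol (ext_deriv \<omega>) y)"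
proof -
  have "ext_deriv \<omega> y vs = 0" if "length vs \<noteq> 4" for vs
    using ext_deriv_degree[OF S y, of 3 \<omega> vs] alternating_form_zero[OF \<omega>_alt] that by simp
  then show ?thesis using frame_at.hodge_alternating[OF frame[OF y], of 4 "ext_deriv \<omega>"] by simp
qed

lemma wedge_degree:
  assumes "\<And>vs. length vs \<noteq> p \<Longrightarrow> \<alpha> y vs = 0" "\<And>vs. length vs \<noteq> q \<Longrightarrow> \<beta> y vs = 0" "length vs \<noteq> p + q"
  shows "(\<alpha> \<and>\<^sub>f \<beta>) y vs = 0"
  unfolding wedge_def
proof (intro sum.neutral ballI)
  fix I assume I: "I \<in> Pow {..<length vs}"
  have len: "length (nths vs I) + length (nths vs (- I)) = length vs"
  proof -
    have "length (nths vs I) + length (nths vs (- I)) = card {i. i < length vs \<and> i \<in> I} + card {i. i < length vs \<and> i \<notin> I}"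
      by (simp add: length_nths)
    also have "\<dots> = card ({i. i < length vs \<and> i \<in> I} \<union> {i. i < length vs \<and> i \<notin> I})"
      by (rule card_Un_disjoint[symmetric]) auto
    also have "{i. i < length vs \<and> i \<in> I} \<union> {i. i < length vs \<and> i \<notin> I} = {..<length vs}" by auto
    finally show ?thesis by simp
  qed
  show "(-1) ^ card {(i, j). i \<in> I \<and> j \<notin> I \<and> j < i} * \<alpha> y (nths vs I) * \<beta> y (nths vs (- I)) = 0"
  proof (cases "length (nths vs I) = p")
    case True
    then have "length (nths vs (- I)) \<noteq> q" using len assms(3) by auto
    then show ?thesis using assms(2) by simp
  qed (use assms(1) in simp)
qed

lemma \<theta>_alt: assumes y: "y \<in> S" shows "alternating_form 1 (\<theta> y)"
proof -
  have "(hodge g vol (ext_deriv \<omega>) \<and>\<^sub>f \<omega>) y vs = 0" if "length vs \<noteq> 6" for vs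
    by (rule wedge_degree[where p = 3 and q = 3]) (use alternating_form_zero[OF star_d\<omega>_alt[OF y]] alternating_form_zero[OF \<omega>_alt[OF y]] that in auto)
  then have "alternating_form 1 (hodge g vol (hodge g vol (ext_deriv \<omega>) \<and>\<^sub>f \<omega>) y)"
    using frame_at.hodge_alternating[OF frame[OF y], of 6] by simp
  from alternating_form_lincomb[OF this this, of "-4/3"] show ?thesis
    unfolding lee_form_def[abs_def] by simp
qed

lemma sum_lists_1: "(\<Sum>is | length (is :: 7 list) = Suc 0. f is) = (\<Sigma> i. f [i])"
  by (simp add: sum_lists_Suc)

lemma lee_frame: assumes y: "y \<in> S"
  shows "\<theta> y [E y i] = (\<Sigma> j. \<Sigma> k. \<Sigma> l. g2_first_order.sd (a y) j k l * psi j k l i) / 18"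
proof -
  have "hodge g vol (hodge g vol (ext_deriv \<omega>) \<and>\<^sub>f \<omega>) y [E y i] = 
     - (\<Sum>is | length is = 3. hodge g vol (ext_deriv \<omega>) y (map (E y) is) * \<psi> y (map (E y) is @ [E y i])) / fact 3"
    using frame_at.hodge_wedge[OF frame[OF y], of 3 "hodge g vol (ext_deriv \<omega>)" 3 \<omega> "[E y i]"]
      alternating_form_zero[OF star_d\<omega>_alt[OF y]] alternating_form_zero[OF \<omega>_alt[OF y]] alternating_form_multilinear[OF star_d\<omega>_alt[OF y]] by simp
  also have "(\<Sum>is | length is = 3. hodge g vol (ext_deriv \<omega>) y (map (E y) is) * \<psi> y (map (E y) is @ [E y i]))
     = (\<Sigma> j. \<Sigma> k. \<Sigma> l. g2_first_order.sd (a y) j k l * psi j k l i)"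
    by (simp add: numeral_3_eq_3 sum_lists_Suc star_d\<omega>[OF y] \<psi>_frame[OF y])
  finally show ?thesis by (simp add: lee_form_def fact_numeral)
qed

lemma star_\<theta>\<omega>: assumes y: "y \<in> S"
  shows "hodge g vol (\<theta> \<and>\<^sub>f \<omega>) y [E y b, E y c, E y d] = - (\<Sigma> i. \<theta> y [E y i] * psi i b c d)"
  using frame_at.hodge_wedge[OF frame[OF y], of 1 \<theta> 3 \<omega> "[E y b, E y c, E y d]"]
    alternating_form_zero[OF \<theta>_alt[OF y]] alternating_form_zero[OF \<omega>_alt[OF y]] alternating_form_multilinear[OF \<theta>_alt[OF y]]
  by (simp add: sum_lists_1 \<psi>_frame[OF y] One_nat_def)

lemma star_\<theta>\<psi>: assumes y: "y \<in> S"
  shows "hodge g vol (\<theta> \<and>\<^sub>f \<psi>) y [E y b, E y c] = (\<Sigma> i. \<theta> y [E y i] * phi i b c)"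
  using frame_at.hodge_wedge[OF frame[OF y], of 1 \<theta> 4 \<psi> "[E y b, E y c]"]
    alternating_form_zero[OF \<theta>_alt[OF y]] alternating_form_zero[OF \<psi>_alt[OF y]] alternating_form_multilinear[OF \<theta>_alt[OF y]]
  by (simp add: sum_lists_1 hodge_\<psi>[OF y] \<omega>_frame[OF y] One_nat_def)

lemma al_frame: assumes y: "y \<in> S"
  shows "form_inner 4 g (ext_deriv \<omega>) \<psi> y = g2_first_order.al (a y)"
proof -
  have loc: "g2_first_order (a y)" by unfold_locales (rule a_skew[OF y])
  interpret F: frame_at g y vol "E y" by (rule frame[OF y])
  have "form_inner 4 g (ext_deriv \<omega>) \<psi> y = form_inner 3 g \<omega> (hodge g vol (ext_deriv \<omega>)) y"
    using F.form_inner_hodge[of 3 "ext_deriv \<omega>" \<omega>] by simp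
  also have "\<dots> = (\<Sigma> i. \<Sigma> j. \<Sigma> k. phi i j k * g2_first_order.sd (a y) i j k) / 6"
    using F.form_inner_frame[of 3 \<omega> "hodge g vol (ext_deriv \<omega>)"] \<omega>_multilinear[OF y] alternating_form_multilinear[OF star_d\<omega>_alt[OF y]]
    by (simp add: numeral_3_eq_3 sum_lists_Suc star_d\<omega>[OF y] \<omega>_frame[OF y] fact_numeral)
  finally show ?thesis by (simp add: g2_first_order.al_def[OF loc])
qed

abbreviation "th y i \<equiv> \<theta> y [E y i]"

text \<open>Integrability at one point; together with the definition of \<open>\<theta>\<close> as Lee form it is the hypothesis of
  the theorem in this chart.\<close>
definition integrable_at :: "vec7 \<Rightarrow> bool" where
  "integrable_at y \<longleftrightarrow> (\<forall>vs. length vs = 5 \<longrightarrow> ext_deriv \<psi> y vs = (\<theta> \<and>\<^sub>f \<psi>) y vs)"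

text \<open>The star of both sides of \<open>d*\<omega> = \<theta> \<and> *\<omega>\<close>.\<close>
lemma integrable_frame:
  assumes y: "y \<in> S" "integrable_at y"
  shows "(\<Sigma> i. th y i * phi i b c) = - (\<Sigma> i. act3 (a y i) phi i b c)"
proof -
  have "hodge g vol (ext_deriv \<psi>) y [E y b, E y c] = hodge g vol (\<theta> \<and>\<^sub>f \<psi>) y [E y b, E y c]"
    using y(2) by (intro hodge_cong) (simp add: integrable_at_def)
  then show ?thesis by (simp add: star_d\<psi>[OF y(1)] star_\<theta>\<psi>[OF y(1)])
qed

text \<open>By integrability \<open>\<delta>\<omega>\<close> is minus the interior product of \<open>\<theta>\<close> with \<open>\<omega>\<close>; contraction with \<open>\<omega>\<close>
  and \<open>phi_phi2\<close> recover \<open>\<theta>\<close>.\<close>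
lemma lee_from_codiff:
  assumes y: "y \<in> S" "integrable_at y"
  shows "\<theta> y [v] = - (1/3) * hodge g vol (codiff g vol \<omega> \<and>\<^sub>f \<psi>) y [v]"
proof -
  interpret F: frame_at g y vol "E y" by (rule frame[OF y(1)])
  have off: "ext_deriv \<psi> y vs = 0" if "length vs \<noteq> 5" for vs
    using ext_deriv_degree[OF S y(1), of 4 \<psi> vs] alternating_form_zero[OF \<psi>_alt] that by simp
  have alt: "alternating_form 2 (hodge g vol (ext_deriv \<psi>) y)"
    using F.hodge_alternating[of 5 "ext_deriv \<psi>"] off by simp
  from alternating_form_lincomb[OF alt alt, of "-2"] have \<delta>: "alternating_form 2 (codiff g vol \<omega> y)"
    unfolding codiff_def[abs_def] by simp
  have "hodge g vol (ext_deriv \<psi>) y [E y b, E y c] = (\<Sigma> i. th y i * phi i b c)" for b c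
    unfolding star_d\<psi>[OF y(1)] integrable_frame[OF y] ..
  then have comp: "codiff g vol \<omega> y [E y b, E y c] = - (\<Sigma> i. th y i * phi i b c)" for b c
    by (simp add: codiff_def)
  have f: "hodge g vol (codiff g vol \<omega> \<and>\<^sub>f \<psi>) y [E y k] = - 3 * th y k" for k
  proof -
    have "hodge g vol (codiff g vol \<omega> \<and>\<^sub>f \<psi>) y [E y k] = (\<Sum>is | length is = 2. codiff g vol \<omega> y (map (E y) is) * hodge g vol \<psi> y (map (E y) is @ [E y k])) / fact 2"
      using F.hodge_wedge[of 2 "codiff g vol \<omega>" 4 \<psi> "[E y k]"]
        alternating_form_zero[OF \<delta>] alternating_form_zero[OF \<psi>_alt[OF y(1)]] alternating_form_multilinear[OF \<delta>] by simp
    also have "(\<Sum>is | length is = 2. codiff g vol \<omega> y (map (E y) is) * hodge g vol \<psi> y (map (E y) is @ [E y k]))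
       = (\<Sigma> b. \<Sigma> c. codiff g vol \<omega> y [E y b, E y c] * phi b c k)"
      by (simp add: numeral_2_eq_2 sum_lists_Suc hodge_\<psi>[OF y(1)] \<omega>_frame[OF y(1)])
    also have "\<dots> = - (\<Sigma> b. \<Sigma> c. \<Sigma> i. th y i * (phi i b c * phi k b c))"
      unfolding comp by (simp add: sum_negf sum_distrib_right phi_perms(2)[of k] mult.assoc phi_cyc[of k])
    also have "(\<Sigma> b. \<Sigma> c. \<Sigma> i. th y i * (phi i b c * phi k b c)) = (\<Sigma> i. \<Sigma> b. \<Sigma> c. th y i * (phi i b c * phi k b c))"
      by (rule sum_rot3[symmetric])
    also have "\<dots> = (\<Sigma> i. th y i * (6 * dl i k))"
      by (simp only: sum_distrib_left[symmetric] phi_phi2)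
    also have "\<dots> = 6 * th y k" by (simp add: mult.left_commute[of _ 6] sum_distrib_left[symmetric])
    finally show ?thesis by (simp add: fact_numeral)
  qed
  have alt1: "alternating_form 1 (hodge g vol (codiff g vol \<omega> \<and>\<^sub>f \<psi>) y)"
  proof -
    have "(codiff g vol \<omega> \<and>\<^sub>f \<psi>) y vs = 0" if "length vs \<noteq> 6" for vs
      by (rule wedge_degree[where p = 2 and q = 4]) (use alternating_form_zero[OF \<delta>] alternating_form_zero[OF \<psi>_alt[OF y(1)]] that in auto)
    then show ?thesis using F.hodge_alternating[of 6 "codiff g vol \<omega> \<and>\<^sub>f \<psi>"] by simp
  qed
  show ?thesis
  proof (rule F.multilinear_ext[of 1 "\<theta> y" "\<lambda>vs. - (1/3) * hodge g vol (codiff g vol \<omega> \<and>\<^sub>f \<psi>) y vs" "[v]"])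
    show "\<theta> y (map (E y) is) = - (1/3) * hodge g vol (codiff g vol \<omega> \<and>\<^sub>f \<psi>) y (map (E y) is)" if len: "length is = 1" for "is"
    proof -
      obtain k where "is = [k]" using len by (cases "is") auto
      then show ?thesis using f[of k] by simp
    qed
  qed (rule alternating_form_multilinear[OF \<theta>_alt[OF y(1)]] multilinear_mult[OF alternating_form_multilinear[OF alt1]] | simp)+
qed

end

section \<open>The characteristic connection\<close>

context adapted_chart
begin

lemma first_order: "y \<in> S \<Longrightarrow> g2_first_order (a y)"
  by unfold_locales (rule a_skew)

text \<open>Frame components of the torsion; \<open>Tf\<close> is the corresponding trilinear form and \<open>Gam\<close> the
  connection with that torsion.\<close>
definition T3 :: "vec7 \<Rightarrow> 7 \<Rightarrow> 7 \<Rightarrow> 7 \<Rightarrow> real" where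
  "T3 y = g2_first_order.T (a y) (th y)"

definition Tf :: "vec7 \<Rightarrow> vec7 \<Rightarrow> vec7 \<Rightarrow> vec7 \<Rightarrow> real" where
  "Tf y u v w = (\<Sigma> i. \<Sigma> j. \<Sigma> k. T3 y i j k * (e i y [u] * e j y [v] * e k y [w]))"

definition Gam :: christoffel where
  "Gam y u v = L y u v + (\<Sum>k\<in>UNIV. (Tf y u v (E y k) / 2) *\<^sub>R E y k)"

lemma Tf_E: "y \<in> S \<Longrightarrow> Tf y (E y i) (E y j) (E y k) = T3 y i j k"
  by (simp add: Tf_def e_E mult.assoc[symmetric])

lemma T3_skew: "y \<in> S \<Longrightarrow> T3 y j i k = - T3 y i j k" "y \<in> S \<Longrightarrow> T3 y i k j = - T3 y i j k"
  unfolding T3_def using g2_first_order.T_skew[OF first_order] by blast+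

lemma Tf_skew: assumes y: "y \<in> S" shows "Tf y v u w = - Tf y u v w" "Tf y u w v = - Tf y u v w"
proof -
  have "Tf y v u w = (\<Sigma> j. \<Sigma> i. \<Sigma> k. T3 y i j k * (e i y [v] * e j y [u] * e k y [w]))"
    unfolding Tf_def by (rule sum.swap)
  also have "\<dots> = (\<Sigma> j. \<Sigma> i. \<Sigma> k. - (T3 y j i k * (e j y [u] * e i y [v] * e k y [w])))"
  proof (intro sum.cong refl)
    fix i j k
    show "T3 y i j k * (e i y [v] * e j y [u] * e k y [w]) = - (T3 y j i k * (e j y [u] * e i y [v] * e k y [w]))"
      using T3_skew(1)[OF y, of j i k] by simp
  qed
  finally show "Tf y v u w = - Tf y u v w" by (simp add: Tf_def sum_negf)
  have "Tf y u w v = (\<Sigma> i. \<Sigma> k. \<Sigma> j. T3 y i j k * (e i y [u] * e j y [w] * e k y [v]))"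
    unfolding Tf_def by (intro sum.cong refl sum.swap)
  also have "\<dots> = (\<Sigma> i. \<Sigma> k. \<Sigma> j. - (T3 y i k j * (e i y [u] * e k y [v] * e j y [w])))"
  proof (intro sum.cong refl)
    fix i j k
    show "T3 y i j k * (e i y [u] * e j y [w] * e k y [v]) = - (T3 y i k j * (e i y [u] * e k y [v] * e j y [w]))"
      using T3_skew(2)[OF y, of i j k] by simp
  qed
  finally show "Tf y u w v = - Tf y u v w" by (simp add: Tf_def sum_negf)
qed

lemma Tf_linear: assumes y: "y \<in> S"
  shows "linear (\<lambda>u. Tf y u v w)" "linear (\<lambda>v. Tf y u v w)" "linear (\<lambda>w. Tf y u v w)"
proof -
  have *: "linear (\<lambda>v. c * G v)" "linear (\<lambda>v. G v * c)" if "linear G" for G :: "vec7 \<Rightarrow> real" and c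
    using linear_compose_scale_right[OF that, of c] by (simp_all add: mult.commute)
  show "linear (\<lambda>u. Tf y u v w)" "linear (\<lambda>v. Tf y u v w)" "linear (\<lambda>w. Tf y u v w)"
    unfolding Tf_def by (intro linear_compose_sum ballI * e_linear[OF y])+
qed

lemma g_Gam: assumes y: "y \<in> S" shows "g y (Gam y u v) w = g y (L y u v) w + Tf y u v w / 2"
proof -
  interpret F: frame_at g y vol "E y" by (rule frame[OF y])
  have "Tf y u v w = (\<Sigma> k. g y w (E y k) * Tf y u v (E y k))"
    using arg_cong[OF F.E_expand[of w], of "Tf y u v"]
    by (simp only: linear_sum[OF Tf_linear(3)[OF y]] linear_cmul[OF Tf_linear(3)[OF y]] real_scaleR_def)
  then show ?thesis
    unfolding Gam_def bilinear_ladd[OF g_bilinear[OF y]] F.g_sum F.sym[of w] by (simp add: sum_divide_distrib mult.commute)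
qed

lemma bilinear_Gam: assumes y: "y \<in> S" shows "bilinear (Gam y)"
proof -
  have *: "linear (\<lambda>v. G v / 2)" if "linear G" for G :: "vec7 \<Rightarrow> real"
    using linear_compose_scale_right[OF that, of "1/2"] by simp
  have "linear (L y u)" "linear (\<lambda>u. L y u v)" for u v using bilinear_L[OF y] by (auto simp: bilinear_def)
  then have "linear (\<lambda>v. Gam y u v)" "linear (\<lambda>u. Gam y u v)" for u v
    unfolding Gam_def by (intro linear_compose_add linear_compose_sum ballI linear_scaleR_const * Tf_linear[OF y]; simp)+
  then show ?thesis by (simp add: bilinear_def)
qed

lemma Gam_metric: assumes y: "y \<in> S" shows "dg y u v w = g y (Gam y u v) w + g y v (Gam y u w)"
proof -
  interpret F: frame_at g y vol "E y" by (rule frame[OF y])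
  show ?thesis
    unfolding F.sym[of v "Gam y u w"] g_Gam[OF y] L_metric[OF y] F.sym[of v "L y u w"]
    by (simp add: Tf_skew(2)[OF y, of u w v])
qed

lemma torsion_Gam: assumes y: "y \<in> S" shows "torsion g Gam y [u, v, w] = Tf y u v w"
  unfolding torsion_def using Tf_skew(1)[OF y, of v u w] L_sym[OF y, of u v]
  by (simp add: numeral_3_eq_3 bilinear_lsub[OF g_bilinear[OF y]] g_Gam[OF y])

text \<open>The difference of the two connections has frame components \<open>a + T3 / 2\<close>, whose slices lie in
  \<open>g\<^sub>2\<close> by \<open>vec_part_char_connection\<close>.\<close>
lemma Gam_parallel:
  assumes y: "y \<in> S" "integrable_at y" and len: "length vs = 3"
  shows "act (Gam y u) (\<omega> y) vs = act (W y u) (\<omega> y) vs"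
proof -
  interpret F: frame_at g y vol "E y" by (rule frame[OF y(1)])
  interpret G: g2_first_order "a y" "th y" by (rule first_order[OF y(1)])
  define B where "B u v = Gam y u v - W y u v" for u v
  have Blin: "linear (\<lambda>u. B u v)" "linear (B u)" for u v
    using bilinear_Gam[OF y(1)] bilinear_W[OF y(1)] unfolding B_def bilinear_def by (auto intro!: linear_compose_sub)
  note \<omega>m = \<omega>_multilinear[OF y(1)]
  have BE: "B (E y i) (E y j) = (\<Sum>k\<in>UNIV. (a y i j k + T3 y i j k / 2) *\<^sub>R E y k)" for i j
  proof -
    have "B (E y i) (E y j) = A y (E y i) (E y j) + (\<Sum>k\<in>UNIV. (T3 y i j k / 2) *\<^sub>R E y k)"
      by (simp add: B_def Gam_def A_def Tf_E[OF y(1)])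
    then show ?thesis by (simp add: A_E[OF y(1)] scaleR_add_left sum.distrib)
  qed
  have vp: "vec_part (\<lambda>j k. a y i j k + T3 y i j k / 2) l = 0" for i l
    unfolding T3_def by (rule G.vec_part_char_connection) (rule integrable_frame[OF y])
  have zero: "act (B (E y i)) (\<omega> y) [E y j, E y k, E y l] = 0" for i j k l
  proof -
    have "act (B (E y i)) (\<omega> y) [E y j, E y k, E y l] = act3 (\<lambda>j k. a y i j k + T3 y i j k / 2) phi j k l"
      using act_frame3[where F = "\<omega> y" and B = "B (E y i)" and E = "E y" and b = "\<lambda>j k. a y i j k + T3 y i j k / 2", OF \<omega>m BE]
      by (simp add: \<omega>_frame[OF y(1)])
    also have "\<dots> = 0"
    proof -
      have "a y i k j + T3 y i k j / 2 = - (a y i j k + T3 y i j k / 2)" for j k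
        using a_skew[OF y(1), of i k j] T3_skew(2)[OF y(1), of i k j] by simp
      from vec_part_eq_0_iff[of "\<lambda>j k. a y i j k + T3 y i j k / 2", OF this] vp show ?thesis by blast
    qed
    finally show ?thesis .
  qed
  have zeroE: "act (B (E y i)) (\<omega> y) vs = 0" for i
  proof (rule F.multilinear_ext[of 3 "act (B (E y i)) (\<omega> y)" "\<lambda>_. 0", OF multilinear_act[OF Blin(2) \<omega>m] _ _ len])
    show "act (B (E y i)) (\<omega> y) (map (E y) is) = 0" if "length is = 3" for "is"
      using that zero by (auto simp: length_Suc_conv numeral_3_eq_3)
  qed (simp add: multilinear_def linear_zero)
  have "act (B u) (\<omega> y) vs = 0"
    using arg_cong[OF F.E_expand[of u], of "\<lambda>u. act (B u) (\<omega> y) vs"] zeroE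
    by (simp only: linear_sum[OF linear_act[OF \<omega>m len Blin(1)]] linear_cmul[OF linear_act[OF \<omega>m len Blin(1)]]) simp
  moreover have "act (Gam y u) (\<omega> y) vs = act (\<lambda>v. B u v + W y u v) (\<omega> y) vs" by (simp add: B_def)
  ultimately show ?thesis using act_add[OF \<omega>m len, of "B u" "W y u"] by simp
qed

lemma torsion_formula:
  assumes y: "y \<in> S" 
  shows "torsion g Gam y vs = - hodge g vol (ext_deriv \<omega>) y vs + 1/6 * form_inner 4 g (ext_deriv \<omega>) \<psi> y * \<omega> y vs
      + hodge g vol (\<theta> \<and>\<^sub>f \<omega>) y vs"
    and torsion_alternating: "alternating_form 3 (torsion g Gam y)"
proof -
  interpret F: frame_at g y vol "E y" by (rule frame[OF y])
  interpret G: g2_first_order "a y" "th y" by (rule first_order[OF y])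
  let ?al = "form_inner 4 g (ext_deriv \<omega>) \<psi> y"
  define R where "R vs = - hodge g vol (ext_deriv \<omega>) y vs + 1/6 * ?al * \<omega> y vs + hodge g vol (\<theta> \<and>\<^sub>f \<omega>) y vs" for vs
  have "(\<theta> \<and>\<^sub>f \<omega>) y vs = 0" if "length vs \<noteq> 4" for vs
    by (rule wedge_degree[where p = 1 and q = 3]) (use alternating_form_zero[OF \<theta>_alt[OF y]] alternating_form_zero[OF \<omega>_alt[OF y]] that in auto)
  then have alt3: "alternating_form 3 (hodge g vol (\<theta> \<and>\<^sub>f \<omega>) y)"
    using F.hodge_alternating[of 4 "\<theta> \<and>\<^sub>f \<omega>"] by simp
  have "R = (\<lambda>vs. (-1) * hodge g vol (ext_deriv \<omega>) y vs + (1/6 * ?al * \<omega> y vs + hodge g vol (\<theta> \<and>\<^sub>f \<omega>) y vs))"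
    by (simp add: R_def fun_eq_iff)
  then have R_alt: "alternating_form 3 R"
    using alternating_form_lincomb[OF star_d\<omega>_alt[OF y] alternating_form_lincomb[OF \<omega>_alt[OF y] alt3, of "1/6 * ?al"], of "-1"]
    by simp
  have tm: "multilinear 3 (torsion g Gam y)"
    unfolding multilinear_def
  proof (intro allI impI)
    fix vs :: "vec7 list" and i :: nat assume h: "length vs = 3 \<and> i < 3"
    then obtain u v w where vs: "vs = [u, v, w]" by (auto simp: length_Suc_conv numeral_3_eq_3)
    from h consider "i = 0" | "i = 1" | "i = 2" by linarith
    then show "linear (\<lambda>z. torsion g Gam y (vs[i := z]))"
      by cases (simp_all add: vs torsion_Gam[OF y] Tf_linear[OF y])
  qed
  have frame_eq: "torsion g Gam y [E y b, E y c, E y d] = R [E y b, E y c, E y d]" for b c d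
    unfolding torsion_Gam[OF y] Tf_E[OF y] R_def star_d\<omega>[OF y] star_\<theta>\<omega>[OF y] \<omega>_frame[OF y] al_frame[OF y]
    by (simp add: T3_def G.T_def)
  have eq: "torsion g Gam y vs = R vs" for vs
  proof (cases "length vs = 3")
    case True
    show ?thesis
    proof (rule F.multilinear_ext[OF tm alternating_form_multilinear[OF R_alt] _ True])
      show "torsion g Gam y (map (E y) is) = R (map (E y) is)" if "length is = 3" for "is"
        using that frame_eq by (auto simp: length_Suc_conv numeral_3_eq_3)
    qed
  next
    case False
    then show ?thesis using alternating_form_zero[OF R_alt] by (simp add: torsion_def)
  qed
  then show "torsion g Gam y vs = - hodge g vol (ext_deriv \<omega>) y vs + 1/6 * ?al * \<omega> y vs
      + hodge g vol (\<theta> \<and>\<^sub>f \<omega>) y vs" by (simp add: R_def)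
  have "torsion g Gam y = R" using eq by blast
  then show "alternating_form 3 (torsion g Gam y)" using R_alt by simp
qed

text \<open>Since \<open>\<omega>\<close> is parallel for \<open>W\<close>, its derivative may be replaced by the action of \<open>W\<close>.\<close>
lemma parallel_form_iff:
  assumes y: "y \<in> S"
  shows "parallel_form_at \<omega> \<Gamma> y \<longleftrightarrow> (\<forall>u vs. length vs = 3 \<longrightarrow> act (\<Gamma> y u) (\<omega> y) vs = act (W y u) (\<omega> y) vs)"
proof -
  have 3: "frechet_derivative (\<lambda>z. \<omega> z vs) (at y) u = act (W y u) (\<omega> y) vs" if "length vs = 3" for u vs
    using frechet_derivative_at[OF \<omega>_derivative[OF y that]] by metis
  have n3: "frechet_derivative (\<lambda>z. \<omega> z vs) (at y) u = 0" "(\<Sum>i<length vs. \<omega> y (vs[i := \<Gamma> y u (vs ! i)])) = 0" if "length vs \<noteq> 3" for u vs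
  proof -
    have "frechet_derivative (\<lambda>z. \<omega> z vs) (at y) = frechet_derivative (\<lambda>z. 0) (at y)"
      by (rule frechet_derivative_cong_open[OF S y]) (simp add: alternating_form_zero[OF \<omega>_alt that])
    then show "frechet_derivative (\<lambda>z. \<omega> z vs) (at y) u = 0" by simp
    show "(\<Sum>i<length vs. \<omega> y (vs[i := \<Gamma> y u (vs ! i)])) = 0"
      by (intro sum.neutral ballI alternating_form_zero[OF \<omega>_alt[OF y]]) (use that in simp)
  qed
  have "frechet_derivative (\<lambda>z. \<omega> z vs) (at y) u - (\<Sum>i<length vs. \<omega> y (vs[i := \<Gamma> y u (vs ! i)])) = 0
     \<longleftrightarrow> (length vs = 3 \<longrightarrow> act (\<Gamma> y u) (\<omega> y) vs = act (W y u) (\<omega> y) vs)" for u vs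
  proof (cases "length vs = 3")
    case True
    then show ?thesis using 3[OF True, of u] unfolding act_def[of "\<Gamma> y u"] by auto
  qed (simp add: n3)
  then show ?thesis unfolding parallel_form_at_def by simp
qed

lemma Gam_characteristic:
  assumes y: "y \<in> S" "integrable_at y"
  shows "parallel_metric_at g Gam y" "parallel_form_at \<omega> Gam y"
  unfolding parallel_form_iff[OF y(1)] parallel_metric_at_def frechet_g[OF y(1)]
  using Gam_metric[OF y(1)] Gam_parallel[OF y] by simp_all

lemma characteristic_unique:
  assumes y: "y \<in> S"
    and 1: "bilinear (\<Gamma> y)" "parallel_metric_at g \<Gamma> y" "parallel_form_at \<omega> \<Gamma> y" "alternating_form 3 (torsion g \<Gamma> y)"
    and 2: "bilinear (\<Gamma>' y)" "parallel_metric_at g \<Gamma>' y" "parallel_form_at \<omega> \<Gamma>' y" "alternating_form 3 (torsion g \<Gamma>' y)"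
  shows "\<Gamma> y u v = \<Gamma>' y u v"
proof -
  interpret F: frame_at g y vol "E y" by (rule frame[OF y])
  have t: "g y (\<Gamma> y u v - \<Gamma> y v u) w = - g y (\<Gamma> y u w - \<Gamma> y w u) v" if "alternating_form 3 (torsion g \<Gamma> y)" for \<Gamma> u v w
    using alternating_form_swap[OF that, of "[u]" v w "[]"] by (simp add: torsion_def)
  show ?thesis
  proof (rule F.G2_connection_unique[where \<omega> = \<omega>, OF \<omega>_alt[OF y] \<omega>_frame[OF y] 1(1) 2(1)])
    fix u v w
    show "g y (\<Gamma> y u v) w + g y v (\<Gamma> y u w) = g y (\<Gamma>' y u v) w + g y v (\<Gamma>' y u w)"
      using 1(2)[unfolded parallel_metric_at_def, rule_format, of v w u] 2(2)[unfolded parallel_metric_at_def, rule_format, of v w u]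
      by linarith
    show "act (\<Gamma> y u) (\<omega> y) vs = act (\<Gamma>' y u) (\<omega> y) vs" if "length vs = 3" for vs
      using 1(3) 2(3) that unfolding parallel_form_iff[OF y] by simp
  qed (use t 1(4) 2(4) in blast)+
qed

lemma smooth_W_field: "smooth_on S X \<Longrightarrow> smooth_on S Y \<Longrightarrow> smooth_on S (\<lambda>y. W y (X y) (Y y))"
  by (rule smooth_on_bilinear_field[OF S bilinear_W smooth_W])

lemma smooth_dg_field: "smooth_on S X \<Longrightarrow> smooth_on S Y \<Longrightarrow> smooth_on S Z \<Longrightarrow> smooth_on S (\<lambda>y. dg y (X y) (Y y) (Z y))"
  unfolding dg_def by (intro smooth_on_add smooth_g_field smooth_W_field S)

lemma smooth_half: "smooth_on S h \<Longrightarrow> smooth_on S (\<lambda>y. h y / 2 :: real)"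
  using smooth_on_mult[OF S _ smooth_on_const[OF S], of h "1/2"] by simp

lemma smooth_L: "smooth_on S (\<lambda>y. L y u v)"
proof -
  have "smooth_on S (\<lambda>y. \<Sum>i\<in>UNIV. ((dg y u v (E y i) + dg y v u (E y i) - dg y (E y i) u v) / 2) *\<^sub>R E y i)"
    by (intro smooth_on_sum smooth_on_scaleR smooth_half smooth_on_diff smooth_on_add smooth_dg_field smooth_on_const smooth_E S)
  moreover have "L y u v = (\<Sum>i\<in>UNIV. ((dg y u v (E y i) + dg y v u (E y i) - dg y (E y i) u v) / 2) *\<^sub>R E y i)" if "y \<in> S" for y
    by (rule levi_civita_frame(1)[OF that frame_at.E_orthonormal[OF frame[OF that]]])
  ultimately show ?thesis using smooth_on_cong[OF S, of "\<lambda>y. L y u v"] by simp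
qed

lemma smooth_a: "smooth_on S (\<lambda>y. a y i j k)"
  unfolding a_def A_def
  by (intro smooth_g_field smooth_on_diff smooth_on_bilinear_field[OF S bilinear_L smooth_L] smooth_W_field smooth_E S)

lemma smooth_sd: "smooth_on S (\<lambda>y. g2_first_order.sd (a y) b c d)"
proof -
  have "smooth_on S (\<lambda>y. \<Sigma> i. act4 (a y i) psi i b c d)"
    unfolding act4_def by (intro smooth_on_sum smooth_on_add smooth_on_mult smooth_on_const smooth_a S)
  then show ?thesis
    using smooth_on_cong[OF S, of "\<lambda>y. g2_first_order.sd (a y) b c d" "\<lambda>y. \<Sigma> i. act4 (a y i) psi i b c d"] g2_first_order.sd_def[OF first_order] by simp
qed

lemma smooth_th: "smooth_on S (\<lambda>y. th y i)"
proof -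
  have "smooth_on S (\<lambda>y. (\<Sigma> j. \<Sigma> k. \<Sigma> l. g2_first_order.sd (a y) j k l * psi j k l i) * (1 / 18))"
    by (intro smooth_on_sum smooth_on_mult smooth_on_const smooth_sd S)
  then show ?thesis
    using smooth_on_cong[OF S, of "\<lambda>y. th y i" "\<lambda>y. (\<Sigma> j. \<Sigma> k. \<Sigma> l. g2_first_order.sd (a y) j k l * psi j k l i) * (1 / 18)"] lee_frame by simp
qed

lemma smooth_T3: "smooth_on S (\<lambda>y. T3 y b c d)"
proof -
  have "smooth_on S (\<lambda>y. - g2_first_order.sd (a y) b c d + ((\<Sigma> i. \<Sigma> j. \<Sigma> k. phi i j k * g2_first_order.sd (a y) i j k) * (1/36)) * phi b c d
      - (\<Sigma> i. th y i * psi i b c d))"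
    by (intro smooth_on_sum smooth_on_add smooth_on_diff smooth_on_minus smooth_on_mult smooth_on_const smooth_sd smooth_th S)
  moreover have "T3 y b c d = - g2_first_order.sd (a y) b c d + ((\<Sigma> i. \<Sigma> j. \<Sigma> k. phi i j k * g2_first_order.sd (a y) i j k) * (1/36)) * phi b c d
      - (\<Sigma> i. th y i * psi i b c d)" if "y \<in> S" for y
    unfolding T3_def g2_first_order.T_def[OF first_order[OF that]] g2_first_order.al_def[OF first_order[OF that]] by simp
  ultimately show ?thesis using smooth_on_cong[OF S, of "\<lambda>y. T3 y b c d"] by simp
qed

lemma smooth_Tf_field: "smooth_on S X \<Longrightarrow> smooth_on S Y \<Longrightarrow> smooth_on S Z \<Longrightarrow> smooth_on S (\<lambda>y. Tf y (X y) (Y y) (Z y))"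
  unfolding Tf_def by (intro smooth_on_sum smooth_on_mult smooth_T3 smooth_e_field S)

lemma smooth_Gam: "smooth_on S (\<lambda>y. Gam y u v)"
  unfolding Gam_def
  by (intro smooth_on_add smooth_on_sum smooth_on_scaleR smooth_half smooth_L smooth_Tf_field smooth_on_const smooth_E S)

end

section \<open>Curvature of the characteristic connection\<close>

lemma sum_swap14: "(\<Sigma> i. \<Sigma> j. \<Sigma> k. \<Sigma> l. f i j k l) = (\<Sigma> i. \<Sigma> j. \<Sigma> k. \<Sigma> l. f l j k i)"
proof -
  have "(\<Sigma> i. \<Sigma> j. \<Sigma> k. \<Sigma> l. f i j k l) = (\<Sigma> j. \<Sigma> k. \<Sigma> i. \<Sigma> l. f i j k l)" by (rule sum_rot3)
  also have "\<dots> = (\<Sigma> j. \<Sigma> k. \<Sigma> l. \<Sigma> i. f i j k l)" by (intro sum.cong refl sum.swap)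
  also have "\<dots> = (\<Sigma> l. \<Sigma> j. \<Sigma> k. \<Sigma> i. f i j k l)" by (rule sum_rot3[symmetric])
  finally show ?thesis .
qed

text \<open>Contraction with \<open>psi\<close> is invariant under cyclic rotation of the first three arguments.\<close>
lemma psi_cyclic_contraction:
  "(\<Sigma> i. \<Sigma> j. \<Sigma> k. \<Sigma> l. psi i j k l * F j k i l) = (\<Sigma> i. \<Sigma> j. \<Sigma> k. \<Sigma> l. psi i j k l * F i j k l)"
proof -
  have "(\<Sigma> i. \<Sigma> j. \<Sigma> k. \<Sigma> l. psi i j k l * F j k i l) = (\<Sigma> i. \<Sigma> j. \<Sigma> k. \<Sigma> l. psi j k i l * F j k i l)"
  proof (intro sum.cong refl)
    fix i j k l show "psi i j k l * F j k i l = psi j k i l * F j k i l" using psi_cyc3(1)[of i j k l] by simp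
  qed
  also have "\<dots> = (\<Sigma> j. \<Sigma> k. \<Sigma> i. \<Sigma> l. psi j k i l * F j k i l)" by (rule sum_rot3)
  finally show ?thesis .
qed

text \<open>For two three-forms the action on any of the three slots contributes the same.\<close>
lemma skew_contraction3:
  fixes F T :: "7 \<Rightarrow> 7 \<Rightarrow> 7 \<Rightarrow> real"
  assumes F: "\<And>j k l. F k j l = - F j k l" "\<And>j k l. F j l k = - F j k l"
    and T: "\<And>j k l. T k j l = - T j k l" "\<And>j k l. T j l k = - T j k l"
  shows "(\<Sigma> j. \<Sigma> k. \<Sigma> l. F j k l * (\<Sigma> m. w j m * T m k l + w k m * T j m l + w l m * T j k m))
    = 3 * (\<Sigma> j. \<Sigma> k. \<Sigma> l. \<Sigma> m. F j k l * (w j m * T m k l))"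
proof -
  define X where "X j k l = (\<Sigma> m. F j k l * (w j m * T m k l))" for j k l
  have 2: "(\<Sigma> m. F j k l * (w k m * T j m l)) = X k j l" for j k l
    unfolding X_def
  proof (rule sum.cong[OF refl])
    fix m show "F j k l * (w k m * T j m l) = F k j l * (w k m * T m j l)" using F(1)[of k j l] T(1)[of j m l] by simp
  qed
  have 3: "(\<Sigma> m. F j k l * (w l m * T j k m)) = X l j k" for j k l
    unfolding X_def
  proof (rule sum.cong[OF refl])
    fix m
    have "F j k l = F l j k" "T j k m = T m j k" using skew3_rules(2)[of F, OF F] skew3_rules(2)[of T, OF T] by (metis, metis)
    then show "F j k l * (w l m * T j k m) = F l j k * (w l m * T m j k)" by simp
  qed
  have "(\<Sigma> j. \<Sigma> k. \<Sigma> l. F j k l * (\<Sigma> m. w j m * T m k l + w k m * T j m l + w l m * T j k m))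
     = (\<Sigma> j. \<Sigma> k. \<Sigma> l. X j k l) + (\<Sigma> j. \<Sigma> k. \<Sigma> l. X k j l) + (\<Sigma> j. \<Sigma> k. \<Sigma> l. X l j k)"
    unfolding sum_distrib_left distrib_left sum.distrib 2 3 by (simp only: X_def[abs_def])
  also have "(\<Sigma> j. \<Sigma> k. \<Sigma> l. X k j l) = (\<Sigma> j. \<Sigma> k. \<Sigma> l. X j k l)" by (rule sum.swap)
  also have "(\<Sigma> j. \<Sigma> k. \<Sigma> l. X l j k) = (\<Sigma> j. \<Sigma> k. \<Sigma> l. X j k l)" by (rule sum_rot3[symmetric])
  finally show ?thesis by (simp add: X_def)
qed

text \<open>Up to a factor, the pairing of \<open>*\<omega>\<close> with the four-form obtained by summing over \<open>m\<close> the wedge squares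
  of the two-forms \<open>T(-, -, E\<^sub>m)\<close>.\<close>
definition qform :: "(7 \<Rightarrow> 7 \<Rightarrow> 7 \<Rightarrow> real) \<Rightarrow> real" where
  "qform T = (\<Sigma> i. \<Sigma> j. \<Sigma> k. \<Sigma> l. psi i j k l * (\<Sigma> m. T i j m * T k l m))"

text \<open>The three cyclic terms of the Bianchi identity contribute equally. Here \<open>t\<close> is the derivative of \<open>T\<close> for
  constant arguments, \<open>c\<close> are the connection coefficients, and only the part of \<open>c\<close> that is skew in its
  first two arguments survives, which is \<open>T\<close> again.\<close>
lemma bianchi_contraction:
  fixes r t :: "7 \<Rightarrow> 7 \<Rightarrow> 7 \<Rightarrow> 7 \<Rightarrow> real" and c T :: "7 \<Rightarrow> 7 \<Rightarrow> 7 \<Rightarrow> real"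
  assumes bianchi: "\<And>i j k l. r i j k l + r j k i l + r k i j l = (t i j k l - (\<Sigma> m. c i l m * T j k m))
      + (t j k i l - (\<Sigma> m. c j l m * T k i m)) + (t k i j l - (\<Sigma> m. c k l m * T i j m))"
    and c: "\<And>i j m. c i j m - c j i m = T i j m"
  shows "(\<Sigma> i. \<Sigma> j. \<Sigma> k. \<Sigma> l. psi i j k l * r i j k l) = (\<Sigma> i. \<Sigma> j. \<Sigma> k. \<Sigma> l. psi i j k l * t i j k l) - qform T / 2"
proof -
  define N where "N i j k l = t i j k l - (\<Sigma> m. c i l m * T j k m)" for i j k l
  have cyc2: "(\<Sigma> i. \<Sigma> j. \<Sigma> k. \<Sigma> l. psi i j k l * F k i j l) = (\<Sigma> i. \<Sigma> j. \<Sigma> k. \<Sigma> l. psi i j k l * F i j k l)" for F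
    using psi_cyclic_contraction[of "\<lambda>i j k l. F k i j l"] by simp
  have "(\<Sigma> i. \<Sigma> j. \<Sigma> k. \<Sigma> l. psi i j k l * (r i j k l + r j k i l + r k i j l))
     = (\<Sigma> i. \<Sigma> j. \<Sigma> k. \<Sigma> l. psi i j k l * (N i j k l + N j k i l + N k i j l))"
    unfolding bianchi N_def ..
  then have "3 * (\<Sigma> i. \<Sigma> j. \<Sigma> k. \<Sigma> l. psi i j k l * r i j k l) = 3 * (\<Sigma> i. \<Sigma> j. \<Sigma> k. \<Sigma> l. psi i j k l * N i j k l)"
    unfolding distrib_left sum.distrib psi_cyclic_contraction[of r] psi_cyclic_contraction[of N] cyc2[of r] cyc2[of N] by simp
  moreover have "(\<Sigma> i. \<Sigma> j. \<Sigma> k. \<Sigma> l. psi i j k l * N i j k l) = (\<Sigma> i. \<Sigma> j. \<Sigma> k. \<Sigma> l. psi i j k l * t i j k l)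
      - (\<Sigma> i. \<Sigma> j. \<Sigma> k. \<Sigma> l. psi i j k l * (\<Sigma> m. c i l m * T j k m))"
    unfolding N_def by (simp only: right_diff_distrib sum_subtractf)
  moreover have "2 * (\<Sigma> i. \<Sigma> j. \<Sigma> k. \<Sigma> l. psi i j k l * (\<Sigma> m. c i l m * T j k m)) = qform T"
  proof -
    let ?P = "\<lambda>c. (\<Sigma> i. \<Sigma> j. \<Sigma> k. \<Sigma> l. psi i j k l * (\<Sigma> m. c i l m * T j k m))"
    have "?P c = (\<Sigma> i. \<Sigma> j. \<Sigma> k. \<Sigma> l. psi l j k i * (\<Sigma> m. c l i m * T j k m))" by (rule sum_swap14)
    also have "\<dots> = - ?P (\<lambda>i l. c l i)"
      unfolding sum_negf[symmetric]
    proof (intro sum.cong refl)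
      fix i j k l
      have "psi l j k i = - psi i j k l" by (metis psi_cyc3(2) psi_cyc4 psi_skew12 psi_skew23 psi_skew34 minus_minus)
      then show "psi l j k i * (\<Sigma> m. c l i m * T j k m) = - (psi i j k l * (\<Sigma> m. c l i m * T j k m))" by simp
    qed
    finally have "2 * ?P c = ?P c - ?P (\<lambda>i l. c l i)" by simp
    also have "\<dots> = (\<Sigma> i. \<Sigma> j. \<Sigma> k. \<Sigma> l. psi i j k l * (\<Sigma> m. T i l m * T j k m))"
      unfolding c[symmetric] by (simp only: left_diff_distrib sum_subtractf right_diff_distrib)
    also have "\<dots> = qform T"
      using psi_cyclic_contraction[of "\<lambda>i j k l. (\<Sigma> m. T k l m * T i j m)"] unfolding qform_def by (simp add: mult.commute)
    finally show ?thesis .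
  qed
  ultimately show ?thesis by simp
qed

text \<open>The derivative of \<open>T\<close> in coordinates is the derivative \<open>dT\<close> of its components corrected by
  the frame connection \<open>c - b\<close>. The part with \<open>b\<close> is moved onto \<open>psi\<close>, which \<open>b\<close> annihilates; what remains
  of it is the connection term of the divergence of \<open>th\<close>. The part with \<open>c\<close> is again quadratic in \<open>T\<close>.\<close>
lemma divergence_contraction:
  fixes t dT :: "7 \<Rightarrow> 7 \<Rightarrow> 7 \<Rightarrow> 7 \<Rightarrow> real" and b c T :: "7 \<Rightarrow> 7 \<Rightarrow> 7 \<Rightarrow> real"
  assumes T: "\<And>j k l. T k j l = - T j k l" "\<And>j k l. T j l k = - T j k l"
    and t: "\<And>i j k l. t i j k l = dT i j k l + (\<Sigma> m. (c i j m - b i j m) * T m k l + (c i k m - b i k m) * T j m l + (c i l m - b i l m) * T j k m)"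
    and c: "\<And>i j m. c i j m - c j i m = T i j m"
    and b: "\<And>i j k. b i k j = - b i j k" "\<And>i p j k l. act4 (b i) psi p j k l = 0"
    and th: "\<And>i. (\<Sigma> j. \<Sigma> k. \<Sigma> l. psi i j k l * T j k l) = - 6 * th i"
    and dth: "\<And>i p. (\<Sigma> j. \<Sigma> k. \<Sigma> l. psi i j k l * dT p j k l) = - 6 * dth p i"
  shows "(\<Sigma> i. \<Sigma> j. \<Sigma> k. \<Sigma> l. psi i j k l * t i j k l) = - 6 * (\<Sigma> i. dth i i - (\<Sigma> m. b i i m * th m)) + 3/2 * qform T"
proof -
  note psk = psi_skew23 psi_skew34
  define Q where "Q w i = (\<Sigma> j. \<Sigma> k. \<Sigma> l. \<Sigma> m. psi i j k l * (w i j m * T m k l))" for w :: "7 \<Rightarrow> 7 \<Rightarrow> 7 \<Rightarrow> real" and i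
  have one: "(\<Sigma> j. \<Sigma> k. \<Sigma> l. psi i j k l * t i j k l) = - 6 * dth i i + 3 * (Q c i - Q b i)" for i
  proof -
    have "(\<Sigma> j. \<Sigma> k. \<Sigma> l. psi i j k l * t i j k l) = (\<Sigma> j. \<Sigma> k. \<Sigma> l. psi i j k l * dT i j k l)
       + (\<Sigma> j. \<Sigma> k. \<Sigma> l. psi i j k l * (\<Sigma> m. (c i j m - b i j m) * T m k l + (c i k m - b i k m) * T j m l + (c i l m - b i l m) * T j k m))"
      unfolding t by (simp only: distrib_left sum.distrib)
    also have "\<dots> = - 6 * dth i i + 3 * Q (\<lambda>i j m. c i j m - b i j m) i"
      unfolding dth Q_def using skew_contraction3[of "psi i" T "\<lambda>j m. c i j m - b i j m", OF psk T] by simp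
    finally show ?thesis
      unfolding Q_def by (simp only: left_diff_distrib right_diff_distrib sum_subtractf)
  qed
  \<comment> \<open>The action of \<open>b i\<close> on \<open>psi\<close> vanishes; of its four slots the first yields the
    divergence term and the other three yield \<open>Q b\<close>.\<close>
  have Qb: "3 * Q b i = - 6 * (\<Sigma> m. b i i m * th m)" for i
  proof -
    have "0 = (\<Sigma> j. \<Sigma> k. \<Sigma> l. T j k l * act4 (b i) psi i j k l)" by (simp add: b(2))
    also have "\<dots> = (\<Sigma> j. \<Sigma> k. \<Sigma> l. T j k l * (\<Sigma> m. b i i m * psi m j k l))
       + (\<Sigma> j. \<Sigma> k. \<Sigma> l. T j k l * (\<Sigma> m. b i j m * psi i m k l + b i k m * psi i j m l + b i l m * psi i j k m))"
      unfolding act4_def by (simp add: sum.distrib distrib_left)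
    also have "(\<Sigma> j. \<Sigma> k. \<Sigma> l. T j k l * (\<Sigma> m. b i i m * psi m j k l)) = - 6 * (\<Sigma> m. b i i m * th m)"
    proof -
      have "(\<Sigma> j. \<Sigma> k. \<Sigma> l. T j k l * (\<Sigma> m. b i i m * psi m j k l)) = (\<Sigma> j. \<Sigma> m. \<Sigma> k. \<Sigma> l. b i i m * (psi m j k l * T j k l))"
        unfolding sum_distrib_left by (subst sum_rot3[symmetric]) (simp add: mult_ac)
      also have "\<dots> = (\<Sigma> m. b i i m * (\<Sigma> j. \<Sigma> k. \<Sigma> l. psi m j k l * T j k l))"
        unfolding sum_distrib_left by (rule sum.swap)
      finally show ?thesis unfolding th by (simp add: sum_distrib_left mult_ac sum_negf)
    qed
    also have "(\<Sigma> j. \<Sigma> k. \<Sigma> l. T j k l * (\<Sigma> m. b i j m * psi i m k l + b i k m * psi i j m l + b i l m * psi i j k m))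
        = 3 * (\<Sigma> j. \<Sigma> k. \<Sigma> l. \<Sigma> m. T j k l * (b i j m * psi i m k l))"
      by (rule skew_contraction3[of T "psi i" "b i", OF T psk])
    also have "(\<Sigma> j. \<Sigma> k. \<Sigma> l. \<Sigma> m. T j k l * (b i j m * psi i m k l)) = - Q b i"
    proof -
      have "(\<Sigma> j. \<Sigma> k. \<Sigma> l. \<Sigma> m. T j k l * (b i j m * psi i m k l)) = (\<Sigma> j. \<Sigma> k. \<Sigma> l. \<Sigma> m. T m k l * (b i m j * psi i j k l))"
        by (rule sum_swap14)
      also have "\<dots> = - Q b i"
        unfolding Q_def sum_negf[symmetric]
      proof (intro sum.cong refl)
        fix j k l m show "T m k l * (b i m j * psi i j k l) = - (psi i j k l * (b i j m * T m k l))" using b(1)[of i m j] by simp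
      qed
      finally show ?thesis .
    qed
    finally show ?thesis by simp
  qed
  \<comment> \<open>Skewness of \<open>psi\<close> in \<open>i, j\<close> leaves half of \<open>c i j m - c j i m = T i j m\<close>.\<close>
  have Qc: "(\<Sigma> i. Q c i) = qform T / 2"
  proof -
    let ?Q = "\<lambda>c. (\<Sigma> i. \<Sigma> j. \<Sigma> k. \<Sigma> l. \<Sigma> m. psi i j k l * (c i j m * T m k l))"
    have "?Q c = (\<Sigma> i. \<Sigma> j. \<Sigma> k. \<Sigma> l. \<Sigma> m. psi j i k l * (c j i m * T m k l))" by (rule sum.swap)
    also have "\<dots> = - ?Q (\<lambda>i j. c j i)"
      unfolding sum_negf[symmetric]
    proof (intro sum.cong refl)
      fix i j k l m show "psi j i k l * (c j i m * T m k l) = - (psi i j k l * (c j i m * T m k l))" by (simp add: psi_skew12[of j i])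
    qed
    finally have "2 * ?Q c = ?Q c - ?Q (\<lambda>i j. c j i)" by simp
    also have "\<dots> = (\<Sigma> i. \<Sigma> j. \<Sigma> k. \<Sigma> l. \<Sigma> m. psi i j k l * (T i j m * T m k l))"
      unfolding c[symmetric, of _ _ _] by (simp only: left_diff_distrib right_diff_distrib sum_subtractf)
    also have "\<dots> = qform T"
      unfolding qform_def sum_distrib_left
    proof (intro sum.cong refl)
      fix i j k l m
      have "T m k l = T k l m" using skew3_rules(1)[of T, OF T] by metis
      then show "psi i j k l * (T i j m * T m k l) = psi i j k l * (T i j m * T k l m)" by simp
    qed
    finally show ?thesis by (simp add: Q_def)
  qed
  have "(\<Sigma> i. \<Sigma> j. \<Sigma> k. \<Sigma> l. psi i j k l * t i j k l) = (\<Sigma> i. - 6 * (dth i i - (\<Sigma> m. b i i m * th m)) + 3 * Q c i)"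
    unfolding one using Qb by (intro sum.cong refl) (simp add: algebra_simps)
  then show ?thesis
    using Qc by (simp only: sum.distrib sum_distrib_left[symmetric])
qed

lemma qform_norm:
  assumes T: "\<And>j k l. T k j l = - T j k l" "\<And>j k l. T j l k = - T j k l"
  shows "(\<Sigma> a. \<Sigma> b. \<Sigma> c. T a b c * (\<Sigma> i. \<Sigma> m. T i a m * psi i m b c)) = - qform T"
proof -
  have inner: "(\<Sigma> b. \<Sigma> c. \<Sigma> i. \<Sigma> m. f b c i m) = (\<Sigma> i. \<Sigma> m. \<Sigma> b. \<Sigma> c. f b c i m)" for f :: "7 \<Rightarrow> 7 \<Rightarrow> 7 \<Rightarrow> 7 \<Rightarrow> real"
  proof -
    have "(\<Sigma> b. \<Sigma> c. \<Sigma> i. \<Sigma> m. f b c i m) = (\<Sigma> b. \<Sigma> i. \<Sigma> m. \<Sigma> c. f b c i m)"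
      by (intro sum.cong refl sum_rot3)
    also have "\<dots> = (\<Sigma> i. \<Sigma> m. \<Sigma> b. \<Sigma> c. f b c i m)" by (rule sum_rot3)
    finally show ?thesis .
  qed
  have "(\<Sigma> a. \<Sigma> b. \<Sigma> c. T a b c * (\<Sigma> i. \<Sigma> m. T i a m * psi i m b c))
     = (\<Sigma> a. \<Sigma> i. \<Sigma> m. \<Sigma> b. \<Sigma> c. T a b c * (T i a m * psi i m b c))"
    unfolding sum_distrib_left by (intro sum.cong refl inner)
  also have "\<dots> = (\<Sigma> i. \<Sigma> m. \<Sigma> a. \<Sigma> b. \<Sigma> c. T a b c * (T i a m * psi i m b c))" by (rule sum_rot3)
  also have "\<dots> = (\<Sigma> i. \<Sigma> m. \<Sigma> b. \<Sigma> c. \<Sigma> a. T a b c * (T i a m * psi i m b c))" by (intro sum.cong refl sum_rot3)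
  also have "\<dots> = - qform T"
    unfolding qform_def sum_distrib_left sum_negf[symmetric]
  proof (intro sum.cong refl)
    fix i m b c a
    have "T a b c = T b c a" "T i a m = - T i m a" using skew3_rules(1)[of T, OF T] T(2) by metis+
    then show "T a b c * (T i a m * psi i m b c) = - (psi i m b c * (T i m a * T b c a))" by simp
  qed
  finally show ?thesis .
qed

text \<open>Differentiating a family of linear maps in the parameter gives a linear map again.\<close>
lemma has_derivative_linear_arg:
  fixes f :: "'a::real_normed_vector \<Rightarrow> 'c::real_vector \<Rightarrow> 'b::real_normed_vector"
  assumes "open S" "y \<in> S" and lin: "\<And>z. z \<in> S \<Longrightarrow> linear (f z)"
    and D: "\<And>v. ((\<lambda>z. f z v) has_derivative (\<lambda>u. D u v)) (at y)"
  shows "linear (D u)"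
proof (rule linearI)
  fix v w c
  have "((\<lambda>z. f z v + f z w) has_derivative (\<lambda>u. D u v + D u w)) (at y)"
    by (intro has_derivative_add D)
  then have "((\<lambda>z. f z (v + w)) has_derivative (\<lambda>u. D u v + D u w)) (at y)"
    using has_derivative_cong_open[OF assms(1,2), of "\<lambda>z. f z (v + w)" "\<lambda>z. f z v + f z w"] linear_add[OF lin] by simp
  from fun_cong[OF has_derivative_unique[OF D this], of u] show "D u (v + w) = D u v + D u w" .
  have "((\<lambda>z. c *\<^sub>R f z v) has_derivative (\<lambda>u. c *\<^sub>R D u v)) (at y)"
    by (intro has_derivative_scaleR_right D)
  then have "((\<lambda>z. f z (c *\<^sub>R v)) has_derivative (\<lambda>u. c *\<^sub>R D u v)) (at y)"
    using has_derivative_cong_open[OF assms(1,2), of "\<lambda>z. f z (c *\<^sub>R v)" "\<lambda>z. c *\<^sub>R f z v"] linear_cmul[OF lin] by simp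
  from fun_cong[OF has_derivative_unique[OF D this], of u] show "D u (c *\<^sub>R v) = c *\<^sub>R D u v" .
qed

context adapted_chart
begin

text \<open>The map \<open>\<tau>\<close> allows the same computation to serve for fields in one chart (\<open>\<tau>\<close> the identity) and for
  tensors pulled back along a transition map.\<close>
lemma e_pullback_derivative:
  assumes U: "open U" "x \<in> U" "\<And>z. z \<in> U \<Longrightarrow> \<tau> z \<in> S" and \<tau>: "(\<tau> has_derivative D) (at x)"
    and X: "(X has_derivative DX) (at x)"
  shows "((\<lambda>z. e i (\<tau> z) [X z]) has_derivative (\<lambda>u. e i (\<tau> x) [W (\<tau> x) (D u) (X x) + DX u])) (at x)"
proof -
  note y = U(3)[OF U(2)]
  have exp: "e i z [v] = (\<Sigma> k. v $ k * e i z [axis k 1])" if "z \<in> S" for z v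
    using linear_axis_expand[OF e_linear[OF that], of i v] by (simp only: real_scaleR_def)
  have "((\<lambda>z. \<Sigma> k. X z $ k * e i (\<tau> z) [axis k 1]) has_derivative
     (\<lambda>u. \<Sigma> k. X x $ k * de i (\<tau> x) (D u) (axis k 1) + DX u $ k * e i (\<tau> x) [axis k 1])) (at x)"
    by (intro has_derivative_sum has_derivative_mult has_derivative_compose[OF \<tau> de[OF y]] bounded_linear.has_derivative[OF bounded_linear_vec_nth] X)
  moreover have "(\<Sigma> k. X x $ k * de i (\<tau> x) (D u) (axis k 1) + DX u $ k * e i (\<tau> x) [axis k 1]) = e i (\<tau> x) [W (\<tau> x) (D u) (X x) + DX u]" for u
  proof -
    have "linear (de i (\<tau> x) (D u))" using bilinear_de[OF y] by (simp add: bilinear_def)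
    from linear_axis_expand[OF this, of "X x"] exp[OF y, of "DX u"]
    show ?thesis by (simp add: sum.distrib linear_add[OF e_linear[OF y]] e_W[OF y])
  qed
  ultimately show ?thesis
    using has_derivative_cong_open[OF U(1,2), of "\<lambda>z. e i (\<tau> z) [X z]" "\<lambda>z. \<Sigma> k. X z $ k * e i (\<tau> z) [axis k 1]"] exp U(3) by simp
qed

lemma g_pullback_derivative:
  assumes U: "open U" "x \<in> U" "\<And>z. z \<in> U \<Longrightarrow> \<tau> z \<in> S" and \<tau>: "(\<tau> has_derivative D) (at x)"
    and X: "(X has_derivative DX) (at x)" and Y: "(Y has_derivative DY) (at x)"
  shows "((\<lambda>z. g (\<tau> z) (X z) (Y z)) has_derivative
    (\<lambda>u. g (\<tau> x) (W (\<tau> x) (D u) (X x) + DX u) (Y x) + g (\<tau> x) (X x) (W (\<tau> x) (D u) (Y x) + DY u))) (at x)"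
proof -
  have "((\<lambda>z. \<Sigma> i. e i (\<tau> z) [X z] * e i (\<tau> z) [Y z]) has_derivative
     (\<lambda>u. \<Sigma> i. e i (\<tau> x) [X x] * e i (\<tau> x) [W (\<tau> x) (D u) (Y x) + DY u] + e i (\<tau> x) [W (\<tau> x) (D u) (X x) + DX u] * e i (\<tau> x) [Y x])) (at x)"
    by (intro has_derivative_sum has_derivative_mult e_pullback_derivative[OF U \<tau>] X Y)
  then show ?thesis
    using has_derivative_cong_open[OF U(1,2), of "\<lambda>z. g (\<tau> z) (X z) (Y z)" "\<lambda>z. \<Sigma> i. e i (\<tau> z) [X z] * e i (\<tau> z) [Y z]"]
    by (simp add: g_e U(2,3) sum.distrib add.commute)
qed

lemma \<omega>_expand: assumes z: "z \<in> S"
  shows "\<omega> z [u, v, w] = (\<Sigma> i. \<Sigma> j. \<Sigma> k. e i z [u] * (e j z [v] * (e k z [w] * phi i j k)))"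
  using multilinear_expand[OF \<omega>_multilinear[OF z] E_expand[OF z], of "[u, v, w]"]
  by (simp add: numeral_3_eq_3 sum_lists_Suc prod.lessThan_Suc_shift \<omega>_frame[OF z] mult.assoc del: prod.lessThan_Suc)

lemma \<omega>_pullback_derivative:
  assumes U: "open U" "x \<in> U" "\<And>z. z \<in> U \<Longrightarrow> \<tau> z \<in> S" and \<tau>: "(\<tau> has_derivative D) (at x)"
    and X: "(X has_derivative DX) (at x)" and Y: "(Y has_derivative DY) (at x)" and Z: "(Z has_derivative DZ) (at x)"
  shows "((\<lambda>z. \<omega> (\<tau> z) [X z, Y z, Z z]) has_derivative (\<lambda>u. \<omega> (\<tau> x) [W (\<tau> x) (D u) (X x) + DX u, Y x, Z x]
      + \<omega> (\<tau> x) [X x, W (\<tau> x) (D u) (Y x) + DY u, Z x] + \<omega> (\<tau> x) [X x, Y x, W (\<tau> x) (D u) (Z x) + DZ u])) (at x)"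
proof -
  have "((\<lambda>z. \<Sigma> i. \<Sigma> j. \<Sigma> k. e i (\<tau> z) [X z] * (e j (\<tau> z) [Y z] * (e k (\<tau> z) [Z z] * phi i j k))) has_derivative
     (\<lambda>u. \<Sigma> i. \<Sigma> j. \<Sigma> k. e i (\<tau> x) [X x] * (e j (\<tau> x) [Y x] * (e k (\<tau> x) [W (\<tau> x) (D u) (Z x) + DZ u] * phi i j k)
        + e j (\<tau> x) [W (\<tau> x) (D u) (Y x) + DY u] * (e k (\<tau> x) [Z x] * phi i j k))
        + e i (\<tau> x) [W (\<tau> x) (D u) (X x) + DX u] * (e j (\<tau> x) [Y x] * (e k (\<tau> x) [Z x] * phi i j k)))) (at x)"
    by (intro has_derivative_sum has_derivative_mult has_derivative_mult_left e_pullback_derivative[OF U \<tau>] X Y Z)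
  then show ?thesis
    using has_derivative_cong_open[OF U(1,2), of "\<lambda>z. \<omega> (\<tau> z) [X z, Y z, Z z]"
       "\<lambda>z. \<Sigma> i. \<Sigma> j. \<Sigma> k. e i (\<tau> z) [X z] * (e j (\<tau> z) [Y z] * (e k (\<tau> z) [Z z] * phi i j k))"]
    by (simp add: \<omega>_expand U(2,3) sum.distrib distrib_left add_ac)
qed

lemma e_field_derivative:
  assumes "y \<in> S" "(X has_derivative DX) (at y)"
  shows "((\<lambda>z. e i z [X z]) has_derivative (\<lambda>u. e i y [W y u (X y) + DX u])) (at y)"
  using e_pullback_derivative[OF S assms(1) _ has_derivative_ident assms(2)] by simp

lemma g_field_derivative:
  assumes "y \<in> S" "(X has_derivative DX) (at y)" "(Y has_derivative DY) (at y)"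
  shows "((\<lambda>z. g z (X z) (Y z)) has_derivative (\<lambda>u. g y (W y u (X y) + DX u) (Y y) + g y (X y) (W y u (Y y) + DY u))) (at y)"
  using g_pullback_derivative[OF S assms(1) _ has_derivative_ident assms(2,3)] by simp

lemma \<omega>_field_derivative:
  assumes "y \<in> S" "(X has_derivative DX) (at y)" "(Y has_derivative DY) (at y)" "(Z has_derivative DZ) (at y)"
  shows "((\<lambda>z. \<omega> z [X z, Y z, Z z]) has_derivative (\<lambda>u. \<omega> y [W y u (X y) + DX u, Y y, Z y]
      + \<omega> y [X y, W y u (Y y) + DY u, Z y] + \<omega> y [X y, Y y, W y u (Z y) + DZ u])) (at y)"
  using \<omega>_pullback_derivative[OF S assms(1) _ has_derivative_ident assms(2-4)] by simp

definition dGam :: "vec7 \<Rightarrow> vec7 \<Rightarrow> vec7 \<Rightarrow> vec7 \<Rightarrow> vec7" where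
  "dGam y u v w = frechet_derivative (\<lambda>z. Gam z v w) (at y) u"

lemma dGam: "y \<in> S \<Longrightarrow> ((\<lambda>z. Gam z v w) has_derivative (\<lambda>u. dGam y u v w)) (at y)"
  unfolding dGam_def using smooth_on_D[OF smooth_Gam] by simp

lemma curvature_Gam: "curvature Gam y u v w = dGam y u v w - dGam y v u w + Gam y u (Gam y v w) - Gam y v (Gam y u w)"
  by (simp add: curvature_def dGam_def)

lemma smooth_on_times_2: "smooth_on S f \<Longrightarrow> times_diff_on 2 S f" for f :: "vec7 \<Rightarrow> real"
  by (simp add: smooth_on_def)

text \<open>The Hessian of \<open>g p q\<close> for constant \<open>p\<close>, \<open>q\<close> is symmetric. Computed with the metric connection, its skew
  part is the stated combination of curvature terms.\<close>
lemma curvature_skew: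
  assumes y: "y \<in> S"
  shows "g y (curvature Gam y u v p) q = - g y p (curvature Gam y u v q)"
proof -
  note gb = bilinear_ladd[OF g_bilinear[OF y]] bilinear_radd[OF g_bilinear[OF y]] bilinear_lsub[OF g_bilinear[OF y]] bilinear_rsub[OF g_bilinear[OF y]]
  have par: "g y (W y u a) b + g y a (W y u b) = g y (Gam y u a) b + g y a (Gam y u b)" for u a b
    using Gam_metric[OF y, of u a b] by (simp add: dg_def)
  define F where "F z = g z p q" for z
  \<comment> \<open>The Hessian, with first derivatives of \<open>g\<close> replaced by connection terms.\<close>
  define Z where "Z u v = g y (dGam y u v p) q + g y (Gam y u (Gam y v p)) q + g y (Gam y v p) (Gam y u q)
     + (g y p (dGam y u v q) + g y p (Gam y u (Gam y v q)) + g y (Gam y u p) (Gam y v q))" for u v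
  have F2: "times_diff_on 2 S F"
    unfolding F_def by (intro smooth_on_times_2 smooth_g_field smooth_on_const S)
  have "frechet_derivative (\<lambda>z. frechet_derivative F (at z) v) (at y) u = Z u v" for u v
  proof -
    have "frechet_derivative (\<lambda>z. frechet_derivative F (at z) v) (at y) = frechet_derivative (\<lambda>z. g z (Gam z v p) q + g z p (Gam z v q)) (at y)"
      by (rule frechet_derivative_cong_open[OF S y]) (simp add: F_def[abs_def] frechet_g Gam_metric)
    also have "\<dots> = (\<lambda>u. (g y (W y u (Gam y v p) + dGam y u v p) q + g y (Gam y v p) (W y u q + 0))
        + (g y (W y u p + 0) (Gam y v q) + g y p (W y u (Gam y v q) + dGam y u v q)))"
      by (rule frechet_derivative_at[symmetric]) (intro has_derivative_add g_field_derivative y dGam has_derivative_const)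
    finally show ?thesis
      using par[of u "Gam y v p" q] par[of u p "Gam y v q"] by (simp add: Z_def gb)
  qed
  then have "Z u v = Z v u" using second_derivative_symmetric_real[OF S F2 y, of v u] by simp
  then show ?thesis unfolding curvature_Gam gb Z_def by simp
qed

definition integrable_on_chart :: bool where "integrable_on_chart \<longleftrightarrow> (\<forall>y\<in>S. integrable_at y)"

text \<open>The same argument for the Hessian of \<open>\<omega>(p, q, r)\<close>, which is available since \<open>\<omega>\<close> is parallel on the
  whole domain and not just at \<open>y\<close>.\<close>
lemma curvature_kills_\<omega>:
  assumes I: "integrable_on_chart" and y: "y \<in> S"
  shows "act (curvature Gam y u v) (\<omega> y) [p, q, r] = 0"
proof -
  note m = multilinear_3[OF \<omega>_multilinear[OF y]]
  note lin = linear_add[OF m(1)] linear_add[OF m(2)] linear_add[OF m(3)] linear_diff[OF m(1)] linear_diff[OF m(2)] linear_diff[OF m(3)]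
  have par: "\<omega> y [W y u a, b, c] + \<omega> y [a, W y u b, c] + \<omega> y [a, b, W y u c]
     = \<omega> y [Gam y u a, b, c] + \<omega> y [a, Gam y u b, c] + \<omega> y [a, b, Gam y u c]" for u a b c
    using Gam_parallel[OF y, of "[a, b, c]" u] I y unfolding integrable_on_chart_def by (simp add: act_list3)
  define F where "F z = \<omega> z [p, q, r]" for z
  define Z where "Z u v = \<omega> y [dGam y u v p, q, r] + \<omega> y [Gam y u (Gam y v p), q, r] + \<omega> y [Gam y v p, Gam y u q, r] + \<omega> y [Gam y v p, q, Gam y u r]
     + (\<omega> y [p, dGam y u v q, r] + \<omega> y [Gam y u p, Gam y v q, r] + \<omega> y [p, Gam y u (Gam y v q), r] + \<omega> y [p, Gam y v q, Gam y u r])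
     + (\<omega> y [p, q, dGam y u v r] + \<omega> y [Gam y u p, q, Gam y v r] + \<omega> y [p, Gam y u q, Gam y v r] + \<omega> y [p, q, Gam y u (Gam y v r)])" for u v
  have F2: "times_diff_on 2 S F"
  proof (rule smooth_on_times_2)
    have "smooth_on S (\<lambda>z. \<Sigma> i. \<Sigma> j. \<Sigma> k. e i z [p] * (e j z [q] * (e k z [r] * phi i j k)))"
      by (intro smooth_on_sum smooth_on_mult smooth_e smooth_on_const S)
    then show "smooth_on S F"
      using smooth_on_cong[OF S, of F "\<lambda>z. \<Sigma> i. \<Sigma> j. \<Sigma> k. e i z [p] * (e j z [q] * (e k z [r] * phi i j k))"] by (simp add: F_def \<omega>_expand)
  qed
  have "frechet_derivative (\<lambda>z. frechet_derivative F (at z) v) (at y) u = Z u v" for u v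
  proof -
    have "frechet_derivative F (at z) v = \<omega> z [Gam z v p, q, r] + \<omega> z [p, Gam z v q, r] + \<omega> z [p, q, Gam z v r]" if z: "z \<in> S" for z
    proof -
      have "frechet_derivative F (at z) = (\<lambda>u. act (W z u) (\<omega> z) [p, q, r])"
        unfolding F_def by (rule frechet_derivative_at[symmetric], rule \<omega>_derivative[OF z]) simp
      then show ?thesis
        using Gam_parallel[OF z, of "[p, q, r]" v] I z unfolding integrable_on_chart_def by (simp add: act_list3)
    qed
    then have "frechet_derivative (\<lambda>z. frechet_derivative F (at z) v) (at y)
        = frechet_derivative (\<lambda>z. \<omega> z [Gam z v p, q, r] + \<omega> z [p, Gam z v q, r] + \<omega> z [p, q, Gam z v r]) (at y)"
      by (rule frechet_derivative_cong_open[OF S y])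
    also have "\<dots> = (\<lambda>u. (\<omega> y [W y u (Gam y v p) + dGam y u v p, q, r] + \<omega> y [Gam y v p, W y u q + 0, r] + \<omega> y [Gam y v p, q, W y u r + 0])
        + (\<omega> y [W y u p + 0, Gam y v q, r] + \<omega> y [p, W y u (Gam y v q) + dGam y u v q, r] + \<omega> y [p, Gam y v q, W y u r + 0])
        + (\<omega> y [W y u p + 0, q, Gam y v r] + \<omega> y [p, W y u q + 0, Gam y v r] + \<omega> y [p, q, W y u (Gam y v r) + dGam y u v r]))"
      by (rule frechet_derivative_at[symmetric]) (intro has_derivative_add \<omega>_field_derivative y dGam has_derivative_const)
    finally show ?thesis
      using par[of u "Gam y v p" q r] par[of u p "Gam y v q" r] par[of u p q "Gam y v r"] by (simp add: Z_def lin)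
  qed
  then have "Z u v = Z v u" using second_derivative_symmetric_real[OF S F2 y, of v u] by simp
  then show ?thesis unfolding act_list3 curvature_Gam lin Z_def by simp
qed

definition dTf :: "vec7 \<Rightarrow> vec7 \<Rightarrow> vec7 \<Rightarrow> vec7 \<Rightarrow> vec7 \<Rightarrow> real" where
  "dTf y u v w q = frechet_derivative (\<lambda>z. Tf z v w q) (at y) u"

lemma Tf_Gam: "y \<in> S \<Longrightarrow> Tf y v w q = g y (Gam y v w - Gam y w v) q"
  using torsion_Gam[of y v w q] by (simp add: torsion_def numeral_3_eq_3)

lemma dTf_Gam: assumes y: "y \<in> S"
  shows "dTf y u v w q = g y (dGam y u v w - dGam y u w v + Gam y u (Gam y v w - Gam y w v)) q + Tf y v w (Gam y u q)"
proof -
  note gb = bilinear_ladd[OF g_bilinear[OF y]] bilinear_radd[OF g_bilinear[OF y]]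
  have "dTf y u v w q = frechet_derivative (\<lambda>z. g z (Gam z v w - Gam z w v) q) (at y) u"
    unfolding dTf_def by (rule fun_cong[OF frechet_derivative_cong_open[OF S y]]) (rule Tf_Gam)
  also have "\<dots> = g y (W y u (Gam y v w - Gam y w v) + (dGam y u v w - dGam y u w v)) q + g y (Gam y v w - Gam y w v) (W y u q + 0)"
    by (rule fun_cong[OF frechet_derivative_at[symmetric]]) (intro g_field_derivative has_derivative_diff y dGam has_derivative_const)
  finally show ?thesis
    using Gam_metric[OF y, of u "Gam y v w - Gam y w v" q] by (simp add: dg_def gb Tf_Gam[OF y])
qed

text \<open>In coordinates the cyclic sum of the curvature involves only the skew part of the connection, which is the
  torsion.\<close>
lemma first_bianchi:
  assumes y: "y \<in> S"
  shows "g y (curvature Gam y u v w) q + g y (curvature Gam y v w u) q + g y (curvature Gam y w u v) q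
     = (dTf y u v w q - Tf y v w (Gam y u q)) + (dTf y v w u q - Tf y w u (Gam y v q)) + (dTf y w u v q - Tf y u v (Gam y w q))"
  unfolding dTf_Gam[OF y] curvature_Gam
  by (simp add: bilinear_ladd[OF g_bilinear[OF y]] bilinear_lsub[OF g_bilinear[OF y]] bilinear_rsub[OF bilinear_Gam[OF y]])

end

section \<open>Scalar curvature\<close>

lemma act_Cons: "act A F (v # vs) = F (A v # vs) + act A (\<lambda>us. F (v # us)) vs"
  unfolding act_def by (simp add: sum.lessThan_Suc_shift del: sum.lessThan_Suc)

text \<open>On \<open>g\<^sub>2\<close> the operator \<open>psi\<close> on two-forms is \<open>- 2\<close>. Applied to the last pair of arguments it turns the
  double trace into a contraction with \<open>psi\<close>.\<close>
lemma curvature_trace: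
  fixes r :: "7 \<Rightarrow> 7 \<Rightarrow> 7 \<Rightarrow> 7 \<Rightarrow> real"
  assumes skew: "\<And>i j k l. r i j l k = - r i j k l" and vec: "\<And>i j m. vec_part (r i j) m = 0"
  shows "(\<Sigma> i. \<Sigma> j. r i j j i) = (\<Sigma> i. \<Sigma> j. \<Sigma> k. \<Sigma> l. psi i j k l * r i j k l) / 2"
proof -
  have "r i j j i = (\<Sigma> k. \<Sigma> l. psi i j k l * r i j k l) / 2" for i j
  proof -
    have "0 = 2 * r i j j i + (\<Sigma> k. \<Sigma> l. psi k l j i * r i j k l)"
      using vec_part_phi[of "r i j" j i, OF skew] by (simp add: vec)
    moreover have "psi k l j i = - psi i j k l" for k l using psi_skew34[of k l i j] psi_pair[of k l i j] by simp
    ultimately show ?thesis by (simp add: sum_negf)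
  qed
  then show ?thesis by (simp add: sum_divide_distrib)
qed

context adapted_chart
begin

lemma linear_E_expand:
  fixes f :: "vec7 \<Rightarrow> real"
  assumes y: "y \<in> S" and "linear f"
  shows "f v = (\<Sigma> k. g y v (E y k) * f (E y k))"
proof -
  interpret F: frame_at g y vol "E y" by (rule frame[OF y])
  show ?thesis
    using arg_cong[OF F.E_expand[of v], of f] by (simp only: linear_sum[OF assms(2)] linear_cmul[OF assms(2)] real_scaleR_def)
qed

lemma curvature_Gam_vec_part:
  assumes I: "integrable_on_chart" and y: "y \<in> S"
  shows "vec_part (\<lambda>k l. g y (curvature Gam y u v (E y k)) (E y l)) m = 0"
proof -
  interpret F: frame_at g y vol "E y" by (rule frame[OF y])
  define r where "r k l = g y (curvature Gam y u v (E y k)) (E y l)" for k l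
  have exp: "curvature Gam y u v (E y j) = (\<Sum>k\<in>UNIV. r j k *\<^sub>R E y k)" for j
    unfolding r_def by (rule F.E_expand)
  have "act3 r phi i j k = 0" for i j k
    using act_frame3[where F = "\<omega> y" and B = "curvature Gam y u v" and E = "E y" and b = r, OF \<omega>_multilinear[OF y] exp, of i j k]
      curvature_kills_\<omega>[OF I y] by (simp add: \<omega>_frame[OF y])
  moreover have "r k j = - r j k" for j k
    unfolding r_def using curvature_skew[OF y, of u v "E y k" "E y j"] F.sym by simp
  ultimately have "vec_part r m = 0" using vec_part_eq_0_iff[of r] by blast
  then show ?thesis by (simp add: r_def[abs_def])
qed

definition dth :: "vec7 \<Rightarrow> 7 \<Rightarrow> vec7 \<Rightarrow> real" where
  "dth y i u = frechet_derivative (\<lambda>z. th z i) (at y) u"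

definition dT3 :: "vec7 \<Rightarrow> 7 \<Rightarrow> 7 \<Rightarrow> 7 \<Rightarrow> vec7 \<Rightarrow> real" where
  "dT3 y i j k u = frechet_derivative (\<lambda>z. T3 z i j k) (at y) u"

lemma dth: "y \<in> S \<Longrightarrow> ((\<lambda>z. th z i) has_derivative dth y i) (at y)"
  unfolding dth_def[abs_def] using smooth_on_D[OF smooth_th] by simp

lemma dT3: "y \<in> S \<Longrightarrow> ((\<lambda>z. T3 z i j k) has_derivative dT3 y i j k) (at y)"
  unfolding dT3_def[abs_def] using smooth_on_D[OF smooth_T3] by simp

text \<open>The torsion determines the Lee form; differentiating this relation identifies the derivative of the torsion,
  contracted with \<open>psi\<close>, with the divergence of \<open>\<theta>\<close>.\<close>
lemma psi_T3: "y \<in> S \<Longrightarrow> (\<Sigma> j. \<Sigma> k. \<Sigma> l. psi i j k l * T3 y j k l) = - 6 * th y i"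
  unfolding T3_def by (rule g2_first_order.psi_T[OF first_order lee_frame])

lemma psi_dT3: assumes y: "y \<in> S" shows "(\<Sigma> j. \<Sigma> k. \<Sigma> l. psi i j k l * dT3 y j k l u) = - 6 * dth y i u"
proof -
  have "((\<lambda>z. \<Sigma> j. \<Sigma> k. \<Sigma> l. psi i j k l * T3 z j k l) has_derivative (\<lambda>u. \<Sigma> j. \<Sigma> k. \<Sigma> l. psi i j k l * dT3 y j k l u)) (at y)"
    by (intro has_derivative_sum has_derivative_mult_right dT3 y)
  moreover have "((\<lambda>z. - 6 * th z i) has_derivative (\<lambda>u. - 6 * dth y i u)) (at y)"
    by (intro has_derivative_mult_right dth y)
  ultimately show ?thesis
    using has_derivative_cong_open[OF S y, of "\<lambda>z. \<Sigma> j. \<Sigma> k. \<Sigma> l. psi i j k l * T3 z j k l" "\<lambda>z. - 6 * th z i", OF psi_T3]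
      has_derivative_unique by (metis (no_types, lifting))
qed

lemma dTf_frame:
  assumes y: "y \<in> S"
  shows "dTf y u (E y j) (E y k) (E y l) = dT3 y j k l u + (\<Sigma> m. g y (W y u (E y j)) (E y m) * T3 y m k l
     + g y (W y u (E y k)) (E y m) * T3 y j m l + g y (W y u (E y l)) (E y m) * T3 y j k m)"
proof -
  have "((\<lambda>z. Tf z (E y j) (E y k) (E y l)) has_derivative (\<lambda>u. \<Sigma> a. \<Sigma> b. \<Sigma> c.
      T3 y a b c * ((e a y [E y j] * e b y [E y k]) * de c y u (E y l) + (e a y [E y j] * de b y u (E y k) + de a y u (E y j) * e b y [E y k]) * e c y [E y l])
      + dT3 y a b c u * (e a y [E y j] * e b y [E y k] * e c y [E y l]))) (at y)"
    unfolding Tf_def by (intro has_derivative_sum has_derivative_mult dT3 de y)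
  from fun_cong[OF frechet_derivative_at[OF this], of u, symmetric] show ?thesis
    unfolding dTf_def g_E[OF y] e_W[OF y] e_E[OF y]
    by (simp add: distrib_left distrib_right sum.distrib mult.assoc[symmetric]) (simp add: mult_ac sum_distrib_left[symmetric])
qed

text \<open>The sum on the right is minus \<open>\<delta>\<theta>\<close>, by \<open>codiff_\<theta>\<close> below. The hypotheses of the contraction lemmas hold
  with \<open>c\<close> the coefficients of \<open>Gam\<close> and \<open>b = a + T3 / 2\<close> its coefficients relative to the frame.\<close>
lemma scalar_curvature_Gam:
  assumes I: "integrable_on_chart" and y: "y \<in> S"
  shows "(\<Sigma> i. \<Sigma> j. g y (curvature Gam y (E y i) (E y j) (E y j)) (E y i))
     = - 3 * (\<Sigma> i. dth y i (E y i) - (\<Sigma> m. a y i i m * th y m)) + qform (T3 y) / 2"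
proof -
  interpret F: frame_at g y vol "E y" by (rule frame[OF y])
  interpret G: g2_first_order "a y" "th y" by (rule first_order[OF y])
  define r where "r i j k l = g y (curvature Gam y (E y i) (E y j) (E y k)) (E y l)" for i j k l
  define t where "t i j k l = dTf y (E y i) (E y j) (E y k) (E y l)" for i j k l
  define c where "c i j m = g y (Gam y (E y i) (E y j)) (E y m)" for i j m
  define b where "b i j m = a y i j m + T3 y i j m / 2" for i j m
  note gl = bilinear_lsub[OF g_bilinear[OF y]]
  have Iy: "integrable_at y" using I y by (simp add: integrable_on_chart_def)
  have c_skew: "c i j m - c j i m = T3 y i j m" for i j m
    using Tf_Gam[OF y, of "E y i" "E y j" "E y m"] by (simp add: c_def Tf_E[OF y] gl)
  have w: "g y (W y (E y i) (E y j)) (E y m) = c i j m - b i j m" for i j m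
    unfolding c_def b_def a_def A_def g_Gam[OF y] Tf_E[OF y] gl by simp
  have T_Gam: "Tf y (E y j) (E y k) (Gam y (E y i) (E y l)) = (\<Sigma> m. c i l m * T3 y j k m)" for i j k l
    using linear_E_expand[OF y Tf_linear(3)[OF y], of "E y j" "E y k" "Gam y (E y i) (E y l)"] by (simp only: c_def Tf_E[OF y])
  have b_skew: "b i k j = - b i j k" for i j k
    using a_skew[OF y, of i k j] T3_skew(2)[OF y, of i k j] by (simp add: b_def)
  have bvec: "vec_part (b i) l = 0" for i l
    unfolding b_def[abs_def] T3_def by (rule G.vec_part_char_connection[OF integrable_frame[OF y Iy]])
  have b0: "act4 (b i) psi p j k l = 0" for i p j k l by (rule act4_psi_eq_0[OF b_skew bvec])
  have "(\<Sigma> i. \<Sigma> j. r i j j i) = (\<Sigma> i. \<Sigma> j. \<Sigma> k. \<Sigma> l. psi i j k l * r i j k l) / 2"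
  proof (rule curvature_trace)
    show "r i j l k = - r i j k l" for i j k l
      unfolding r_def using curvature_skew[OF y, of "E y i" "E y j" "E y l" "E y k"] F.sym by simp
    show "vec_part (r i j) m = 0" for i j m
      using curvature_Gam_vec_part[OF I y, of "E y i" "E y j" m] by (simp add: r_def[abs_def])
  qed
  moreover have "(\<Sigma> i. \<Sigma> j. \<Sigma> k. \<Sigma> l. psi i j k l * r i j k l) = (\<Sigma> i. \<Sigma> j. \<Sigma> k. \<Sigma> l. psi i j k l * t i j k l) - qform (T3 y) / 2"
  proof (rule bianchi_contraction[where c = c])
    show "r i j k l + r j k i l + r k i j l = (t i j k l - (\<Sigma> m. c i l m * T3 y j k m))
      + (t j k i l - (\<Sigma> m. c j l m * T3 y k i m)) + (t k i j l - (\<Sigma> m. c k l m * T3 y i j m))" for i j k l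
      unfolding r_def t_def T_Gam[symmetric] by (rule first_bianchi[OF y])
  qed (rule c_skew)
  moreover have "(\<Sigma> i. \<Sigma> j. \<Sigma> k. \<Sigma> l. psi i j k l * t i j k l)
     = - 6 * (\<Sigma> i. dth y i (E y i) - (\<Sigma> m. b i i m * th y m)) + 3/2 * qform (T3 y)"
  proof (rule divergence_contraction[where c = c and b = b and dth = "\<lambda>p i. dth y i (E y p)" and dT = "\<lambda>p j k l. dT3 y j k l (E y p)"])
    show "t i j k l = dT3 y j k l (E y i) + (\<Sigma> m. (c i j m - b i j m) * T3 y m k l + (c i k m - b i k m) * T3 y j m l + (c i l m - b i l m) * T3 y j k m)" for i j k l
      unfolding t_def dTf_frame[OF y] w ..
  qed (use T3_skew[OF y] c_skew b_skew b0 psi_T3[OF y] psi_dT3[OF y] in blast)+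
  moreover have "b i i m = a y i i m" for i m
    using T3_skew(1)[OF y, of i i m] by (simp add: b_def)
  ultimately show ?thesis by (simp add: r_def)
qed

definition dL :: "vec7 \<Rightarrow> vec7 \<Rightarrow> vec7 \<Rightarrow> vec7 \<Rightarrow> vec7" where
  "dL y u v w = frechet_derivative (\<lambda>z. L z v w) (at y) u"

lemma dL: "y \<in> S \<Longrightarrow> ((\<lambda>z. L z v w) has_derivative (\<lambda>u. dL y u v w)) (at y)"
  unfolding dL_def using smooth_on_D[OF smooth_L] by simp

lemma curvature_L: "curvature L y u v w = dL y u v w - dL y v u w + L y u (L y v w) - L y v (L y u w)"
  by (simp add: curvature_def dL_def)

text \<open>With \<open>s = T / 2\<close> totally skew, terms linear in \<open>s\<close> or its derivative are paired with repeated arguments and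
  cancel; only the square of \<open>s\<close> remains.\<close>
lemma sectional_curvature_relation:
  assumes y: "y \<in> S"
  defines "s \<equiv> \<lambda>u v. Gam y u v - L y u v"
  shows "g y (curvature L y u v v) u = g y (curvature Gam y u v v) u + g y (s u v) (s u v)"
proof -
  interpret F: frame_at g y vol "E y" by (rule frame[OF y])
  note gb = bilinear_ladd[OF g_bilinear[OF y]] bilinear_radd[OF g_bilinear[OF y]] bilinear_lsub[OF g_bilinear[OF y]] bilinear_rsub[OF g_bilinear[OF y]]
  have gs: "g z (Gam z p q - L z p q) w = Tf z p q w / 2" if "z \<in> S" for z p q w
    by (simp add: bilinear_lsub[OF g_bilinear[OF that]] g_Gam[OF that])
  have Tf0: "Tf z p p w = 0" "Tf z p w p = 0" if "z \<in> S" for z p w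
    using Tf_skew(1)[OF that, of p p w] Tf_skew(1)[OF that, of p w p] Tf_skew(2)[OF that, of w p p] by simp_all
  have GL: "Gam z v v = L z v v" if "z \<in> S" for z
  proof -
    interpret Z: frame_at g z vol "E z" by (rule frame[OF that])
    show ?thesis by (rule Z.g_ext) (simp add: g_Gam[OF that] Tf0[OF that])
  qed
  have 1: "dGam y u v v = dL y u v v"
    unfolding dGam_def dL_def by (rule fun_cong[OF frechet_derivative_cong_open[OF S y]]) (rule GL)
  \<comment> \<open>By skewness \<open>g(s(u, v), u)\<close> vanishes identically, and so does its derivative along \<open>v\<close>.\<close>
  have "((\<lambda>z. g z (Gam z u v - L z u v) u) has_derivative
      (\<lambda>h. g y (W y h (Gam y u v - L y u v) + (dGam y h u v - dL y h u v)) u + g y (Gam y u v - L y u v) (W y h u + 0))) (at y)"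
    by (intro g_field_derivative y has_derivative_diff dGam dL has_derivative_const)
  moreover have "((\<lambda>z. g z (Gam z u v - L z u v) u) has_derivative (\<lambda>h. 0)) (at y)"
    using has_derivative_cong_open[OF S y, of "\<lambda>z. g z (Gam z u v - L z u v) u" "\<lambda>z. 0"] by (simp add: gs Tf0)
  ultimately have "g y (W y v (s u v) + (dGam y v u v - dL y v u v)) u + g y (s u v) (W y v u + 0) = 0"
    unfolding s_def by (metis (no_types, lifting) has_derivative_unique)
  then have 2: "g y (dGam y v u v) u - g y (dL y v u v) u = - g y (L y v (s u v)) u - g y (s u v) (L y v u)"
    using L_metric[OF y, of v "s u v" u] by (simp add: dg_def gb)
  have Gs: "Gam y p q = L y p q + s p q" for p q by (simp add: s_def)
  have 3: "Gam y u (Gam y v v) = L y u (L y v v) + s u (L y v v)" unfolding GL[OF y] by (rule Gs)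
  have 4: "Gam y v (Gam y u v) = L y v (L y u v) + L y v (s u v) + s v (Gam y u v)"
    by (simp add: Gs[of v "Gam y u v"]) (simp add: Gs[of u v] bilinear_radd[OF bilinear_L[OF y]])
  have 5: "g y (s u p) u = 0" for p unfolding s_def gs[OF y] by (simp add: Tf0[OF y])
  have 6: "g y (s v x) u = g y (s u v) x" for x
    unfolding s_def gs[OF y] using Tf_skew(1)[OF y, of u v x] Tf_skew(2)[OF y, of v u x] by simp
  have 7: "g y (s u v) (Gam y u v) = g y (s u v) (L y v u) + g y (s u v) (s u v)"
    by (simp add: Gs[of u v] gb L_sym[OF y, of v u])
  show ?thesis
    unfolding curvature_L curvature_Gam gb 3 4 1 5 using 2 6[of "Gam y u v"] 7 5 by simp
qed

lemma scalar_curvature_L: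
  assumes y: "y \<in> S"
  shows "(\<Sigma> i. \<Sigma> j. g y (curvature L y (E y i) (E y j) (E y j)) (E y i))
     = (\<Sigma> i. \<Sigma> j. g y (curvature Gam y (E y i) (E y j) (E y j)) (E y i)) + (\<Sigma> i. \<Sigma> j. \<Sigma> k. (T3 y i j k)\<^sup>2) / 4"
proof -
  define s where "s u v = Gam y u v - L y u v" for u v
  have es: "e k y [s (E y i) (E y j)] = T3 y i j k / 2" for i j k
    unfolding g_E[OF y, symmetric] s_def by (simp add: bilinear_lsub[OF g_bilinear[OF y]] g_Gam[OF y] Tf_E[OF y])
  have "g y (s (E y i) (E y j)) (s (E y i) (E y j)) = (\<Sigma> k. (T3 y i j k)\<^sup>2) / 4" for i j
    unfolding g_e[OF y] es by (simp add: power2_eq_square sum_divide_distrib)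
  then show ?thesis
    unfolding sectional_curvature_relation[OF y] s_def by (simp add: sum.distrib sum_divide_distrib)
qed

text \<open>The trace over the arbitrary basis is replaced by the adapted frame, one pair of arguments at a time.\<close>
lemma scalar_curvature_frame:
  assumes y: "y \<in> S"
  shows "scalar_curvature g y = (\<Sigma> i. \<Sigma> j. g y (curvature L y (E y i) (E y j) (E y j)) (E y i))"
proof -
  interpret F: frame_at g y vol "E y" by (rule frame[OF y])
  let ?O = "onb g y"
  have Llin: "linear (\<lambda>u. L y u v)" "linear (\<lambda>v. L y u v)" for u v using bilinear_L[OF y] by (auto simp: bilinear_def)
  have d1: "linear (\<lambda>u. dL y u v w)" for v w by (rule has_derivative_linear[OF dL[OF y]])
  have d3: "linear (\<lambda>w. dL y u v w)" for u v
    by (rule has_derivative_linear_arg[where f = "\<lambda>z w. L z v w" and D = "\<lambda>u w. dL y u v w", OF S y _ dL[OF y]])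
      (use bilinear_L in \<open>auto simp: bilinear_def\<close>)
  have d2: "linear (\<lambda>v. dL y u v w)" for u w
    by (rule has_derivative_linear_arg[where f = "\<lambda>z v. L z v w" and D = "\<lambda>u v. dL y u v w", OF S y _ dL[OF y]])
      (use bilinear_L in \<open>auto simp: bilinear_def\<close>)
  note comp = linear_compose[unfolded comp_def]
  have c: "linear (\<lambda>u. curvature L y u v w)" "linear (\<lambda>v. curvature L y u v w)" "linear (\<lambda>w. curvature L y u v w)" for u v w
    unfolding curvature_L
    by (intro linear_compose_add linear_compose_sub d1 d2 d3 Llin comp[OF Llin(1) Llin(1)] comp[OF Llin(1) Llin(2)]
       comp[OF Llin(2) Llin(1)] comp[OF Llin(2) Llin(2)])+
  have gc: "linear (\<lambda>v. g y (f v) q)" if "linear f" for f :: "vec7 \<Rightarrow> vec7" and q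
    by (rule comp[OF that F.g_linear(2)])
  have "(\<Sigma> j. g y (curvature L y u (?O j) (?O j)) q) = (\<Sigma> j. g y (curvature L y u (E y j) (E y j)) q)" for u q
    by (rule F.bilinear_trace_indep[where F = "\<lambda>v w. g y (curvature L y u v w) q", OF F.onb_orthonormal F.E_orthonormal]) (intro gc c)+
  then have "scalar_curvature g y = (\<Sigma> i. \<Sigma> j. g y (curvature L y (?O i) (E y j) (E y j)) (?O i))"
    by (simp add: scalar_curvature_def)
  also have "\<dots> = (\<Sigma> i. \<Sigma> j. g y (curvature L y (E y i) (E y j) (E y j)) (E y i))"
    by (rule F.bilinear_trace_indep[where F = "\<lambda>u q. \<Sigma> j. g y (curvature L y u (E y j) (E y j)) q", OF F.onb_orthonormal F.E_orthonormal])
      (intro linear_compose_sum ballI gc c F.g_linear(1))+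
  finally show ?thesis .
qed

text \<open>The frame components of the volume form are constant, and the skew maps \<open>A u\<close> annihilate it; hence it is
  parallel for the Levi-Civita connection.\<close>
lemma vol_derivative:
  assumes y: "y \<in> S" "length vs = 7"
  shows "((\<lambda>z. vol z vs) has_derivative (\<lambda>u. act (L y u) (vol y) vs)) (at y)"
proof -
  interpret F: frame_at g y vol "E y" by (rule frame[OF y(1)])
  have "vol z (map (E z) is) = vol y (map (E y) is)" if z: "z \<in> S" "length is = 7" for z "is"
  proof (cases "distinct is")
    case False
    then show ?thesis
      using alternating_form_repeat[OF vol_alternating] z(1) y(1) by (metis distinct_map)
  next
    case True
    have "mset is = mset [1,2,3,4,5,6,7]"
      using F.set_distinct_UNIV[OF True z(2)] True UNIV_7 by (intro set_eq_iff_mset_eq_distinct[THEN iffD1]) simp_all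
    then have "(vol z (map (E z) is) = vol y (map (E y) is)) = (vol z (map (E z) [1,2,3,4,5,6,7]) = vol y (map (E y) [1,2,3,4,5,6,7]))"
    proof (rule mset_eq_by_swaps[where P = "\<lambda>is. vol z (map (E z) is) = vol y (map (E y) is)", rotated])
      show "(vol z (map (E z) (us @ i # j # vs)) = vol y (map (E y) (us @ i # j # vs))) = (vol z (map (E z) (us @ j # i # vs)) = vol y (map (E y) (us @ j # i # vs)))" for us i j vs
        using alternating_form_swap[OF vol_alternating[OF z(1)], of "map (E z) us" "E z i" "E z j" "map (E z) vs"]
          alternating_form_swap[OF vol_alternating[OF y(1)], of "map (E y) us" "E y i" "E y j" "map (E y) vs"] by simp
    qed
    then show ?thesis using F.vol_frame frame_at.vol_frame[OF frame[OF z(1)]] by simp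
  qed
  from frame_constant_derivative[OF alternating_form_multilinear[OF vol_alternating] this y]
  have "((\<lambda>z. vol z vs) has_derivative (\<lambda>u. act (W y u) (vol y) vs)) (at y)" by blast
  moreover have "act (L y u) (vol y) vs = act (W y u) (vol y) vs" for u
  proof -
    have lin: "linear (A y u)" using bilinear_A[OF y(1)] by (simp add: bilinear_def)
    have "act (L y u) (vol y) vs = act (\<lambda>v. W y u v + A y u v) (vol y) vs" by (simp add: A_def)
    then show ?thesis
      using act_add[OF F.vol_multilinear y(2), of "W y u" "A y u"] F.act_vol[of "A y u" vs, OF A_skew[OF y(1)] lin] by simp
  qed
  ultimately show ?thesis by simp
qed

lemma vol_field_derivative:
  assumes y: "y \<in> S" and len: "length vs = 6" and X: "(X has_derivative DX) (at y)"
  shows "((\<lambda>z. vol z (X z # vs)) has_derivative (\<lambda>u. vol y ((DX u + L y u (X y)) # vs) + act (L y u) (\<lambda>us. vol y (X y # us)) vs)) (at y)"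
proof -
  note m = alternating_form_multilinear[OF vol_alternating]
  have lin: "linear (\<lambda>v. vol z (v # vs))" if "z \<in> S" for z
    using multilinear_Cons(2)[of 6 "vol z" vs] m[OF that] len by simp
  have Llin: "linear (L y u)" for u using bilinear_L[OF y] by (simp add: bilinear_def)
  have act_lin: "linear (\<lambda>v. act (L y u) (vol y) (v # vs))" for u
    using multilinear_Cons(2)[of 6 "act (L y u) (vol y)" vs] multilinear_act[OF Llin m[OF y]] len by simp
  have "((\<lambda>z. \<Sigma> k. X z $ k * vol z (axis k 1 # vs)) has_derivative
      (\<lambda>u. \<Sigma> k. X y $ k * act (L y u) (vol y) (axis k 1 # vs) + DX u $ k * vol y (axis k 1 # vs))) (at y)"
    by (intro has_derivative_sum has_derivative_mult vol_derivative y bounded_linear.has_derivative[OF bounded_linear_vec_nth] X) (simp add: len)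
  moreover have "(\<Sigma> k. X y $ k * act (L y u) (vol y) (axis k 1 # vs) + DX u $ k * vol y (axis k 1 # vs))
     = vol y ((DX u + L y u (X y)) # vs) + act (L y u) (\<lambda>us. vol y (X y # us)) vs" for u
    using linear_axis_expand[OF act_lin, of u "X y"] linear_axis_expand[OF lin[OF y], of "DX u"]
    by (simp add: sum.distrib act_Cons linear_add[OF lin[OF y]])
  ultimately show ?thesis
    using has_derivative_cong_open[OF S y, of "\<lambda>z. vol z (X z # vs)" "\<lambda>z. \<Sigma> k. X z $ k * vol z (axis k 1 # vs)"]
      linear_axis_expand[OF lin] by simp
qed

text \<open>With \<open>V\<close> the vector field dual to \<open>\<theta>\<close>, the form \<open>*\<theta>\<close> is the interior product of \<open>V\<close> with the parallel
  volume form, so its covariant derivative is the interior product of the covariant derivative \<open>n\<close> of \<open>V\<close>.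
  Applying \<open>hodge_ext_deriv\<close> and taking the star once more leaves the trace of \<open>n\<close>.\<close>
lemma codiff_\<theta>:
  assumes y: "y \<in> S"
  shows "codiff g vol \<theta> y [] = - (\<Sigma> i. dth y i (E y i) - (\<Sigma> m. a y i i m * th y m))"
proof -
  interpret F: frame_at g y vol "E y" by (rule frame[OF y])
  define V where "V z = (\<Sum>i\<in>UNIV. th z i *\<^sub>R E z i)" for z
  have "smooth_on S V" unfolding V_def[abs_def] by (intro smooth_on_sum smooth_on_scaleR smooth_th smooth_E S)
  from smooth_on_D[OF this y] obtain DV where DV: "(V has_derivative DV) (at y)" by blast
  have DVlin: "linear DV" by (rule has_derivative_linear[OF DV])
  have star: "hodge g vol \<theta> z vs = vol z (V z # vs)" if z: "z \<in> S" and len: "length vs = 6" for z vs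
  proof -
    have lin: "linear (\<lambda>v. vol z (v # vs))"
      using multilinear_Cons(2)[of 6 "vol z" vs] alternating_form_multilinear[OF vol_alternating[OF z]] len by simp
    show ?thesis
      using frame_at.hodge_frame[OF frame[OF z], of 1 \<theta> vs, OF alternating_form_multilinear[OF \<theta>_alt[OF z]]] len
      by (simp add: sum_lists_Suc V_def linear_sum[OF lin] linear_cmul[OF lin])
  qed
  define n where "n u = DV u + L y u (V y)" for u
  have nlin: "linear n" unfolding n_def using bilinear_L[OF y] by (intro linear_compose_add DVlin) (auto simp: bilinear_def)
  have alt: "alternating_form 6 (hodge g vol \<theta> y)"
    using F.hodge_alternating[of 1 \<theta>] alternating_form_zero[OF \<theta>_alt[OF y]] by simp
  have volm: "multilinear (Suc 6) (vol y)" using F.vol_multilinear by simp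
  have "hodge g vol (ext_deriv (hodge g vol \<theta>)) y [] = (-1) ^ 6 * (\<Sigma> i. hodge g vol (\<lambda>_ vs. vol y (n (E y i) # vs)) y (E y i # []))"
  proof (rule F.hodge_ext_deriv[where \<alpha> = "hodge g vol \<theta>" and L = "L y" and N = "\<lambda>u vs. vol y (n u # vs)", OF alt])
    fix u and vs :: "vec7 list" assume len: "length vs = 6"
    have "frechet_derivative (\<lambda>z. hodge g vol \<theta> z vs) (at y) = frechet_derivative (\<lambda>z. vol z (V z # vs)) (at y)"
      by (rule frechet_derivative_cong_open[OF S y]) (rule star[OF _ len])
    also have "\<dots> = (\<lambda>u. vol y (n u # vs) + act (L y u) (\<lambda>us. vol y (V y # us)) vs)"
      unfolding n_def by (rule frechet_derivative_at[symmetric], rule vol_field_derivative[OF y len DV])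
    finally show "frechet_derivative (\<lambda>z. hodge g vol \<theta> z vs) (at y) u = vol y (n u # vs) + act (L y u) (hodge g vol \<theta> y) vs"
      using act_cong[of vs "\<lambda>us. vol y (V y # us)" "hodge g vol \<theta> y" "L y u"] star[OF y] len by simp
  next
    show "multilinear 6 (\<lambda>vs. vol y (n u # vs))" for u by (rule multilinear_Cons(1)[OF volm])
    show "linear (\<lambda>u. vol y (n u # vs))" if "length vs = 6" for vs
      using linear_compose[OF nlin multilinear_Cons(2)[OF volm that]] by (simp add: comp_def)
  qed (simp_all add: L_sym[OF y])
  moreover have "hodge g vol (\<lambda>_ vs. vol y (n (E y i) # vs)) y [E y i] = dth y i (E y i) - (\<Sigma> m. a y i i m * th y m)" for i
  proof -
    \<comment> \<open>The one-form dual to the vector \<open>n (E y i)\<close>.\<close>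
    define \<nu> :: field where "\<nu> z us = (if length us = 1 then g y (n (E y i)) (hd us) else 0)" for z us
    have \<nu>_alt: "alternating_form 1 (\<nu> y)"
      unfolding alternating_form_def
    proof (intro conjI allI impI)
      fix us :: "vec7 list" and p q
      show "linear (\<lambda>v. \<nu> y (us[p := v]))" if "length us = 1 \<and> p < 1"
      proof -
        obtain w where "us = [w]" using \<open>length us = 1 \<and> p < 1\<close> by (auto simp: length_Suc_conv)
        then show ?thesis using that F.g_linear(1) by (simp add: \<nu>_def)
      qed
    qed (auto simp: \<nu>_def)
    have "hodge g vol (\<lambda>_ vs. vol y (n (E y i) # vs)) y [E y i] = hodge g vol (hodge g vol \<nu>) y [E y i]"
    proof (rule hodge_cong)
      fix vs :: "vec7 list" assume "length vs = 7 - length [E y i]"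
      then have len: "length vs = 6" by simp
      have lin: "linear (\<lambda>v. vol y (v # vs))" by (rule multilinear_Cons(2)[OF volm len])
      have *: "hodge g vol \<nu> y vs = (\<Sigma> k. g y (n (E y i)) (E y k) * vol y (E y k # vs))"
        using F.hodge_frame[of 1 \<nu> vs, OF alternating_form_multilinear[OF \<nu>_alt]] len by (simp add: sum_lists_Suc \<nu>_def)
      show "vol y (n (E y i) # vs) = hodge g vol \<nu> y vs" unfolding * by (rule linear_E_expand[OF y lin])
    qed
    also have "\<dots> = \<nu> y [E y i]" by (rule F.hodge_hodge[where \<alpha> = \<nu> and k = 1]) (simp_all add: \<nu>_alt[unfolded One_nat_def])
    also have "\<dots> = e i y [n (E y i)]" by (simp add: \<nu>_def g_E[OF y])
    also have "\<dots> = e i y [W y (E y i) (V y) + DV (E y i)] + e i y [A y (E y i) (V y)]"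
    proof -
      have "n (E y i) = (W y (E y i) (V y) + DV (E y i)) + A y (E y i) (V y)" by (simp add: n_def A_def)
      then show ?thesis by (simp only: linear_add[OF e_linear[OF y]])
    qed
    also have "e i y [W y (E y i) (V y) + DV (E y i)] = dth y i (E y i)"
    proof -
      have eV: "e i z [V z] = th z i" if "z \<in> S" for z
        by (simp add: V_def linear_sum[OF e_linear[OF that]] linear_cmul[OF e_linear[OF that]] e_E[OF that])
      have "((\<lambda>z. th z i) has_derivative (\<lambda>u. e i y [W y u (V y) + DV u])) (at y)"
        by (rule iffD1[OF has_derivative_cong_open[OF S y, of "\<lambda>z. e i z [V z]" "\<lambda>z. th z i", OF eV] e_field_derivative[OF y DV]])
      from fun_cong[OF has_derivative_unique[OF this dth[OF y]]] show ?thesis .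
    qed
    also have "e i y [A y (E y i) (V y)] = - (\<Sigma> m. a y i i m * th y m)"
    proof -
      have gV: "g y (V y) (E y m) = th y m" for m
        by (simp add: g_E[OF y] V_def linear_sum[OF e_linear[OF y]] linear_cmul[OF e_linear[OF y]] e_E[OF y])
      have "e i y [A y (E y i) (V y)] = - g y (V y) (A y (E y i) (E y i))"
        unfolding g_E[OF y, symmetric] by (rule A_skew[OF y])
      then show ?thesis unfolding A_E[OF y] F.g_sum(2) gV .
    qed
    finally show ?thesis by simp
  qed
  ultimately show ?thesis by (simp add: codiff_def)
qed

theorem scalar_curvature_chart:
  assumes I: "integrable_on_chart" and y: "y \<in> S"
  shows "scalar_curvature g y = 1/18 * (form_inner 4 g (ext_deriv \<omega>) \<psi> y)\<^sup>2 + 2 * form_inner 1 g \<theta> \<theta> y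
      - 1/12 * tensor3_norm_sq g (torsion g Gam) y + 3 * codiff g vol \<theta> y []"
proof -
  interpret F: frame_at g y vol "E y" by (rule frame[OF y])
  have Iy: "integrable_at y" using I y by (simp add: integrable_on_chart_def)
  have "tensor3_norm_sq g (torsion g Gam) y = (\<Sum>is | length is = 3. torsion g Gam y (map (onb g y) is) * torsion g Gam y (map (onb g y) is))"
    by (simp add: tensor3_norm_sq_def numeral_3_eq_3 sum_lists_Suc power2_eq_square)
  also have "\<dots> = (\<Sum>is | length is = 3. torsion g Gam y (map (E y) is) * torsion g Gam y (map (E y) is))"
    by (rule F.list_contraction_indep[OF F.onb_orthonormal F.E_orthonormal]) (rule alternating_form_multilinear[OF torsion_alternating[OF y]])+
  also have "\<dots> = (\<Sigma> i. \<Sigma> j. \<Sigma> k. (T3 y i j k)\<^sup>2)"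
    by (simp add: numeral_3_eq_3 sum_lists_Suc power2_eq_square torsion_Gam[OF y] Tf_E[OF y])
  finally have norm: "tensor3_norm_sq g (torsion g Gam) y = (\<Sigma> i. \<Sigma> j. \<Sigma> k. (T3 y i j k)\<^sup>2)" .
  have lee: "form_inner 1 g \<theta> \<theta> y = (\<Sigma> i. (th y i)\<^sup>2)"
    using F.form_inner_frame[of 1 \<theta> \<theta>] alternating_form_multilinear[OF \<theta>_alt[OF y]] by (simp add: sum_lists_Suc power2_eq_square)
  have "(\<Sigma> i. \<Sigma> j. \<Sigma> k. (T3 y i j k)\<^sup>2) = - 3/2 * qform (T3 y) + (g2_first_order.al (a y))\<^sup>2 / 6 + 6 * (\<Sigma> i. (th y i)\<^sup>2)"
    using g2_first_order.T_norm[OF first_order[OF y] integrable_frame[OF y Iy] lee_frame[OF y]] qform_norm[of "T3 y", OF T3_skew[OF y]]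
    by (simp add: T3_def)
  moreover have "scalar_curvature g y = 3 * codiff g vol \<theta> y [] + qform (T3 y) / 2 + (\<Sigma> i. \<Sigma> j. \<Sigma> k. (T3 y i j k)\<^sup>2) / 4"
    unfolding scalar_curvature_frame[OF y] scalar_curvature_L[OF y] scalar_curvature_Gam[OF I y] codiff_\<theta>[OF y] by simp
  ultimately show ?thesis unfolding norm lee al_frame[OF y] by linarith
qed

end

section \<open>Passage from charts to the manifold\<close>

text \<open>The defining properties of the characteristic connection at one point. They do not involve
  derivatives of the connection, so the connection is determined pointwise.\<close>
definition characteristic_at :: "field \<Rightarrow> metric \<Rightarrow> vec7 \<Rightarrow> (vec7 \<Rightarrow> vec7 \<Rightarrow> vec7) \<Rightarrow> bool" where
  "characteristic_at \<omega> g x G \<longleftrightarrow> bilinear G \<and> parallel_metric_at g (\<lambda>_. G) x \<and> parallel_form_at \<omega> (\<lambda>_. G) x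
     \<and> alternating_form 3 (torsion g (\<lambda>_. G) x)"

definition char_conn :: "field \<Rightarrow> metric \<Rightarrow> christoffel" where
  "char_conn \<omega> g x = (SOME G. characteristic_at \<omega> g x G)"

lemma torsion_pointwise: "torsion g \<Gamma> x = torsion g (\<lambda>_. \<Gamma> x) x"
  by (simp add: torsion_def fun_eq_iff)

lemma characteristic_at_iff:
  "characteristic_at \<omega> g x (\<Gamma> x) \<longleftrightarrow> bilinear (\<Gamma> x) \<and> parallel_metric_at g \<Gamma> x \<and> parallel_form_at \<omega> \<Gamma> x \<and> alternating_form 3 (torsion g \<Gamma> x)"
  unfolding characteristic_at_def torsion_pointwise[of g \<Gamma> x] parallel_metric_at_def parallel_form_at_def ..

lemma alternating_form_pullback:
  assumes F: "alternating_form k F" and D: "linear D"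
  shows "alternating_form k (\<lambda>vs. F (map D vs))"
  unfolding alternating_form_def
proof (intro conjI allI impI)
  fix vs :: "vec7 list" and i j
  show "F (map D vs) = 0" if "length vs \<noteq> k" using alternating_form_zero[OF F] that by simp
  show "linear (\<lambda>v. F (map D (vs[i := v])))" if "length vs = k \<and> i < k"
  proof -
    have "linear (\<lambda>v. F ((map D vs)[i := v]))" using F that unfolding alternating_form_def by simp
    from linear_compose[OF D this] show ?thesis by (simp add: comp_def map_update)
  qed
  show "F (map D vs) = 0" if "length vs = k \<and> i < j \<and> j < k \<and> vs ! i = vs ! j"
  proof -
    have "length (map D vs) = k \<and> i < j \<and> j < k \<and> map D vs ! i = map D vs ! j" using that by simp
    then show ?thesis using F unfolding alternating_form_def by blast
  qed
qed

context adapted_chart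
begin

lemma characteristic_at_Gam: "integrable_on_chart \<Longrightarrow> y \<in> S \<Longrightarrow> characteristic_at \<omega> g y (Gam y)"
  unfolding characteristic_at_iff integrable_on_chart_def
  using bilinear_Gam Gam_characteristic torsion_alternating by blast

lemma characteristic_at_unique:
  assumes y: "y \<in> S" and "characteristic_at \<omega> g y G" "characteristic_at \<omega> g y G'"
  shows "G = G'"
proof (intro ext)
  fix u v show "G u v = G' u v"
    by (rule characteristic_unique[OF y, of "\<lambda>_. G" "\<lambda>_. G'"]) (use assms(2,3) in \<open>auto simp: characteristic_at_def\<close>)
qed

lemma char_conn_eq:
  assumes y: "y \<in> S" and "characteristic_at \<omega> g y G"
  shows "char_conn \<omega> g y = G"
  unfolding char_conn_def
proof (rule some_equality[where P = "characteristic_at \<omega> g y"])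
  show "G' = G" if "characteristic_at \<omega> g y G'" for G' by (rule characteristic_at_unique[OF y that assms(2)])
qed (rule assms(2))

lemma smooth_char_conn: assumes "integrable_on_chart" shows "smooth_on S (\<lambda>y. char_conn \<omega> g y u v)"
proof -
  have "char_conn \<omega> g y u v = Gam y u v" if "y \<in> S" for y
    using char_conn_eq[OF that characteristic_at_Gam[OF assms that]] by simp
  from smooth_on_cong[OF S this] show ?thesis using smooth_Gam by simp
qed

text \<open>Solving the transformation law for the connection in the source chart gives a bilinear map \<open>G\<close>. It is metric and
  preserves the pulled-back three-form by the chain rule. Its torsion is the pull-back of the torsion, because
  the second derivative of \<open>\<tau>\<close> is symmetric. By uniqueness it is the characteristic connection of the source.\<close>
lemma characteristic_at_pullback:
  assumes I: "integrable_on_chart" and U: "open U" "x \<in> U" "\<And>z. z \<in> U \<Longrightarrow> \<tau> z \<in> S" and \<tau>: "smooth_on U \<tau>"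
    and P: "adapted_chart S1 \<omega>1 g1 vol1 e1" "x \<in> S1"
    and \<omega>1: "\<And>z vs. z \<in> U \<Longrightarrow> \<omega>1 z vs = \<omega> (\<tau> z) (map (frechet_derivative \<tau> (at z)) vs)"
    and g1: "\<And>z u v. z \<in> U \<Longrightarrow> g1 z u v = g (\<tau> z) (frechet_derivative \<tau> (at z) u) (frechet_derivative \<tau> (at z) v)"
  shows "frechet_derivative \<tau> (at x) (char_conn \<omega>1 g1 x u v)
     = char_conn \<omega> g (\<tau> x) (frechet_derivative \<tau> (at x) u) (frechet_derivative \<tau> (at x) v)
       + frechet_derivative (\<lambda>z. frechet_derivative \<tau> (at z) v) (at x) u"
proof -
  interpret P: adapted_chart S1 \<omega>1 g1 vol1 e1 by (rule P(1))
  interpret F: frame_at g1 x vol1 "P.E x" by (rule P.frame[OF P(2)])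
  define D where "D z = frechet_derivative \<tau> (at z)" for z
  define DD where "DD v u = frechet_derivative (\<lambda>z. D z v) (at x) u" for v u
  define y where "y = \<tau> x"
  have y: "y \<in> S" using U(2,3) by (simp add: y_def)
  have D: "(\<tau> has_derivative D z) (at z)" if "z \<in> U" for z unfolding D_def by (rule smooth_on_D[OF \<tau> that])
  have Dlin: "linear (D z)" if "z \<in> U" for z by (rule has_derivative_linear[OF D[OF that]])
  note Dx = D[OF U(2)] and Dxlin = Dlin[OF U(2)]
  have DD: "((\<lambda>z. D z v) has_derivative DD v) (at x)" for v
    unfolding DD_def[abs_def] D_def using smooth_on_D[OF smooth_on_frechet_derivative[OF \<tau>] U(2)] by simp
  have DDlin: "linear (DD v)" "linear (\<lambda>v. DD v u)" for u v
    by (rule has_derivative_linear[OF DD], rule has_derivative_linear_arg[where f = D and D = "\<lambda>u v. DD v u", OF U(1,2) Dlin DD])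
  have DDsym: "DD u v = DD v u" for u v
    unfolding DD_def D_def by (rule second_derivative_symmetric[OF U(1,2)]) (use \<tau> in \<open>simp add: smooth_on_def\<close>)
  have g1': "g1 x u v = g y (D x u) (D x v)" for u v unfolding g1[OF U(2)] D_def y_def ..
  have \<omega>1': "\<omega>1 z vs = \<omega> (\<tau> z) (map (D z) vs)" if "z \<in> U" for z vs unfolding \<omega>1[OF that] D_def ..
  have "inj (D x)"
  proof (rule linear_injective_0[OF Dxlin, THEN iffD2], intro allI impI)
    fix w assume "D x w = 0"
    then have "g1 x w w = 0" by (simp add: g1' bilinear_lzero[OF g_bilinear[OF y]])
    then show "w = 0" using F.pos[of w] by fastforce
  qed
  then obtain Di where Di: "linear Di" "\<And>w. D x (Di w) = w"
    using linear_injective_isomorphism[OF Dxlin] by metis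
  define B where "B u v = Gam y (D x u) (D x v) + DD v u" for u v
  define G where "G u v = Di (B u v)" for u v
  have DG: "D x (G u v) = B u v" for u v by (simp add: G_def Di(2))
  note gb = bilinear_ladd[OF g_bilinear[OF y]] bilinear_radd[OF g_bilinear[OF y]] bilinear_lsub[OF g_bilinear[OF y]]
  note comp = linear_compose[unfolded comp_def]
  have Glin: "linear (Gam y a)" "linear (\<lambda>a. Gam y a b)" for a b using bilinear_Gam[OF y] by (auto simp: bilinear_def)
  have "linear (\<lambda>v. G u v)" "linear (\<lambda>u. G u v)" for u v
    unfolding G_def B_def
    by (intro comp[OF _ Di(1)] linear_compose_add DDlin comp[OF Dxlin Glin(1)] comp[OF Dxlin Glin(2)])+
  then have bil: "bilinear G" by (simp add: bilinear_def)
  have par_g: "parallel_metric_at g1 (\<lambda>_. G) x"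
    unfolding parallel_metric_at_def
  proof (intro allI)
    fix u v w
    have "frechet_derivative (\<lambda>z. g1 z v w) (at x) = frechet_derivative (\<lambda>z. g (\<tau> z) (D z v) (D z w)) (at x)"
      by (rule frechet_derivative_cong_open[OF U(1,2)]) (simp add: g1 D_def)
    also have "\<dots> = (\<lambda>u. g y (W y (D x u) (D x v) + DD v u) (D x w) + g y (D x v) (W y (D x u) (D x w) + DD w u))"
      unfolding y_def by (rule frechet_derivative_at[symmetric], rule g_pullback_derivative[OF U Dx DD DD])
    finally show "frechet_derivative (\<lambda>z. g1 z v w) (at x) u - g1 x (G u v) w - g1 x v (G u w) = 0"
      using Gam_metric[OF y, of "D x u" "D x v" "D x w"] unfolding g1' DG B_def dg_def by (simp add: gb)
  qed
  have par_\<omega>: "parallel_form_at \<omega>1 (\<lambda>_. G) x"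
    unfolding P.parallel_form_iff[OF P(2)]
  proof (intro allI impI)
    fix u and vs :: "vec7 list" assume len: "length vs = 3"
    then obtain p q r where vs: "vs = [p, q, r]" by (auto simp: length_Suc_conv numeral_3_eq_3)
    note m = multilinear_3[OF \<omega>_multilinear[OF y]]
    have Iy: "integrable_at y" using I y by (simp add: integrable_on_chart_def)
    have "frechet_derivative (\<lambda>z. \<omega>1 z vs) (at x) = frechet_derivative (\<lambda>z. \<omega> (\<tau> z) [D z p, D z q, D z r]) (at x)"
      by (rule frechet_derivative_cong_open[OF U(1,2)]) (simp add: \<omega>1' vs)
    also have "\<dots> = (\<lambda>u. \<omega> y [W y (D x u) (D x p) + DD p u, D x q, D x r] + \<omega> y [D x p, W y (D x u) (D x q) + DD q u, D x r]
        + \<omega> y [D x p, D x q, W y (D x u) (D x r) + DD r u])"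
      unfolding y_def by (rule frechet_derivative_at[symmetric], rule \<omega>_pullback_derivative[OF U Dx DD DD DD])
    finally have "frechet_derivative (\<lambda>z. \<omega>1 z vs) (at x) u = act (G u) (\<omega>1 x) vs"
      using Gam_parallel[OF y Iy, of "[D x p, D x q, D x r]" "D x u"]
      unfolding vs act_list3 \<omega>1'[OF U(2)] list.map DG B_def y_def[symmetric] linear_add[OF m(1)] linear_add[OF m(2)] linear_add[OF m(3)]
      by simp
    moreover have "frechet_derivative (\<lambda>z. \<omega>1 z vs) (at x) u = act (P.W x u) (\<omega>1 x) vs"
      using frechet_derivative_at[OF P.\<omega>_derivative[OF P(2) len]] by metis
    ultimately show "act (G u) (\<omega>1 x) vs = act (P.W x u) (\<omega>1 x) vs" by simp
  qed
  have "torsion g1 (\<lambda>_. G) x vs = torsion g Gam y (map (D x) vs)" for vs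
  proof (cases "length vs = 3")
    case True
    then obtain p q r where vs: "vs = [p, q, r]" by (auto simp: length_Suc_conv numeral_3_eq_3)
    show ?thesis
      unfolding vs torsion_def g1' linear_diff[OF Dxlin] DG B_def DDsym[of "[p, q, r] ! 0"]
      by (simp add: numeral_3_eq_3 DDsym[of p q])
  qed (simp add: torsion_def)
  then have "torsion g1 (\<lambda>_. G) x = (\<lambda>vs. torsion g Gam y (map (D x) vs))" by blast
  then have "alternating_form 3 (torsion g1 (\<lambda>_. G) x)"
    using alternating_form_pullback[OF torsion_alternating[OF y] Dxlin] by simp
  then have "characteristic_at \<omega>1 g1 x G" using bil par_g par_\<omega> by (simp add: characteristic_at_def)
  then have 1: "char_conn \<omega>1 g1 x = G" by (rule P.char_conn_eq[OF P(2)])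
  have 2: "char_conn \<omega> g y = Gam y" by (rule char_conn_eq[OF y characteristic_at_Gam[OF I y]])
  show ?thesis
    using DG[of u v] unfolding 1 y_def[symmetric] 2 D_def[symmetric] B_def DD_def .
qed

end

text \<open>The domain of a transition map is open because charts are open maps.\<close>
lemma overlap_properties:
  assumes "smooth_atlas X A" "c \<in> A" "c' \<in> A"
  shows "open (overlap c c')" "overlap c c' \<subseteq> chart_image c" "smooth_on (overlap c c') (transition c c')"
    and "x \<in> overlap c c' \<Longrightarrow> transition c c' x \<in> chart_image c'"
proof -
  have c: "openin X (fst c)" "open (chart_image c)" "homeomorphic_map (subtopology X (fst c)) (top_of_set (chart_image c)) (snd c)"
    and c': "openin X (fst c')"
    and sm: "smooth_on (overlap c c') (transition c c')"
    using assms unfolding smooth_atlas_def by blast+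
  show "smooth_on (overlap c c') (transition c c')" by (rule sm)
  show "overlap c c' \<subseteq> chart_image c" by (auto simp: overlap_def chart_image_def)
  have "openin (subtopology X (fst c)) (fst c \<inter> fst c')"
    using c(1) c' by (simp add: openin_open_subtopology openin_Int)
  then have "openin (top_of_set (chart_image c)) (overlap c c')"
    using homeomorphic_imp_open_map[OF c(3)] unfolding open_map_def overlap_def by blast
  then show "open (overlap c c')" using c(2) openin_open_eq by blast
  have "topspace (subtopology X (fst c)) = fst c" using openin_subset[OF c(1)] by auto
  then have inj: "inj_on (snd c) (fst c)" using homeomorphic_imp_injective_map[OF c(3)] by simp
  show "transition c c' x \<in> chart_image c'" if "x \<in> overlap c c'"
    using that inj by (auto simp: overlap_def transition_def chart_image_def)
qed

text \<open>Every point has an adapted coframe nearby, and the global hypotheses restrict to its domain.\<close>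
lemma adapted_chart_at:
  assumes G2: "G2_structure A \<omega> g vol" and int: "integrable_G2 A \<omega> g vol" and c: "c \<in> A" and x: "x \<in> chart_image c"
  obtains S e where "x \<in> S" "S \<subseteq> chart_image c" "adapted_chart S (\<omega> c) (g c) (vol c) e"
    "adapted_chart.integrable_on_chart S (\<omega> c) (g c) (vol c)"
proof -
  obtain S e where N: "open S" "x \<in> S" "S \<subseteq> chart_image c" "adapted_coframe_on S (\<omega> c) (g c) (vol c) e"
    using G2 c x unfolding G2_structure_def by meson
  have "alternating_form 3 (\<omega> c y)" "alternating_form 7 (vol c y)" if "y \<in> S" for y
    using G2 c that N(3) unfolding G2_structure_def differential_form_def smooth_form_on_def by blast+
  then have chart: "adapted_chart S (\<omega> c) (g c) (vol c) e" using N by unfold_locales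
  then interpret adapted_chart S "\<omega> c" "g c" "vol c" e .
  have "integrable_on_chart"
    unfolding integrable_on_chart_def integrable_at_def using int c N(3) unfolding integrable_G2_def by blast
  with N chart that show thesis by blast
qed

lemma characteristic_connection_exists:
  assumes M: "smooth_atlas X A" and G2: "G2_structure A \<omega> g vol" and int: "integrable_G2 A \<omega> g vol"
  shows "characteristic_connection A \<omega> g (\<lambda>c. char_conn (\<omega> c) (g c))"
proof -
  have char: "characteristic_at (\<omega> c) (g c) x (char_conn (\<omega> c) (g c) x)" if c: "c \<in> A" and x: "x \<in> chart_image c" for c x
  proof -
    obtain S e where N: "x \<in> S" "adapted_chart S (\<omega> c) (g c) (vol c) e" "adapted_chart.integrable_on_chart S (\<omega> c) (g c) (vol c)"
      using adapted_chart_at[OF G2 int c x] by metis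
    interpret adapted_chart S "\<omega> c" "g c" "vol c" e by (rule N(2))
    show ?thesis
      using characteristic_at_Gam[OF N(3,1)] char_conn_eq[OF N(1)] by simp
  qed
  have smooth: "smooth_on (chart_image c) (\<lambda>x. char_conn (\<omega> c) (g c) x u v)" if c: "c \<in> A" for c u v
    unfolding smooth_on_def
  proof (intro allI times_diff_on_local)
    fix n x assume x: "x \<in> chart_image c"
    obtain S e where N: "x \<in> S" "adapted_chart S (\<omega> c) (g c) (vol c) e" "adapted_chart.integrable_on_chart S (\<omega> c) (g c) (vol c)"
      using adapted_chart_at[OF G2 int c x] by metis
    interpret adapted_chart S "\<omega> c" "g c" "vol c" e by (rule N(2))
    show "\<exists>U. open U \<and> x \<in> U \<and> times_diff_on n U (\<lambda>x. char_conn (\<omega> c) (g c) x u v)"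
      using N(1) S smooth_char_conn[OF N(3)] unfolding smooth_on_def by blast
  qed
  have law: "frechet_derivative (transition c c') (at x) (char_conn (\<omega> c) (g c) x u v)
     = char_conn (\<omega> c') (g c') (transition c c' x) (frechet_derivative (transition c c') (at x) u) (frechet_derivative (transition c c') (at x) v)
       + frechet_derivative (\<lambda>z. frechet_derivative (transition c c') (at z) v) (at x) u"
    if c: "c \<in> A" "c' \<in> A" and x: "x \<in> overlap c c'" for c c' x u v
  proof -
    note ov = overlap_properties[OF M c]
    let ?\<tau> = "transition c c'"
    obtain S e where N: "?\<tau> x \<in> S" "adapted_chart S (\<omega> c') (g c') (vol c') e" "adapted_chart.integrable_on_chart S (\<omega> c') (g c') (vol c')"
      using adapted_chart_at[OF G2 int c(2) ov(4)[OF x]] by metis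
    obtain S1 e1 where S1: "x \<in> S1" "adapted_chart S1 (\<omega> c) (g c) (vol c) e1"
      using adapted_chart_at[OF G2 int c(1)] x ov(2) by (metis subsetD)
    interpret adapted_chart S "\<omega> c'" "g c'" "vol c'" e by (rule N(2))
    define U where "U = overlap c c' \<inter> ?\<tau> -` S"
    have "continuous_on (overlap c c') ?\<tau>" using ov(3) unfolding smooth_on_def by (metis times_diff_on.simps(1))
    then have "open U" unfolding U_def by (rule continuous_open_preimage[OF _ ov(1) S])
    moreover have "smooth_on U ?\<tau>"
      using ov(3) times_diff_on_subset[of _ "overlap c c'" ?\<tau> U] unfolding smooth_on_def U_def by blast
    moreover have "\<omega> c z vs = \<omega> c' (?\<tau> z) (map (frechet_derivative ?\<tau> (at z)) vs)"
      "g c z u v = g c' (?\<tau> z) (frechet_derivative ?\<tau> (at z) u) (frechet_derivative ?\<tau> (at z) v)" if "z \<in> U" for z vs u v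
    proof -
      have "differential_form A 3 \<omega>" "riemannian_metric A g" "z \<in> overlap c c'"
        using G2 that by (simp_all add: G2_structure_def U_def)
      then show "\<omega> c z vs = \<omega> c' (?\<tau> z) (map (frechet_derivative ?\<tau> (at z)) vs)"
        "g c z u v = g c' (?\<tau> z) (frechet_derivative ?\<tau> (at z) u) (frechet_derivative ?\<tau> (at z) v)"
        using c unfolding differential_form_def riemannian_metric_def by meson+
    qed
    moreover have "x \<in> U" "\<And>z. z \<in> U \<Longrightarrow> ?\<tau> z \<in> S" using x N(1) by (auto simp: U_def)
    ultimately show ?thesis
      by (intro characteristic_at_pullback[OF N(3) _ _ _ _ S1(2) S1(1), of U])
  qed
  show ?thesis
    unfolding characteristic_connection_def linear_connection_def Let_def
    using char smooth law unfolding characteristic_at_iff by blast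
qed

theorem theorem1p1:
  fixes X :: "'m topology" and A :: "'m chart set"
    and \<omega> vol :: "'m chart \<Rightarrow> field" and g :: "'m chart \<Rightarrow> metric"
  assumes "smooth_manifold X A"
    and "G2_structure A \<omega> g vol"
    and "integrable_G2 A \<omega> g vol"
  shows "\<exists>\<Gamma>. characteristic_connection A \<omega> g \<Gamma> \<and>
    (\<forall>\<Gamma>'. characteristic_connection A \<omega> g \<Gamma>' \<longrightarrow>
      (\<forall>c\<in>A. \<forall>x\<in>chart_image c. \<Gamma>' c x = \<Gamma> c x)) \<and>
    (\<forall>c\<in>A. \<forall>x\<in>chart_image c.
      let star = hodge (g c) (vol c);
          \<delta> = codiff (g c) (vol c);
          d\<omega> = ext_deriv (\<omega> c);
          \<theta> = lee_form (\<omega> c) (g c) (vol c);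
          T = torsion (g c) (\<Gamma> c);
          a = form_inner 4 (g c) d\<omega> (star (\<omega> c)) x
      in
        scalar_curvature (g c) x =
          1/18 * a\<^sup>2 + 2 * form_inner 1 (g c) \<theta> \<theta> x
          - 1/12 * tensor3_norm_sq (g c) T x + 3 * \<delta> \<theta> x [] \<and>
        (\<forall>vs. length vs = 3 \<longrightarrow>
          T x vs = - star d\<omega> x vs + 1/6 * a * \<omega> c x vs + star (\<theta> \<and>\<^sub>f \<omega> c) x vs) \<and>
        (\<forall>v. \<theta> x [v] = - (1/3) * star (star d\<omega> \<and>\<^sub>f \<omega> c) x [v] \<and>
             \<theta> x [v] = - (1/3) * star (\<delta> (\<omega> c) \<and>\<^sub>f star (\<omega> c)) x [v]))"
proof (intro exI[of _ "\<lambda>c. char_conn (\<omega> c) (g c)"] conjI allI impI ballI)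
  show "characteristic_connection A \<omega> g (\<lambda>c. char_conn (\<omega> c) (g c))"
    using characteristic_connection_exists assms unfolding smooth_manifold_def by blast
next
  fix \<Gamma>' c x assume \<Gamma>': "characteristic_connection A \<omega> g \<Gamma>'" and c: "c \<in> A" and x: "x \<in> chart_image c"
  obtain S e where N: "x \<in> S" "adapted_chart S (\<omega> c) (g c) (vol c) e"
    using adapted_chart_at[OF assms(2,3) c x] by metis
  have "characteristic_at (\<omega> c) (g c) x (\<Gamma>' c x)"
    using \<Gamma>' c x unfolding characteristic_at_iff[of _ _ _ "\<Gamma>' c"] characteristic_connection_def linear_connection_def by blast
  from adapted_chart.char_conn_eq[OF N(2,1) this] show "\<Gamma>' c x = char_conn (\<omega> c) (g c) x" by simp
next
  fix c x assume c: "c \<in> A" and x: "x \<in> chart_image c"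
  obtain S e where N: "x \<in> S" "adapted_chart S (\<omega> c) (g c) (vol c) e" "adapted_chart.integrable_on_chart S (\<omega> c) (g c) (vol c)"
    using adapted_chart_at[OF assms(2,3) c x] by metis
  interpret adapted_chart S "\<omega> c" "g c" "vol c" e by (rule N(2))
  have "char_conn (\<omega> c) (g c) x = Gam x" by (rule char_conn_eq[OF N(1) characteristic_at_Gam[OF N(3,1)]])
  then have T: "torsion (g c) (char_conn (\<omega> c) (g c)) x = torsion (g c) Gam x"
    by (simp add: torsion_pointwise[of "g c" Gam] torsion_pointwise[of "g c" "char_conn (\<omega> c) (g c)"])
  have norm: "tensor3_norm_sq (g c) (torsion (g c) (char_conn (\<omega> c) (g c))) x = tensor3_norm_sq (g c) (torsion (g c) Gam) x"
    unfolding tensor3_norm_sq_def T ..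
  have Ix: "integrable_at x" using N(1,3) by (simp add: integrable_on_chart_def)
  show "let star = hodge (g c) (vol c);
          \<delta> = codiff (g c) (vol c);
          d\<omega> = ext_deriv (\<omega> c);
          \<theta> = lee_form (\<omega> c) (g c) (vol c);
          T = torsion (g c) (char_conn (\<omega> c) (g c));
          a = form_inner 4 (g c) d\<omega> (star (\<omega> c)) x
      in
        scalar_curvature (g c) x =
          1/18 * a\<^sup>2 + 2 * form_inner 1 (g c) \<theta> \<theta> x
          - 1/12 * tensor3_norm_sq (g c) T x + 3 * \<delta> \<theta> x [] \<and>
        (\<forall>vs. length vs = 3 \<longrightarrow>
          T x vs = - star d\<omega> x vs + 1/6 * a * \<omega> c x vs + star (\<theta> \<and>\<^sub>f \<omega> c) x vs) \<and>
        (\<forall>v. \<theta> x [v] = - (1/3) * star (star d\<omega> \<and>\<^sub>f \<omega> c) x [v] \<and>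
             \<theta> x [v] = - (1/3) * star (\<delta> (\<omega> c) \<and>\<^sub>f star (\<omega> c)) x [v])"
    unfolding Let_def norm T
    using scalar_curvature_chart[OF N(3,1)] torsion_formula[OF N(1)] lee_from_codiff[OF N(1) Ix] lee_form_def
    by blast
qed

end
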